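(* Let $L$ be a lattice of signature $(2,n)$ with $n\ge3$ and let $J\subset L$ be a primitive isotropic sublattice of rank $2$. Let $0\subset\mathcal E_J\subset\mathcal E_J^{\perp}\subset\mathcal E$ be the $J$-filtration on the second Hodge bundle $\mathcal E$ over $\mathcal D$. There are $\Gamma(J)_{\mathbb R}$-equivariant isomorphisms $$\mathcal E_J\simeq\pi^{\ast}\mathcal L_J,\qquad \mathcal E_J^{\perp}/\mathcal E_J\simeq V(J)\otimes\mathcal O_{\mathcal D},\qquad \mathcal E/\mathcal E_J^{\perp}\simeq\pi^{\ast}\mathcal L_J^{-1}.$$
   Context: A lattice is a free $\mathbb Z$-module of finite rank with a nondegenerate symmetric bilinear form $(\cdot,\cdot)$ with values in $\mathbb Z$; $L_F=L\otimes_{\mathbb Z}F$. $\mathcal D$ is a fixed connected component of $\{[\omega]\in\mathbb P(L_{\mathbb C}) : (\omega,\omega)=0,\ (\omega,\bar\omega)>0\}$. Over $\mathcal D$: $\mathcal L\subset L_{\mathbb C}\otimes\mathcal O_{\mathcal D}$ is the tautological line bundle (fiber $\mathbb C\omega$ at $[\omega]$) and $\mathcal E=\mathcal L^\perp/\mathcal L$ is the second Hodge bundle (fiber $\omega^\perp/\mathbb C\omega$), with the induced nondegenerate quadratic form. $V(J)=(J^\perp/J)_{\mathbb C}$. $\Gamma(J)_{\mathbb R}$ is the group of isometries in $\mathrm O(L_{\mathbb R})$ preserving $J_{\mathbb R}$ and acting trivially on $\wedge^2J_{\mathbb R}$ and on $(J^\perp/J)_{\mathbb R}$. The linear projection $\mathbb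 PL_{\mathbb C}\dashrightarrow\mathbb P(L/J^\perp)_{\mathbb C}$ restricts to $\pi:\mathcal D\to\mathbb H_J$, where $\mathbb H_J$ (the image) is a connected component of $\mathbb P(L/J^\perp)_{\mathbb C}\setminus\mathbb P(L/J^\perp)_{\mathbb R}$ (an upper half plane); $\mathcal L_J=\mathcal O_{\mathbb P(L/J^\perp)_{\mathbb C}}(-1)|_{\mathbb H_J}$, on which $\Gamma(J)_{\mathbb R}$ acts equivariantly. $\mathcal E_J\subset\mathcal E$ is the isotropic sub line bundle whose fiber at $[\omega]$ is the image of $\omega^\perp\cap J_{\mathbb C}$ in $\omega^\perp/\mathbb C\omega$, and $\mathcal E_J^\perp$ is its orthogonal complement in $\mathcal E$. $\Gamma(J)_{\mathbb R}$ acts trivially on the factor $V(J)$. *)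

theory Defs
  imports "HOL-Analysis.Analysis"
begin

section \<open>Lattices\<close>

text \<open>
  A lattice of rank \<open>m\<close> is \<open>\<int>\<^sup>m\<close> (that is, a free \<open>\<int>\<close>-module with a chosen basis)
  together with an arbitrary integral form \<open>b\<close>; for a field \<open>F\<close>, the space \<open>L\<^sub>F\<close> is \<open>F\<^sup>m\<close>.
\<close>

definition lattice_form :: "(int^'m \<Rightarrow> int^'m \<Rightarrow> int) \<Rightarrow> bool" where
  "lattice_form b \<longleftrightarrow>
     (\<forall>x y. b x y = b y x) \<and>
     (\<forall>x y z. b (x + y) z = b x z + b y z) \<and>
     (\<forall>x. (\<forall>y. b x y = 0) \<longrightarrow> x = 0)"

definition form_ext :: "(int^'m \<Rightarrow> int^'m \<Rightarrow> int) \<Rightarrow> 'a::field^'m \<Rightarrow> 'a^'m \<Rightarrow> 'a" where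
  "form_ext b x y = (\<Sum>i\<in>UNIV. \<Sum>j\<in>UNIV. of_int (b (axis i 1) (axis j 1)) * x $ i * y $ j)"

definition signature :: "(real^'m \<Rightarrow> real^'m \<Rightarrow> real) \<Rightarrow> nat \<Rightarrow> nat \<Rightarrow> bool" where
  "signature q r s \<longleftrightarrow>
     (\<exists>P N. subspace P \<and> subspace N \<and> dim P = r \<and> dim N = s \<and>
        (\<forall>x\<in>P. x \<noteq> 0 \<longrightarrow> q x x > 0) \<and> (\<forall>x\<in>N. x \<noteq> 0 \<longrightarrow> q x x < 0) \<and>
        (\<forall>x\<in>P. \<forall>y\<in>N. q x y = 0) \<and> {x + y |x y. x \<in> P \<and> y \<in> N} = UNIV)"

definition sublattice :: "(int^'m) set \<Rightarrow> bool" where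
  "sublattice J \<longleftrightarrow> module.subspace (*s) J"

definition has_rank :: "(int^'m) set \<Rightarrow> nat \<Rightarrow> bool" where
  "has_rank J r \<longleftrightarrow>
     (\<exists>S. finite S \<and> card S = r \<and> \<not> module.dependent (*s) S \<and> module.span (*s) S = J)"

definition primitive :: "(int^'m) set \<Rightarrow> bool" where
  "primitive J \<longleftrightarrow> (\<forall>k x. k \<noteq> 0 \<longrightarrow> k *s x \<in> J \<longrightarrow> x \<in> J)"

definition isotropic :: "(int^'m \<Rightarrow> int^'m \<Rightarrow> int) \<Rightarrow> (int^'m) set \<Rightarrow> bool" where
  "isotropic b J \<longleftrightarrow> (\<forall>x\<in>J. \<forall>y\<in>J. b x y = 0)"

definition lperp :: "(int^'m \<Rightarrow> int^'m \<Rightarrow> int) \<Rightarrow> (int^'m) set \<Rightarrow> (int^'m) set" where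
  "lperp b J = {x. \<forall>y\<in>J. b x y = 0}"

text \<open>The subspace \<open>M\<^sub>F\<close> of \<open>L\<^sub>F\<close> attached to a sublattice \<open>M\<close>.\<close>

definition scalars_ext :: "(int^'m) set \<Rightarrow> ('a::field^'m) set" where
  "scalars_ext M = vec.span ((\<lambda>x. \<chi> i. of_int (x $ i)) ` M)"


section \<open>Complex vector spaces with explicit carrier\<close>

text \<open>
  Fibres are subquotients of one ambient space, so they are not types. Elements of a quotient
  are cosets. Note that scalar multiplication of a coset by \<open>0\<close> has to give the zero coset,
  hence the summand from \<open>K\<close> in \<open>quot_vs\<close>.
\<close>

record 'v cvs =
  carr :: "'v set"
  zer :: "'v"
  add :: "'v \<Rightarrow> 'v \<Rightarrow> 'v"
  scl :: "complex \<Rightarrow> 'v \<Rightarrow> 'v"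

definition full_vs :: "(complex^'m) cvs" where
  "full_vs = \<lparr>carr = UNIV, zer = 0, add = (+), scl = (*s)\<rparr>"

definition coset :: "'v cvs \<Rightarrow> 'v set \<Rightarrow> 'v \<Rightarrow> 'v set" where
  "coset V K v = {add V v k |k. k \<in> K}"

definition sub_vs :: "'v cvs \<Rightarrow> 'v set \<Rightarrow> 'v cvs" where
  "sub_vs V S = V\<lparr>carr := S\<rparr>"

definition quot_vs :: "'v cvs \<Rightarrow> 'v set \<Rightarrow> 'v set cvs" where
  "quot_vs V K =
     \<lparr>carr = coset V K ` carr V,
      zer = K,
      add = (\<lambda>A B. {add V a b |a b. a \<in> A \<and> b \<in> B}),
      scl = (\<lambda>c A. {add V (scl V c a) k |a k. a \<in> A \<and> k \<in> K})\<rparr>"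

definition clinear_map :: "'v cvs \<Rightarrow> 'w cvs \<Rightarrow> ('v \<Rightarrow> 'w) \<Rightarrow> bool" where
  "clinear_map V W f \<longleftrightarrow>
     (\<forall>u\<in>carr V. f u \<in> carr W) \<and>
     (\<forall>u\<in>carr V. \<forall>v\<in>carr V. f (add V u v) = add W (f u) (f v)) \<and>
     (\<forall>c. \<forall>v\<in>carr V. f (scl V c v) = scl W c (f v))"

definition dual_vs :: "'v cvs \<Rightarrow> ('v \<Rightarrow> complex) cvs" where
  "dual_vs V =
     \<lparr>carr = {f. clinear_map V \<lparr>carr = UNIV, zer = 0, add = (+), scl = (*)\<rparr> f
               \<and> f \<in> extensional (carr V)},
      zer = (\<lambda>v\<in>carr V. 0),
      add = (\<lambda>f g. \<lambda>v\<in>carr V. f v + g v),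
      scl = (\<lambda>c f. \<lambda>v\<in>carr V. c * f v)\<rparr>"

definition lincomb :: "'v cvs \<Rightarrow> (complex \<times> 'v) list \<Rightarrow> 'v" where
  "lincomb V xs = foldr (\<lambda>(c, v). add V (scl V c v)) xs (zer V)"


section \<open>Complex spaces\<close>

definition holo_on :: "(complex^'m \<Rightarrow> complex) \<Rightarrow> (complex^'m) set \<Rightarrow> bool" where
  "holo_on f S \<longleftrightarrow>
     (\<forall>z\<in>S. \<exists>f'. (f has_derivative f') (at z) \<and> (\<forall>c v. f' (c *s v) = c * f' v))"

text \<open>A topological space with, for each open set, the functions regarded as holomorphic there.\<close>

record 'x cspace =
  top_of :: "'x topology"
  hol_of :: "'x set \<Rightarrow> ('x \<Rightarrow> complex) set"

text \<open>
  The projective space \<open>\<bbbP>(W)\<close> of a finite-dimensional space \<open>W\<close>, presented by a linear surjection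
  \<open>p\<close> from \<open>\<complex>\<^sup>m\<close> onto \<open>W\<close>. Its points are the lines in \<open>W\<close>; topology and holomorphic functions are
  the ones induced by the map \<open>v \<mapsto> [p v]\<close>, which is defined for \<open>p v \<noteq> 0\<close>.
\<close>

definition pline :: "(complex^'m \<Rightarrow> 'w) \<Rightarrow> complex^'m \<Rightarrow> 'w set" where
  "pline p v = range (\<lambda>c. p (c *s v))"

definition proj_points :: "(complex^'m \<Rightarrow> 'w) \<Rightarrow> 'w set set" where
  "proj_points p = {pline p v |v. p v \<noteq> p 0}"

definition proj_space :: "(complex^'m \<Rightarrow> 'w) \<Rightarrow> 'w set cspace" where
  "proj_space p =
     \<lparr>top_of = topology (\<lambda>U. U \<subseteq> proj_points p \<and> open {v. pline p v \<in> U}),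
      hol_of = (\<lambda>U. {f. holo_on (\<lambda>v. f (pline p v)) {v. pline p v \<in> U}})\<rparr>"

lemma openin_proj_space:
  "openin (top_of (proj_space p)) U \<longleftrightarrow> U \<subseteq> proj_points p \<and> open {v. pline p v \<in> U}"
proof -
  have "istopology (\<lambda>U. U \<subseteq> proj_points p \<and> open {v. pline p v \<in> U})"
    unfolding istopology_def
  proof (intro conjI allI impI)
    fix S T
    assume "S \<subseteq> proj_points p \<and> open {v. pline p v \<in> S}"
      and "T \<subseteq> proj_points p \<and> open {v. pline p v \<in> T}"
    moreover have "{v. pline p v \<in> S \<inter> T} = {v. pline p v \<in> S} \<inter> {v. pline p v \<in> T}"
      by auto
    ultimately show "S \<inter> T \<subseteq> proj_points p" "open {v. pline p v \<in> S \<inter> T}"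
      by auto
  next
    fix \<K>
    assume "\<forall>K\<in>\<K>. K \<subseteq> proj_points p \<and> open {v. pline p v \<in> K}"
    moreover have "{v. pline p v \<in> \<Union>\<K>} = (\<Union>K\<in>\<K>. {v. pline p v \<in> K})"
      by auto
    ultimately show "\<Union>\<K> \<subseteq> proj_points p" "open {v. pline p v \<in> \<Union>\<K>}"
      by auto
  qed
  then show ?thesis
    by (simp add: proj_space_def topology_inverse')
qed

text \<open>
  Structure induced on a (locally closed) submanifold: holomorphic functions are those that locally
  extend to holomorphic functions on the ambient space.
\<close>

definition subspace_of :: "'x cspace \<Rightarrow> 'x set \<Rightarrow> 'x cspace" where
  "subspace_of X S =
     \<lparr>top_of = subtopology (top_of X) S,
      hol_of = (\<lambda>U. {f. \<forall>x\<in>U. \<exists>V g. openin (top_of X) V \<and> x \<in> V \<and> g \<in> hol_of X V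
                                  \<and> (\<forall>y\<in>U \<inter> V. f y = g y)})\<rparr>"


section \<open>Equivariant holomorphic vector bundles\<close>

text \<open>
  Fibres, holomorphic sections over open sets, and the linear maps \<open>act g x\<close> from the fibre at
  \<open>x\<close> to the fibre at \<open>g x\<close>. The values of a section outside the open set are irrelevant.
\<close>

record ('g, 'x, 'v) ebundle =
  fibre :: "'x \<Rightarrow> 'v cvs"
  sections :: "'x set \<Rightarrow> ('x \<Rightarrow> 'v) set"
  act :: "'g \<Rightarrow> 'x \<Rightarrow> 'v \<Rightarrow> 'v"

text \<open>\<open>W \<otimes> \<O>\<^sub>X\<close>: sections are locally of the form \<open>\<Sum>\<^sub>i f\<^sub>i \<otimes> w\<^sub>i\<close> with \<open>f\<^sub>i\<close> holomorphic.\<close>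

definition trivial_bundle ::
    "'x cspace \<Rightarrow> 'v cvs \<Rightarrow> ('g \<Rightarrow> 'v \<Rightarrow> 'v) \<Rightarrow> ('g, 'x, 'v) ebundle" where
  "trivial_bundle X W \<rho> =
     \<lparr>fibre = (\<lambda>_. W),
      sections = (\<lambda>U. {s. \<forall>x\<in>U. \<exists>U' fws. openin (top_of X) U' \<and> x \<in> U' \<and> U' \<subseteq> U \<and>
          (\<forall>(f, w)\<in>set fws. f \<in> hol_of X U' \<and> w \<in> carr W) \<and>
          (\<forall>y\<in>U'. s y = lincomb W (map (\<lambda>(f, w). (f y, w)) fws))}),
      act = (\<lambda>g _. \<rho> g)\<rparr>"

definition sub_bundle ::
    "('g, 'x, 'v) ebundle \<Rightarrow> ('x \<Rightarrow> 'v set) \<Rightarrow> ('g, 'x, 'v) ebundle" where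
  "sub_bundle E S =
     \<lparr>fibre = (\<lambda>x. sub_vs (fibre E x) (S x)),
      sections = (\<lambda>U. {s \<in> sections E U. \<forall>x\<in>U. s x \<in> S x}),
      act = act E\<rparr>"

definition quotient_bundle ::
    "'x cspace \<Rightarrow> ('g, 'x, 'v) ebundle \<Rightarrow> ('x \<Rightarrow> 'v set) \<Rightarrow> ('g, 'x, 'v set) ebundle" where
  "quotient_bundle X E S =
     \<lparr>fibre = (\<lambda>x. quot_vs (fibre E x) (S x)),
      sections = (\<lambda>U. {s. \<forall>x\<in>U. \<exists>U'. openin (top_of X) U' \<and> x \<in> U' \<and> U' \<subseteq> U \<and>
          (\<exists>t\<in>sections E U'. \<forall>y\<in>U'. s y = coset (fibre E y) (S y) (t y))}),
      act = (\<lambda>g x A. act E g x ` A)\<rparr>"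

text \<open>
  Sections of the dual are those pairing holomorphically with local sections; \<open>g\<close> acts by
  \<open>f \<mapsto> f \<circ> g\<^sup>-\<^sup>1\<close>.
\<close>

definition dual_bundle ::
    "'x cspace \<Rightarrow> ('g, 'x, 'v) ebundle \<Rightarrow> ('g, 'x, 'v \<Rightarrow> complex) ebundle" where
  "dual_bundle X E =
     \<lparr>fibre = (\<lambda>x. dual_vs (fibre E x)),
      sections = (\<lambda>U. {s. (\<forall>x\<in>U. s x \<in> carr (dual_vs (fibre E x))) \<and>
          (\<forall>U' t. openin (top_of X) U' \<longrightarrow> U' \<subseteq> U \<longrightarrow> t \<in> sections E U' \<longrightarrow>
             (\<lambda>x. s x (t x)) \<in> hol_of X U')}),
      act = (\<lambda>g x f. \<lambda>w\<in>act E g x ` carr (fibre E x).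
               f (inv_into (carr (fibre E x)) (act E g x) w))\<rparr>"

text \<open>\<open>\<pi>\<^sup>*E = \<O>\<^sub>X \<otimes> \<pi>\<^sup>-\<^sup>1E\<close>: sections are locally of the form \<open>\<Sum>\<^sub>i f\<^sub>i \<cdot> (t\<^sub>i \<circ> \<pi>)\<close>.\<close>

definition pullback_bundle ::
    "'x cspace \<Rightarrow> 'y cspace \<Rightarrow> ('x \<Rightarrow> 'y) \<Rightarrow> ('g, 'y, 'v) ebundle \<Rightarrow> ('g, 'x, 'v) ebundle" where
  "pullback_bundle X Y \<pi> E =
     \<lparr>fibre = (\<lambda>x. fibre E (\<pi> x)),
      sections = (\<lambda>U. {s. \<forall>x\<in>U. \<exists>U' V fts. openin (top_of X) U' \<and> x \<in> U' \<and> U' \<subseteq> U \<and>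
          openin (top_of Y) V \<and> \<pi> ` U' \<subseteq> V \<and>
          (\<forall>(f, t)\<in>set fts. f \<in> hol_of X U' \<and> t \<in> sections E V) \<and>
          (\<forall>y\<in>U'. s y = lincomb (fibre E (\<pi> y)) (map (\<lambda>(f, t). (f y, t (\<pi> y))) fts))}),
      act = (\<lambda>g x. act E g (\<pi> x))\<rparr>"

text \<open>
  \<open>E\<close> and \<open>F\<close> are isomorphic as \<open>G\<close>-equivariant holomorphic bundles over \<open>X\<close>, where \<open>G\<close> acts on
  \<open>X\<close> by \<open>\<beta>\<close>.
\<close>

definition equiv_iso ::
    "'x cspace \<Rightarrow> 'g set \<Rightarrow> ('g \<Rightarrow> 'x \<Rightarrow> 'x) \<Rightarrow>
     ('g, 'x, 'v) ebundle \<Rightarrow> ('g, 'x, 'w) ebundle \<Rightarrow> bool" where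
  "equiv_iso X G \<beta> E F \<longleftrightarrow>
     (\<exists>\<phi>.
        (\<forall>x\<in>topspace (top_of X). clinear_map (fibre E x) (fibre F x) (\<phi> x) \<and>
           bij_betw (\<phi> x) (carr (fibre E x)) (carr (fibre F x))) \<and>
        (\<forall>U s. openin (top_of X) U \<longrightarrow> (\<forall>x\<in>U. s x \<in> carr (fibre E x)) \<longrightarrow>
           (s \<in> sections E U \<longleftrightarrow> (\<lambda>x. \<phi> x (s x)) \<in> sections F U)) \<and>
        (\<forall>g\<in>G. \<forall>x\<in>topspace (top_of X). \<beta> g x \<in> topspace (top_of X) \<and>
           (\<forall>v\<in>carr (fibre E x). act E g x v \<in> carr (fibre E (\<beta> g x)) \<and>
              \<phi> (\<beta> g x) (act E g x v) = act F g x (\<phi> x v))))"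


section \<open>The period domain and its Hodge bundles\<close>

definition period_quadric :: "(int^'m \<Rightarrow> int^'m \<Rightarrow> int) \<Rightarrow> (complex^'m) set set" where
  "period_quadric b =
     {pline id \<omega> |\<omega>. \<omega> \<noteq> 0 \<and> form_ext b \<omega> \<omega> = 0 \<and> Re (form_ext b \<omega> (\<chi> i. cnj (\<omega> $ i))) > 0}"

definition period_domain ::
    "(int^'m \<Rightarrow> int^'m \<Rightarrow> int) \<Rightarrow> (complex^'m) set set \<Rightarrow> bool" where
  "period_domain b D \<longleftrightarrow>
     D \<in> connected_components_of (subtopology (top_of (proj_space id)) (period_quadric b))"

definition domain_space :: "(complex^'m) set set \<Rightarrow> (complex^'m) set cspace" where
  "domain_space D = subspace_of (proj_space id) D"

definition complexify :: "real^'m^'m \<Rightarrow> complex^'m \<Rightarrow> complex^'m" where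
  "complexify g v = map_matrix complex_of_real g *v v"

definition act_point :: "real^'m^'m \<Rightarrow> (complex^'m) set \<Rightarrow> (complex^'m) set" where
  "act_point g l = complexify g ` l"

definition cperp ::
    "(int^'m \<Rightarrow> int^'m \<Rightarrow> int) \<Rightarrow> (complex^'m) set \<Rightarrow> (complex^'m) set" where
  "cperp b S = {v. \<forall>w\<in>S. form_ext b v w = 0}"

text \<open>\<open>\<L>\<^sup>\<bottom> / \<L>\<close>; a point \<open>x\<close> of \<open>D\<close> is itself the line \<open>\<complex>\<omega>\<close>.\<close>

definition second_hodge ::
    "(int^'m \<Rightarrow> int^'m \<Rightarrow> int) \<Rightarrow> (complex^'m) set set \<Rightarrow>
     (real^'m^'m, (complex^'m) set, (complex^'m) set) ebundle" where
  "second_hodge b D =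
     quotient_bundle (domain_space D)
       (sub_bundle (trivial_bundle (domain_space D) full_vs complexify) (\<lambda>x. cperp b x))
       (\<lambda>x. x)"

definition induced_form ::
    "(int^'m \<Rightarrow> int^'m \<Rightarrow> int) \<Rightarrow> (complex^'m) set \<Rightarrow> (complex^'m) set \<Rightarrow> complex" where
  "induced_form b A B = (THE c. \<forall>v\<in>A. \<forall>w\<in>B. form_ext b v w = c)"

definition EJ_fibre ::
    "(int^'m \<Rightarrow> int^'m \<Rightarrow> int) \<Rightarrow> (int^'m) set \<Rightarrow> (complex^'m) set \<Rightarrow> (complex^'m) set set" where
  "EJ_fibre b J x = coset full_vs x ` (cperp b x \<inter> scalars_ext J)"

definition EJ_perp_fibre ::
    "(int^'m \<Rightarrow> int^'m \<Rightarrow> int) \<Rightarrow> (int^'m) set \<Rightarrow> (complex^'m) set set \<Rightarrow>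
     (complex^'m) set \<Rightarrow> (complex^'m) set set" where
  "EJ_perp_fibre b J D x =
     {A \<in> carr (fibre (second_hodge b D) x). \<forall>B\<in>EJ_fibre b J x. induced_form b A B = 0}"

definition EJ :: "(int^'m \<Rightarrow> int^'m \<Rightarrow> int) \<Rightarrow> (int^'m) set \<Rightarrow> (complex^'m) set set \<Rightarrow>
     (real^'m^'m, (complex^'m) set, (complex^'m) set) ebundle" where
  "EJ b J D = sub_bundle (second_hodge b D) (EJ_fibre b J)"

definition EJ_perp :: "(int^'m \<Rightarrow> int^'m \<Rightarrow> int) \<Rightarrow> (int^'m) set \<Rightarrow> (complex^'m) set set \<Rightarrow>
     (real^'m^'m, (complex^'m) set, (complex^'m) set) ebundle" where
  "EJ_perp b J D = sub_bundle (second_hodge b D) (EJ_perp_fibre b J D)"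


section \<open>The structures attached to J\<close>

definition wedge :: "real^'m \<Rightarrow> real^'m \<Rightarrow> real^'m^'m" where
  "wedge u v = (\<chi> i j. u $ i * v $ j - v $ i * u $ j)"

text \<open>
  \<open>\<Lambda>\<^sup>2J\<^sub>\<real>\<close> is spanned by the tensors \<open>wedge u v\<close> with \<open>u, v \<in> J\<^sub>\<real>\<close>. An isometry preserving \<open>J\<^sub>\<real>\<close>
  preserves \<open>(J\<^sup>\<bottom>)\<^sub>\<real>\<close>, and it is trivial on the quotient iff \<open>g x - x \<in> J\<^sub>\<real>\<close>.
\<close>

definition GammaJ :: "(int^'m \<Rightarrow> int^'m \<Rightarrow> int) \<Rightarrow> (int^'m) set \<Rightarrow> (real^'m^'m) set" where
  "GammaJ b J = {g. invertible g \<and>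
     (\<forall>x y. form_ext b (g *v x) (g *v y) = form_ext b x y) \<and>
     (*v) g ` scalars_ext J = scalars_ext J \<and>
     (\<forall>u\<in>scalars_ext J. \<forall>v\<in>scalars_ext J. wedge (g *v u) (g *v v) = wedge u v) \<and>
     (\<forall>x\<in>scalars_ext (lperp b J). g *v x - x \<in> scalars_ext J)}"

definition VJ :: "(int^'m \<Rightarrow> int^'m \<Rightarrow> int) \<Rightarrow> (int^'m) set \<Rightarrow> (complex^'m) set cvs" where
  "VJ b J = quot_vs (sub_vs full_vs (scalars_ext (lperp b J))) (scalars_ext J)"

definition proj_J ::
    "(int^'m \<Rightarrow> int^'m \<Rightarrow> int) \<Rightarrow> (int^'m) set \<Rightarrow> complex^'m \<Rightarrow> (complex^'m) set" where
  "proj_J b J = coset full_vs (scalars_ext (lperp b J))"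

definition pi_J ::
    "(int^'m \<Rightarrow> int^'m \<Rightarrow> int) \<Rightarrow> (int^'m) set \<Rightarrow> (complex^'m) set \<Rightarrow> (complex^'m) set set" where
  "pi_J b J x = proj_J b J ` x"

text \<open>\<open>\<bbbH>\<^sub>J\<close> is the image of \<open>D\<close> in \<open>\<bbbP>(L / J\<^sup>\<bottom>)\<^sub>\<complex>\<close>.\<close>

definition HJ_space :: "(int^'m \<Rightarrow> int^'m \<Rightarrow> int) \<Rightarrow> (int^'m) set \<Rightarrow> (complex^'m) set set \<Rightarrow>
     (complex^'m) set set cspace" where
  "HJ_space b J D = subspace_of (proj_space (proj_J b J)) (pi_J b J ` D)"

text \<open>\<open>\<O>(-1)\<close>: the fibre at a line in \<open>(L / J\<^sup>\<bottom>)\<^sub>\<complex>\<close> is that line.\<close>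

definition LJ :: "(int^'m \<Rightarrow> int^'m \<Rightarrow> int) \<Rightarrow> (int^'m) set \<Rightarrow> (complex^'m) set set \<Rightarrow>
     (real^'m^'m, (complex^'m) set set, (complex^'m) set) ebundle" where
  "LJ b J D =
     sub_bundle
       (trivial_bundle (HJ_space b J D) (quot_vs full_vs (scalars_ext (lperp b J)))
          (\<lambda>g A. complexify g ` A))
       (\<lambda>y. y)"

end

theory Submission
  imports Defs
begin

text \<open>
  Write \<open>(\<cdot>,\<cdot>)\<close> for the form and let \<open>e1, e2\<close> be a basis of \<open>J\<close>. Everything is governed by the linear map
  \<open>\<Psi> v = (v,e1) e2 - (v,e2) e1\<close> from \<open>L\<^sub>\<complex>\<close> to \<open>J\<^sub>\<complex>\<close>. Its kernel is \<open>J\<^sup>\<bottom>\<close>, so it identifies \<open>(L/J\<^sup>\<bottom>)\<^sub>\<complex>\<close> with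
  \<open>J\<^sub>\<complex>\<close>; invariantly it is the duality \<open>(L/J\<^sup>\<bottom>)\<^sub>\<complex> = J\<^sub>\<complex>\<^sup>*\<close> followed by \<open>J\<^sup>* = J \<otimes> (\<Lambda>\<^sup>2J)\<^sup>*\<close>, and it commutes
  with \<open>\<Gamma>(J)\<^sub>\<real>\<close> because that group acts trivially on \<open>\<Lambda>\<^sup>2J\<^sub>\<real>\<close>. Since \<open>(v, \<Psi> v) = 0\<close>, the vector \<open>\<Psi> \<omega>\<close>
  spans \<open>\<omega>\<^sup>\<bottom> \<inter> J\<^sub>\<complex>\<close>. The three isomorphisms at a point \<open>[\<omega>]\<close> are then as follows.

  \<^item> \<open>\<E>\<^sub>J \<rightarrow> \<pi>\<^sup>*\<L>\<^sub>J\<close> takes the class of \<open>\<Psi> v\<close> to the image of \<open>v\<close> in \<open>L/J\<^sup>\<bottom>\<close>, for \<open>v \<in> \<complex>\<omega>\<close>.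
  \<^item> \<open>\<E>\<^sub>J\<^sup>\<bottom>/\<E>\<^sub>J \<rightarrow> V(J)\<close>: a vector of \<open>\<omega>\<^sup>\<bottom>\<close> orthogonal to \<open>\<Psi> \<omega>\<close> lies in \<open>\<complex>\<omega> \<oplus> J\<^sup>\<bottom>\<close>, and its
    component in \<open>J\<^sup>\<bottom>\<close> is taken modulo \<open>J\<close>.
  \<^item> \<open>\<E>/\<E>\<^sub>J\<^sup>\<bottom> \<rightarrow> \<pi>\<^sup>*\<L>\<^sub>J\<^sup>-\<^sup>1\<close> takes the class of \<open>u\<close> to the functional \<open>v \<mapsto> (u, \<Psi> v)\<close>.

  Nonzero real vectors of \<open>J\<close> are never orthogonal to a period: otherwise a positive plane together with an
  isotropic vector orthogonal to it would span a three-dimensional semidefinite space, which signature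
  \<open>(2,n)\<close> excludes. So each point has a unique representative with \<open>(\<omega>,e2) = 1\<close>, and this representative
  varies holomorphically. It trivialises \<open>\<L>\<close> and \<open>\<L>\<^sub>J\<close>, and together with the basis \<open>f1, f2\<close> of a complement
  of \<open>J\<^sup>\<bottom>\<close> dual to \<open>e1, e2\<close> it gives explicit holomorphic lifts. For each of the six bundles, a section is therefore
  holomorphic exactly if explicit coordinate functions on \<open>\<D>\<close> are, and corresponding sections have the
  same coordinates (\<open>EJ_iso\<close>, \<open>Gr1_iso\<close>, \<open>Gr2_iso\<close>).

  Two facts link the lattice to this linear algebra. First, \<open>(J\<^sup>\<bottom>)\<^sub>\<complex>\<close>, spanned by integral vectors,
  is the full orthogonal complement of \<open>J\<^sub>\<complex>\<close> (\<open>scalars_ext_lperp\<close>). Second, \<open>\<Gamma>(J)\<^sub>\<real>\<close> maps the component \<open>\<D>\<close>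
  to itself (\<open>GammaJ_preserves_domain\<close>). The period quadric has two sides, distinguished by the sign of
  \<open>Im ((\<omega>,e1) / (\<omega>,e2))\<close>. Determinant one on \<open>J\<^sub>\<real>\<close> preserves the sign, and each side is connected, being the
  image of a tube domain over a convex cone.
\<close>

section \<open>The bilinear form over a field\<close>

lemma form_ext_add_left: "form_ext b (x + y) z = form_ext b x z + form_ext b y z"
  by (simp add: form_ext_def algebra_simps sum.distrib)

lemma form_ext_add_right: "form_ext b z (x + y) = form_ext b z x + form_ext b z y"
  by (simp add: form_ext_def algebra_simps sum.distrib)

lemma form_ext_scale_left: "form_ext b (c *s x) y = c * form_ext b x y"
  by (simp add: form_ext_def sum_distrib_left algebra_simps)

lemma form_ext_scale_right: "form_ext b x (c *s y) = c * form_ext b x y"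
  by (simp add: form_ext_def sum_distrib_left algebra_simps)

lemma form_ext_zero: "form_ext b 0 y = 0" "form_ext b x 0 = 0"
  by (simp_all add: form_ext_def)

lemma form_ext_minus: "form_ext b (- x) y = - form_ext b x y" "form_ext b x (- y) = - form_ext b x y"
  by (simp_all add: form_ext_def sum_negf)

lemma form_ext_diff_left: "form_ext b (x - y) z = form_ext b x z - form_ext b y z"
  using form_ext_add_left[of b x "- y" z] by (simp add: form_ext_minus)

lemma form_ext_diff_right: "form_ext b z (x - y) = form_ext b z x - form_ext b z y"
  using form_ext_add_right[of b z x "- y"] by (simp add: form_ext_minus)

lemmas form_ext_linear = form_ext_add_left form_ext_add_right form_ext_scale_left
  form_ext_scale_right form_ext_zero form_ext_minus form_ext_diff_left form_ext_diff_right

lemma form_ext_commute: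
  assumes "\<And>x y. b x y = b y x"
  shows "form_ext b x y = form_ext b y x"
  unfolding form_ext_def
  by (subst sum.swap) (simp add: assms[of "axis _ _" "axis _ _"] mult_ac)


section \<open>Holomorphic functions\<close>

lemma holo_on_const: "holo_on (\<lambda>_. c) S"
  unfolding holo_on_def by (auto intro!: exI[of _ "\<lambda>_. 0"])

lemma holo_on_add: "holo_on f S \<Longrightarrow> holo_on g S \<Longrightarrow> holo_on (\<lambda>x. f x + g x) S"
  unfolding holo_on_def
proof
  assume fg: "\<forall>z\<in>S. \<exists>f'. (f has_derivative f') (at z) \<and> (\<forall>c v. f' (c *s v) = c * f' v)"
    "\<forall>z\<in>S. \<exists>f'. (g has_derivative f') (at z) \<and> (\<forall>c v. f' (c *s v) = c * f' v)"
  fix z assume "z \<in> S"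
  with fg obtain f' g' where
    "(f has_derivative f') (at z)" "\<forall>c v. f' (c *s v) = c * f' v"
    "(g has_derivative g') (at z)" "\<forall>c v. g' (c *s v) = c * g' v"
    by metis
  then show "\<exists>h. ((\<lambda>x. f x + g x) has_derivative h) (at z) \<and> (\<forall>c v. h (c *s v) = c * h v)"
    by (intro exI[of _ "\<lambda>h. f' h + g' h"] conjI has_derivative_add) (auto simp: algebra_simps)
qed

lemma holo_on_mult:
  assumes "holo_on f S" "holo_on g S"
  shows "holo_on (\<lambda>x. f x * g x) S"
  unfolding holo_on_def
proof
  fix z assume "z \<in> S"
  with assms obtain f' g' where
    "(f has_derivative f') (at z)" "\<forall>c v. f' (c *s v) = c * f' v"
    "(g has_derivative g') (at z)" "\<forall>c v. g' (c *s v) = c * g' v"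
    unfolding holo_on_def by metis
  then show "\<exists>h. ((\<lambda>x. f x * g x) has_derivative h) (at z) \<and> (\<forall>c v. h (c *s v) = c * h v)"
    by (intro exI[of _ "\<lambda>h. f z * g' h + f' h * g z"] conjI has_derivative_mult)
      (auto simp: algebra_simps)
qed

lemma holo_on_divide:
  assumes "holo_on f S" "holo_on g S" "\<And>z. z \<in> S \<Longrightarrow> g z \<noteq> 0"
  shows "holo_on (\<lambda>x. f x / g x) S"
  unfolding holo_on_def
proof
  fix z assume z: "z \<in> S"
  with assms obtain f' g' where
    "(f has_derivative f') (at z)" "\<forall>c v. f' (c *s v) = c * f' v"
    "(g has_derivative g') (at z)" "\<forall>c v. g' (c *s v) = c * g' v"
    unfolding holo_on_def by metis
  then show "\<exists>h. ((\<lambda>x. f x / g x) has_derivative h) (at z) \<and> (\<forall>c v. h (c *s v) = c * h v)"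
    using assms(3)[OF z]
    by (intro exI[of _ "\<lambda>h. (f' h * g z - f z * g' h) / (g z * g z)"] conjI has_derivative_divide')
      (auto simp: field_simps)
qed

lemma scaleR_eq_smult: "r *\<^sub>R v = complex_of_real r *s (v :: complex^'m)"
  by (vector scaleR_conv_of_real)

lemma bounded_linear_complex_linear:
  fixes h :: "complex^'m \<Rightarrow> complex"
  assumes "\<And>u v. h (u + v) = h u + h v" "\<And>c v. h (c *s v) = c * h v"
  shows "bounded_linear h"
proof -
  have "linear h"
    by (rule linearI) (simp_all add: assms scaleR_eq_smult scaleR_conv_of_real)
  then show ?thesis
    by (simp add: linear_conv_bounded_linear)
qed

lemma holo_on_linear:
  assumes "\<And>u v. h (u + v) = h u + h v" "\<And>c v. h (c *s v) = c * h v"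
  shows "holo_on h S"
  unfolding holo_on_def
  using bounded_linear_imp_has_derivative[OF bounded_linear_complex_linear[of h]] assms by blast

lemma bounded_linear_form_ext: "bounded_linear (\<lambda>v :: complex^'m. form_ext b v e)"
  by (rule bounded_linear_complex_linear) (simp_all add: form_ext_linear)

text \<open>
  The closure properties of a sheaf of rings of functions on which the comparison of sections rests,
  for \<open>\<D>\<close> and for the half plane alike. A function is only constrained on the open set,
  hence the last axiom.
\<close>

locale function_sheaf =
  fixes X :: "'x cspace"
  assumes hol_const: "openin (top_of X) U \<Longrightarrow> (\<lambda>_. c) \<in> hol_of X U"
    and hol_add: "f \<in> hol_of X U \<Longrightarrow> g \<in> hol_of X U \<Longrightarrow> (\<lambda>x. f x + g x) \<in> hol_of X U"
    and hol_mult: "f \<in> hol_of X U \<Longrightarrow> g \<in> hol_of X U \<Longrightarrow> (\<lambda>x. f x * g x) \<in> hol_of X U"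
    and hol_local: "(\<And>x. x \<in> U \<Longrightarrow> \<exists>U'. openin (top_of X) U' \<and> x \<in> U' \<and> U' \<subseteq> U \<and> f \<in> hol_of X U')
       \<Longrightarrow> f \<in> hol_of X U"
    and hol_cong: "f \<in> hol_of X U \<Longrightarrow> (\<And>x. x \<in> U \<Longrightarrow> f x = g x) \<Longrightarrow> g \<in> hol_of X U"

lemma hol_proj_space_iff:
  "f \<in> hol_of (proj_space p) U \<longleftrightarrow> holo_on (\<lambda>v. f (pline p v)) {v. pline p v \<in> U}"
  by (simp add: proj_space_def)

lemma holo_on_subset: "holo_on f S \<Longrightarrow> T \<subseteq> S \<Longrightarrow> holo_on f T"
  by (auto simp: holo_on_def)

lemma hol_subspace_ofI:
  assumes "\<And>x. x \<in> U \<Longrightarrow> \<exists>V g. openin (top_of X) V \<and> x \<in> V \<and> g \<in> hol_of X V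
                                  \<and> (\<forall>y\<in>U \<inter> V. f y = g y)"
  shows "f \<in> hol_of (subspace_of X S) U"
  using assms by (simp add: subspace_of_def)

lemma hol_subspace_ofE:
  assumes "f \<in> hol_of (subspace_of X S) U" "x \<in> U"
  obtains V g where "openin (top_of X) V" "x \<in> V" "g \<in> hol_of X V" "\<And>y. y \<in> U \<Longrightarrow> y \<in> V \<Longrightarrow> f y = g y"
  using assms by (auto simp: subspace_of_def)

text \<open>
  Two functions have local extensions on a common neighbourhood, the intersection of the given ones, and
  there the extensions can be combined.
\<close>

lemma hol_subspace_of_combine:
  fixes p :: "complex^'m \<Rightarrow> 'w" and F :: "complex \<Rightarrow> complex \<Rightarrow> complex"
  assumes fg: "f \<in> hol_of (subspace_of (proj_space p) S) U" "g \<in> hol_of (subspace_of (proj_space p) S) U"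
    and F: "\<And>(h :: complex^'m \<Rightarrow> complex) k T. holo_on h T \<Longrightarrow> holo_on k T \<Longrightarrow> holo_on (\<lambda>x. F (h x) (k x)) T"
  shows "(\<lambda>x. F (f x) (g x)) \<in> hol_of (subspace_of (proj_space p) S) U"
proof (rule hol_subspace_ofI)
  fix x assume x: "x \<in> U"
  obtain V h where 1: "openin (top_of (proj_space p)) V" "x \<in> V" "h \<in> hol_of (proj_space p) V"
    "\<And>y. y \<in> U \<Longrightarrow> y \<in> V \<Longrightarrow> f y = h y"
    using hol_subspace_ofE[OF fg(1) x] by metis
  obtain V' k where 2: "openin (top_of (proj_space p)) V'" "x \<in> V'" "k \<in> hol_of (proj_space p) V'"
    "\<And>y. y \<in> U \<Longrightarrow> y \<in> V' \<Longrightarrow> g y = k y"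
    using hol_subspace_ofE[OF fg(2) x] by metis
  have "holo_on (\<lambda>v. F (h (pline p v)) (k (pline p v))) {v. pline p v \<in> V \<inter> V'}"
    by (rule F) (use 1(3) 2(3) in \<open>auto simp: hol_proj_space_iff elim: holo_on_subset\<close>)
  with 1 2 show "\<exists>V g'. openin (top_of (proj_space p)) V \<and> x \<in> V \<and> g' \<in> hol_of (proj_space p) V \<and>
      (\<forall>y\<in>U \<inter> V. F (f y) (g y) = g' y)"
    by (intro exI[of _ "V \<inter> V'"] exI[of _ "\<lambda>x. F (h x) (k x)"]) (auto simp: hol_proj_space_iff)
qed

lemma function_sheaf_subspace_of_proj_space:
  "function_sheaf (subspace_of (proj_space (p :: complex^'m \<Rightarrow> 'w)) S)" (is "function_sheaf ?X")
proof
  fix c U assume "openin (top_of ?X) U"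
  then obtain V where V: "openin (top_of (proj_space p)) V" "U = V \<inter> S"
    by (auto simp: subspace_of_def openin_subtopology)
  show "(\<lambda>_. c) \<in> hol_of ?X U"
    by (rule hol_subspace_ofI, rule exI[of _ V], rule exI[of _ "\<lambda>_. c"])
      (use V in \<open>auto simp: hol_proj_space_iff holo_on_const\<close>)
next
  fix f g U assume fg: "f \<in> hol_of ?X U" "g \<in> hol_of ?X U"
  show "(\<lambda>x. f x + g x) \<in> hol_of ?X U" "(\<lambda>x. f x * g x) \<in> hol_of ?X U"
    by (rule hol_subspace_of_combine[OF fg]; rule holo_on_add holo_on_mult; assumption)+
next
  fix U f
  assume loc: "\<And>x. x \<in> U \<Longrightarrow> \<exists>U'. openin (top_of ?X) U' \<and> x \<in> U' \<and> U' \<subseteq> U \<and> f \<in> hol_of ?X U'"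
    show "f \<in> hol_of ?X U"
  proof (rule hol_subspace_ofI)
    fix x assume x: "x \<in> U"
    from loc[OF this] obtain U' where U': "openin (top_of ?X) U'" "x \<in> U'" "U' \<subseteq> U" "f \<in> hol_of ?X U'" by blast
    then obtain W where W: "openin (top_of (proj_space p)) W" "U' = W \<inter> S"
      by (auto simp: subspace_of_def openin_subtopology)
    obtain V h where 1: "openin (top_of (proj_space p)) V" "x \<in> V" "h \<in> hol_of (proj_space p) V"
      "\<And>y. y \<in> U' \<Longrightarrow> y \<in> V \<Longrightarrow> f y = h y"
      using hol_subspace_ofE[OF U'(4,2)] by metis
    have US: "U \<subseteq> S"
    proof
      fix z assume "z \<in> U"
      from loc[OF this] obtain U'' where "openin (top_of ?X) U''" "z \<in> U''" by blast
      then show "z \<in> S" by (auto simp: subspace_of_def openin_subtopology)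
    qed
    show "\<exists>V g. openin (top_of (proj_space p)) V \<and> x \<in> V \<and> g \<in> hol_of (proj_space p) V \<and>
        (\<forall>y\<in>U \<inter> V. f y = g y)"
      by (rule exI[of _ "V \<inter> W"], rule exI[of _ h])
        (use U' W 1 US in \<open>auto simp: hol_proj_space_iff elim: holo_on_subset\<close>)
  qed
next
  fix f g U assume "f \<in> hol_of ?X U" "\<And>x. x \<in> U \<Longrightarrow> f x = g x"
  then show "g \<in> hol_of ?X U"
    by (simp add: subspace_of_def)
qed

context function_sheaf
begin

lemma hol_sum:
  assumes "openin (top_of X) U" "\<And>i. i \<in> A \<Longrightarrow> f i \<in> hol_of X U"
  shows "(\<lambda>x. \<Sum>i\<in>A. f i x) \<in> hol_of X U"
  using assms by (induction A rule: infinite_finite_induct) (auto intro!: hol_const hol_add)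

lemma hol_sum_list:
  assumes "openin (top_of X) U" "\<And>i. i \<in> set is \<Longrightarrow> f i \<in> hol_of X U"
  shows "(\<lambda>x. \<Sum>i\<leftarrow>is. f i x) \<in> hol_of X U"
  using assms by (induction "is") (auto intro!: hol_const hol_add)

lemma hol_sum_list_pairs:
  assumes U: "openin (top_of X) U" and "\<And>f w. (f, w) \<in> set fws \<Longrightarrow> f \<in> hol_of X U"
  shows "(\<lambda>y. \<Sum>(f, w)\<leftarrow>fws. f y * (l w :: complex)) \<in> hol_of X U"
  using assms(2)
proof (induction fws)
  case (Cons a fws)
  obtain f w where a: "a = (f, w)" by (cases a)
  have "(\<lambda>y. f y * l w + (\<Sum>(f, w)\<leftarrow>fws. f y * l w)) \<in> hol_of X U"
    using Cons a by (intro hol_add hol_mult hol_const U) auto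
  then show ?case by (simp add: a)
qed (simp add: hol_const U)

lemma hol_minus:
  assumes "openin (top_of X) U" "f \<in> hol_of X U"
  shows "(\<lambda>x. - f x) \<in> hol_of X U"
  using hol_mult[OF hol_const[OF assms(1), of "-1"] assms(2)] by simp

lemma hol_diff:
  assumes "openin (top_of X) U" "f \<in> hol_of X U" "g \<in> hol_of X U"
  shows "(\<lambda>x. f x - g x) \<in> hol_of X U"
  using hol_add[OF assms(2) hol_minus[OF assms(1,3)]] by simp

definition hol_vector :: "'x set \<Rightarrow> ('x \<Rightarrow> complex^'m) \<Rightarrow> bool" where
  "hol_vector U t \<longleftrightarrow> (\<forall>i. (\<lambda>x. t x $ i) \<in> hol_of X U)"

lemma hol_vector_const: "openin (top_of X) U \<Longrightarrow> hol_vector U (\<lambda>_. v)"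
  by (simp add: hol_vector_def hol_const)

lemma hol_vector_diff:
  "openin (top_of X) U \<Longrightarrow> hol_vector U s \<Longrightarrow> hol_vector U t \<Longrightarrow> hol_vector U (\<lambda>x. s x - t x)"
  by (simp add: hol_vector_def hol_diff)

lemma hol_vector_scale: "f \<in> hol_of X U \<Longrightarrow> hol_vector U t \<Longrightarrow> hol_vector U (\<lambda>x. f x *s t x)"
  by (simp add: hol_vector_def hol_mult)

lemma hol_form_ext:
  assumes "openin (top_of X) U" "hol_vector U s" "hol_vector U t"
  shows "(\<lambda>x. form_ext b (s x) (t x)) \<in> hol_of X U"
  unfolding form_ext_def
  using assms by (auto simp: hol_vector_def intro!: hol_sum hol_mult hol_const)

lemma hol_vector_cong:
  "hol_vector U t \<Longrightarrow> (\<And>x. x \<in> U \<Longrightarrow> t x = s x) \<Longrightarrow> hol_vector U s"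
  unfolding hol_vector_def using hol_cong[of "\<lambda>x. t x $ _"] by (metis (no_types, lifting))

lemma hol_vector_local:
  assumes "\<And>x. x \<in> U \<Longrightarrow> \<exists>U'. openin (top_of X) U' \<and> x \<in> U' \<and> U' \<subseteq> U \<and> hol_vector U' t"
  shows "hol_vector U t"
  unfolding hol_vector_def
proof
  fix i show "(\<lambda>x. t x $ i) \<in> hol_of X U"
  proof (rule hol_local)
    fix x assume "x \<in> U"
    from assms[OF this] show "\<exists>U'. openin (top_of X) U' \<and> x \<in> U' \<and> U' \<subseteq> U \<and> (\<lambda>x. t x $ i) \<in> hol_of X U'"
      unfolding hol_vector_def by blast
  qed
qed

end


section \<open>Cosets and parametrised vector spaces\<close>

text \<open>
  The fibres are subquotients of \<open>\<complex>\<^sup>m\<close>, possibly nested, with cosets of cosets as elements, or duals of such.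
  Presenting each one as the image of a subspace of \<open>\<complex>\<^sup>m\<close> under a map respecting the operations
  keeps the computations on vectors of \<open>\<complex>\<^sup>m\<close>.
\<close>

definition parametrizes :: "'v cvs \<Rightarrow> (complex^'m) set \<Rightarrow> (complex^'m \<Rightarrow> 'v) \<Rightarrow> bool" where
  "parametrizes V S r \<longleftrightarrow> vec.subspace S \<and> carr V = r ` S \<and> r 0 = zer V \<and>
     (\<forall>u\<in>S. \<forall>v\<in>S. add V (r u) (r v) = r (u + v)) \<and>
     (\<forall>c. \<forall>u\<in>S. scl V c (r u) = r (c *s u))"

lemma parametrizes_full: "parametrizes full_vs UNIV (\<lambda>v. v)"
  by (simp add: parametrizes_def full_vs_def)

lemma sub_vs_simps [simp]:
  "carr (sub_vs V S) = S" "zer (sub_vs V S) = zer V" "add (sub_vs V S) = add V"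
  "scl (sub_vs V S) = scl V" "coset (sub_vs V S) K = coset V K"
  by (simp_all add: sub_vs_def coset_def fun_eq_iff)

lemma lincomb_sub_vs [simp]: "lincomb (sub_vs V S) = lincomb V"
  by (simp add: lincomb_def fun_eq_iff)

lemma parametrizes_sub:
  assumes "parametrizes V S r" "vec.subspace T" "T \<subseteq> S"
  shows "parametrizes (sub_vs V (r ` T)) T r"
  using assms unfolding parametrizes_def by (auto simp: subset_iff)

lemma coset_parametrized:
  assumes "parametrizes V S r" "T \<subseteq> S" "u \<in> S"
  shows "coset V (r ` T) (r u) = {r (u + t) |t. t \<in> T}"
proof -
  have "add V (r u) (r t) = r (u + t)" if "t \<in> T" for t
    using assms that by (auto simp: parametrizes_def)
  then show ?thesis
    unfolding coset_def by (simp add: setcompr_eq_image image_image cong: image_cong_simp)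
qed

text \<open>
  By \<open>coset_parametrized\<close> a coset is an image of a translate of \<open>T\<close>, so the operations on cosets reduce to those on
  translates. The inclusion of the right-hand sides uses \<open>0 \<in> T\<close>.
\<close>

lemma parametrizes_quot:
  assumes V: "parametrizes V S r" and T: "vec.subspace T" "T \<subseteq> S"
  shows "parametrizes (quot_vs V (r ` T)) S (\<lambda>u. coset V (r ` T) (r u))"
proof -
  have S: "vec.subspace S" using V by (simp add: parametrizes_def)
  note cos = coset_parametrized[OF V T(2)]
  have ad: "add V (r u) (r v) = r (u + v)" if "u \<in> S" "v \<in> S" for u v
    using V that by (auto simp: parametrizes_def)
  have sc: "scl V c (r u) = r (c *s u)" if "u \<in> S" for u c
    using V that by (auto simp: parametrizes_def)
  have ST: "u + t \<in> S" if "u \<in> S" "t \<in> T" for u t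
    using that S T by (auto intro: vec.subspace_add)
  show ?thesis
    unfolding parametrizes_def
  proof (intro conjI ballI allI S)
    show "carr (quot_vs V (r ` T)) = (\<lambda>u. coset V (r ` T) (r u)) ` S"
      using V by (auto simp: quot_vs_def parametrizes_def)
    show "coset V (r ` T) (r 0) = zer (quot_vs V (r ` T))"
      by (subst cos) (auto simp: quot_vs_def S vec.subspace_0)
  next
    fix u v assume uv: "u \<in> S" "v \<in> S"
    have "{add V a c |a c. a \<in> {r (u + t) |t. t \<in> T} \<and> c \<in> {r (v + t) |t. t \<in> T}} =
        {r (u + v + t) |t. t \<in> T}" (is "?Jperp_part = ?R")
    proof
      show "?Jperp_part \<subseteq> ?R"
      proof clarify
        fix t t' assume t: "t \<in> T" "t' \<in> T"
        have "add V (r (u + t)) (r (v + t')) = r (u + v + (t + t'))"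
          using ad[OF ST[OF uv(1) t(1)] ST[OF uv(2) t(2)]] by (simp add: add_ac)
        then show "\<exists>s. add V (r (u + t)) (r (v + t')) = r (u + v + s) \<and> s \<in> T"
          using t T(1) vec.subspace_add by blast
      qed
      show "?R \<subseteq> ?Jperp_part"
      proof clarify
        fix t assume t: "t \<in> T"
        have "r (u + v + t) = add V (r (u + t)) (r (v + 0))"
          using ad[OF ST[OF uv(1) t] uv(2)] by (simp add: add_ac)
        then show "\<exists>a c. r (u + v + t) = add V a c \<and> a \<in> {r (u + t) |t. t \<in> T} \<and> c \<in> {r (v + t) |t. t \<in> T}"
          using t vec.subspace_0[OF T(1)] by blast
      qed
    qed
    then show "add (quot_vs V (r ` T)) (coset V (r ` T) (r u)) (coset V (r ` T) (r v)) =
        coset V (r ` T) (r (u + v))"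
      using uv S by (simp add: cos vec.subspace_add quot_vs_def)
  next
    fix c u assume u: "u \<in> S"
    have "{add V (scl V c a) k |a k. a \<in> {r (u + t) |t. t \<in> T} \<and> k \<in> r ` T} =
        {r (c *s u + t) |t. t \<in> T}" (is "?Jperp_part = ?R")
    proof
      have cS: "c *s (u + t) \<in> S" if "t \<in> T" for t
        using u ST that S vec.subspace_scale by blast
      show "?Jperp_part \<subseteq> ?R"
      proof clarify
        fix t t' assume t: "t \<in> T" "t' \<in> T"
        have "add V (scl V c (r (u + t))) (r t') = r (c *s u + (c *s t + t'))"
          using ad[OF cS[OF t(1)], of t'] sc[OF ST[OF u t(1)]] t(2) T(2)
          by (simp add: subset_iff vec.scale_right_distrib add_ac)
        then show "\<exists>s. add V (scl V c (r (u + t))) (r t') = r (c *s u + s) \<and> s \<in> T"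
          using t T(1) vec.subspace_add vec.subspace_scale by blast
      qed
      show "?R \<subseteq> ?Jperp_part"
      proof clarify
        fix t assume t: "t \<in> T"
        have "r (c *s u + t) = add V (scl V c (r (u + 0))) (r t)"
          using u t T S by (simp add: ad sc subset_iff vec.subspace_scale)
        then show "\<exists>a k. r (c *s u + t) = add V (scl V c a) k \<and> a \<in> {r (u + t) |t. t \<in> T} \<and> k \<in> r ` T"
          using t vec.subspace_0[OF T(1)] by blast
      qed
    qed
    then show "scl (quot_vs V (r ` T)) c (coset V (r ` T) (r u)) = coset V (r ` T) (r (c *s u))"
      using u S by (simp add: cos vec.subspace_scale quot_vs_def)
  qed
qed

lemma coset_eq_iff_parametrized:
  assumes V: "parametrizes V S r" and T: "vec.subspace T" "T \<subseteq> S" and uv: "u \<in> S" "v \<in> S"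
  shows "coset V (r ` T) (r u) = coset V (r ` T) (r v) \<longleftrightarrow> (\<exists>t\<in>T. r u = r (v + t))"
proof -
  have S: "vec.subspace S" using V by (simp add: parametrizes_def)
  note cos = coset_parametrized[OF V T(2)]
  have ad: "add V (r u) (r v) = r (u + v)" if "u \<in> S" "v \<in> S" for u v
    using V that by (auto simp: parametrizes_def)
  have ST: "u + t \<in> S" if "u \<in> S" "t \<in> T" for u t
    using that S T by (auto intro: vec.subspace_add)
  have TS: "t \<in> S" if "t \<in> T" for t using that T by auto
  show ?thesis
  proof
    assume "coset V (r ` T) (r u) = coset V (r ` T) (r v)"
    moreover have "r (u + 0) \<in> coset V (r ` T) (r u)"
      unfolding cos[OF uv(1)] using vec.subspace_0[OF T(1)] by blast
    ultimately show "\<exists>t\<in>T. r u = r (v + t)" unfolding cos[OF uv(2)] by auto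
  next
    assume "\<exists>t\<in>T. r u = r (v + t)"
    then obtain t where t: "t \<in> T" "r u = r (v + t)" by blast
    have 1: "r (u + s) = r (v + (t + s))" if "s \<in> T" for s
      using ad[OF uv(1) TS[OF that]] ad[OF ST[OF uv(2) t(1)] TS[OF that]] t(2) by (simp add: add_ac)
    have 2: "r (v + s) = r (u + (s - t))" if "s \<in> T" for s
      using 1[of "s - t"] that t(1) T(1) by (simp add: vec.subspace_diff)
    show "coset V (r ` T) (r u) = coset V (r ` T) (r v)"
      unfolding cos[OF uv(1)] cos[OF uv(2)]
      using 1 2 vec.subspace_add[OF T(1)] vec.subspace_diff[OF T(1)] t(1) by blast
  qed
qed

lemma coset_full: "coset full_vs K v = {v + k |k. k \<in> K}"
  by (simp add: coset_def full_vs_def)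

lemma coset_full_eq_iff:
  assumes "vec.subspace K"
  shows "coset full_vs K u = coset full_vs K v \<longleftrightarrow> u - v \<in> K"
proof -
  have "coset full_vs K u = coset full_vs K v \<longleftrightarrow> (\<exists>t\<in>K. u = v + t)"
    using coset_eq_iff_parametrized[OF parametrizes_full assms, of u v] by simp
  also have "\<dots> \<longleftrightarrow> u - v \<in> K"
    by (metis add_diff_cancel_left' diff_add_cancel add.commute)
  finally show ?thesis .
qed

lemma parametrizes_quot_full:
  "vec.subspace K \<Longrightarrow> parametrizes (quot_vs full_vs K) UNIV (coset full_vs K)"
  using parametrizes_quot[OF parametrizes_full, of K] by simp

lemma lincomb_parametrized:
  assumes "parametrizes V S r" "\<And>c w. (c, w) \<in> set xs \<Longrightarrow> w \<in> S"
  shows "(\<Sum>(c, w)\<leftarrow>xs. c *s w) \<in> S \<and>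
    lincomb V (map (\<lambda>(c, w). (c, r w)) xs) = r (\<Sum>(c, w)\<leftarrow>xs. c *s w)"
  using assms(2)
proof (induction xs)
  case Nil
  then show ?case using assms(1) by (auto simp: lincomb_def parametrizes_def vec.subspace_0)
next
  case (Cons a xs)
  obtain c w where a: "a = (c, w)" by (cases a)
  have "w \<in> S" using Cons.prems a by auto
  moreover have IH: "(\<Sum>(c, w)\<leftarrow>xs. c *s w) \<in> S"
    "lincomb V (map (\<lambda>(c, w). (c, r w)) xs) = r (\<Sum>(c, w)\<leftarrow>xs. c *s w)"
    using Cons by auto
  moreover have "lincomb V (map (\<lambda>(c, w). (c, r w)) (a # xs)) =
     add V (scl V c (r w)) (lincomb V (map (\<lambda>(c, w). (c, r w)) xs))"
    by (simp add: lincomb_def a)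
  ultimately show ?case
    using assms(1) unfolding parametrizes_def
    by (auto simp: a vec.subspace_add vec.subspace_scale)
qed

lemma lincomb_functional:
  assumes "l (zer V) = (0::complex)" "zer V \<in> C"
    "\<And>u v. u \<in> C \<Longrightarrow> v \<in> C \<Longrightarrow> add V u v \<in> C \<and> l (add V u v) = l u + l v"
    "\<And>c u. u \<in> C \<Longrightarrow> scl V c u \<in> C \<and> l (scl V c u) = c * l u"
    "\<And>c w. (c, w) \<in> set xs \<Longrightarrow> w \<in> C"
  shows "lincomb V xs \<in> C \<and> l (lincomb V xs) = (\<Sum>(c, w)\<leftarrow>xs. c * l w)"
  using assms(5)
proof (induction xs)
  case Nil
  then show ?case using assms by (simp add: lincomb_def)
next
  case (Cons a xs)
  obtain c w where a: "a = (c, w)" by (cases a)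
  have "w \<in> C" "lincomb V xs \<in> C" "l (lincomb V xs) = (\<Sum>(c, w)\<leftarrow>xs. c * l w)"
    using Cons a by auto
  moreover have "lincomb V (a # xs) = add V (scl V c w) (lincomb V xs)"
    by (simp add: lincomb_def a)
  ultimately show ?case using assms by (simp add: a)
qed

text \<open>
  Maps between fibres are obtained by parametrising both with the same vectors, so that equality of kernels
  is all that remains to be checked.
\<close>

lemma parametrizes_iso:
  assumes V: "parametrizes V S r" and W: "parametrizes W S r'"
    and eq: "\<And>u v. u \<in> S \<Longrightarrow> v \<in> S \<Longrightarrow> r u = r v \<longleftrightarrow> r' u = r' v"
    and f: "\<And>u. u \<in> S \<Longrightarrow> f (r u) = r' u"
  shows "clinear_map V W f \<and> bij_betw f (carr V) (carr W)"
proof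
  have S: "vec.subspace S" using V by (simp add: parametrizes_def)
  have cV: "carr V = r ` S" and cW: "carr W = r' ` S" using V W by (auto simp: parametrizes_def)
  show "clinear_map V W f"
    unfolding clinear_map_def cV cW
    using V W S by (auto simp: parametrizes_def f vec.subspace_add vec.subspace_scale)
  show "bij_betw f (carr V) (carr W)"
    unfolding bij_betw_def cV cW
    by (auto simp: inj_on_def f eq image_iff)
qed

text \<open>
  The isomorphism sends \<open>r x u\<close> to \<open>r' x u\<close>. The vectors \<open>u\<close> representing a section are arbitrary, in particular not assumed
  to vary holomorphically, so the hypothesis on sections has to be met by a criterion independent of the choice.
\<close>

lemma equiv_iso_parametrized:
  fixes X :: "(complex^'m) set cspace" and r :: "(complex^'m) set \<Rightarrow> complex^'m \<Rightarrow> 'v"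
    and r' :: "(complex^'m) set \<Rightarrow> complex^'m \<Rightarrow> 'w"
  assumes E: "\<And>x. x \<in> topspace (top_of X) \<Longrightarrow> parametrizes (fibre E x) (S x) (r x)"
    and F: "\<And>x. x \<in> topspace (top_of X) \<Longrightarrow> parametrizes (fibre F x) (S x) (r' x)"
    and eq: "\<And>x u v. x \<in> topspace (top_of X) \<Longrightarrow> u \<in> S x \<Longrightarrow> v \<in> S x \<Longrightarrow> r x u = r x v \<longleftrightarrow> r' x u = r' x v"
    and sec: "\<And>U s t u. openin (top_of X) U \<Longrightarrow> (\<And>x. x \<in> U \<Longrightarrow> u x \<in> S x) \<Longrightarrow>
         (\<And>x. x \<in> U \<Longrightarrow> s x = r x (u x)) \<Longrightarrow> (\<And>x. x \<in> U \<Longrightarrow> t x = r' x (u x)) \<Longrightarrow>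
         s \<in> sections E U \<longleftrightarrow> t \<in> sections F U"
    and act: "\<And>g x u. g \<in> G \<Longrightarrow> x \<in> topspace (top_of X) \<Longrightarrow> u \<in> S x \<Longrightarrow>
         h g u \<in> S (\<beta> g x) \<and>
         act E g x (r x u) = r (\<beta> g x) (h g u) \<and> act F g x (r' x u) = r' (\<beta> g x) (h g u)"
    and base: "\<And>g x. g \<in> G \<Longrightarrow> x \<in> topspace (top_of X) \<Longrightarrow> \<beta> g x \<in> topspace (top_of X)"
  shows "equiv_iso X G \<beta> E F"
proof -
  define rep where "rep x A = (SOME u. u \<in> S x \<and> r x u = A)" for x A
  define \<phi> where "\<phi> x A = r' x (rep x A)" for x A
  have rep: "rep x A \<in> S x" "r x (rep x A) = A"
    if "x \<in> topspace (top_of X)" "A \<in> carr (fibre E x)" for x A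
  proof -
    from E[OF that(1)] that(2) have "\<exists>u. u \<in> S x \<and> r x u = A" by (auto simp: parametrizes_def)
    from someI_ex[OF this] show "rep x A \<in> S x" "r x (rep x A) = A" by (auto simp: rep_def)
  qed
  have carr: "carr (fibre E x) = r x ` S x" if "x \<in> topspace (top_of X)" for x
    using E[OF that] by (auto simp: parametrizes_def)
  have \<phi>: "\<phi> x (r x u) = r' x u" if "x \<in> topspace (top_of X)" "u \<in> S x" for x u
    using eq[OF that(1), of "rep x (r x u)" u] rep[OF that(1), of "r x u"] that carr by (auto simp: \<phi>_def)
  show ?thesis
    unfolding equiv_iso_def
  proof (rule exI[of _ \<phi>], intro conjI ballI allI impI)
    fix x assume x: "x \<in> topspace (top_of X)"
    have "clinear_map (fibre E x) (fibre F x) (\<phi> x) \<and> bij_betw (\<phi> x) (carr (fibre E x)) (carr (fibre F x))"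
      by (rule parametrizes_iso[OF E[OF x] F[OF x] eq[OF x] \<phi>[OF x]])
    then show "clinear_map (fibre E x) (fibre F x) (\<phi> x)"
      "bij_betw (\<phi> x) (carr (fibre E x)) (carr (fibre F x))" by auto
  next
    fix U s assume U: "openin (top_of X) U" and s: "\<forall>x\<in>U. s x \<in> carr (fibre E x)"
    have Ut: "x \<in> topspace (top_of X)" if "x \<in> U" for x
      using U openin_subset that by blast
    show "(s \<in> sections E U) = ((\<lambda>x. \<phi> x (s x)) \<in> sections F U)"
      by (rule sec[OF U, of "\<lambda>x. rep x (s x)"]) (use s rep Ut in \<open>auto simp: \<phi>_def\<close>)
  next
    fix g x assume g: "g \<in> G" and x: "x \<in> topspace (top_of X)"
    show "\<beta> g x \<in> topspace (top_of X)" by (rule base[OF g x])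
    fix v assume "v \<in> carr (fibre E x)"
    then obtain u where u: "u \<in> S x" "v = r x u" using carr[OF x] by auto
    show "act E g x v \<in> carr (fibre E (\<beta> g x))"
      using act[OF g x u(1)] carr[OF base[OF g x]] u by auto
    show "\<phi> (\<beta> g x) (act E g x v) = act F g x (\<phi> x v)"
      using act[OF g x u(1)] u \<phi>[OF x u(1)] \<phi>[OF base[OF g x], of "h g u"] by auto
  qed
qed

lemma sections_trivial_bundle:
  "s \<in> sections (trivial_bundle X W \<rho>) U \<longleftrightarrow>
    (\<forall>x\<in>U. \<exists>U' fws. openin (top_of X) U' \<and> x \<in> U' \<and> U' \<subseteq> U \<and>
          (\<forall>(f, w)\<in>set fws. f \<in> hol_of X U' \<and> w \<in> carr W) \<and>
          (\<forall>y\<in>U'. s y = lincomb W (map (\<lambda>(f, w). (f y, w)) fws)))"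
  by (simp add: trivial_bundle_def)

context function_sheaf
begin

text \<open>
  The standard basis turns a vector of holomorphic functions into a finite combination of constant vectors.
\<close>

lemma sections_trivial_full:
  fixes s :: "'x \<Rightarrow> complex^'m"
  assumes U: "openin (top_of X) U"
  shows "s \<in> sections (trivial_bundle X full_vs \<rho>) U \<longleftrightarrow> hol_vector U s"
proof
  assume s: "s \<in> sections (trivial_bundle X full_vs \<rho>) U"
  show "hol_vector U s"
  proof (rule hol_vector_local)
    fix x assume "x \<in> U"
    from bspec[OF s[unfolded sections_trivial_bundle] this]
    obtain U' fws where *: "openin (top_of X) U'" "x \<in> U'" "U' \<subseteq> U"
      "\<forall>(f, w)\<in>set fws. f \<in> hol_of X U' \<and> w \<in> carr (full_vs :: (complex^'m) cvs)"
      "\<forall>y\<in>U'. s y = lincomb full_vs (map (\<lambda>(f, w). (f y, w)) fws)"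
      by (elim exE conjE) (rule that)
    have S: "s y $ i = (\<Sum>(f, w)\<leftarrow>fws. f y * w $ i)" if "y \<in> U'" for y i
    proof -
      have "lincomb full_vs (map (\<lambda>(f, w). (f y, w)) fws) $ i = (\<Sum>(f, w)\<leftarrow>map (\<lambda>(f, w). (f y, w)) fws. f * w $ i)"
        using lincomb_functional[of "\<lambda>v. v $ i" full_vs UNIV] by (simp add: full_vs_def)
      then show ?thesis using *(5) that by (simp add: o_def split_def)
    qed
    have H: "(\<lambda>y. \<Sum>(f, w)\<leftarrow>fws. f y * w $ i) \<in> hol_of X U'" for i
      using hol_sum_list_pairs[OF *(1), of fws "\<lambda>w. w $ i"] *(4) by blast
    have "hol_vector U' s"
      unfolding hol_vector_def by (intro allI hol_cong[OF H]) (simp add: S)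
    then show "\<exists>U'. openin (top_of X) U' \<and> x \<in> U' \<and> U' \<subseteq> U \<and> hol_vector U' s" using * by blast
  qed
next
  assume s: "hol_vector U s"
  obtain xs :: "'m list" where xs: "set xs = UNIV" "distinct xs"
    using finite_distinct_list[of "UNIV :: 'm set"] by auto
  let ?l = "map (\<lambda>i. (\<lambda>x. s x $ i, axis i 1 :: complex^'m)) xs"
  have "s y = lincomb full_vs (map (\<lambda>(f, w). (f y, w)) ?l)" for y
  proof -
    have "lincomb full_vs (map (\<lambda>(c, w). (c, w)) (map (\<lambda>i. (s y $ i, axis i 1)) xs)) =
        (\<Sum>(c, w)\<leftarrow>map (\<lambda>i. (s y $ i, axis i 1)) xs. c *s w)"
      using lincomb_parametrized[OF parametrizes_full] by blast
    also have "\<dots> = (\<Sum>i\<in>UNIV. s y $ i *s axis i 1)"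
      using xs by (simp add: o_def sum_list_distinct_conv_sum_set)
    also have "\<dots> = s y" by (rule basis_expansion)
    finally show ?thesis by (simp add: o_def)
  qed
  moreover have "\<forall>(f, w)\<in>set ?l. f \<in> hol_of X U \<and> w \<in> carr full_vs"
    using s by (auto simp: hol_vector_def full_vs_def)
  ultimately show "s \<in> sections (trivial_bundle X full_vs \<rho>) U"
    unfolding sections_trivial_bundle using U by blast
qed

end

section \<open>Periods relative to an isotropic plane\<close>

lemma pline_id: "pline id v = range (\<lambda>c. c *s v)"
  by (simp add: pline_def)

lemma complexify_add: "complexify g (u + v) = complexify g u + complexify g v"
  by (simp add: complexify_def matrix_vector_right_distrib)

lemma complexify_scale: "complexify g (c *s v) = c *s complexify g v"
  by (simp add: complexify_def vector_scalar_commute)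

lemma complexify_diff: "complexify g (u - v) = complexify g u - complexify g v"
  using complexify_add[of g "u - v" v] by simp

lemma complexify_coset: "complexify g ` coset full_vs K v = coset full_vs (complexify g ` K) (complexify g v)"
  by (auto simp: coset_full complexify_add image_iff) (metis complexify_add)

text \<open>
  The complex linear algebra that the isomorphisms depend on, abstracted from the lattice: \<open>e1, e2\<close> is a
  basis of \<open>J\<^sub>\<complex>\<close>, \<open>f1, f2\<close> is dual to it, and every point of \<open>D\<close> has a representative pairing to \<open>1\<close> with \<open>e2\<close>.
  The identity \<open>G_det\<close> is the trivial action on \<open>\<Lambda>\<^sup>2J\<close> in terms of the map \<open>Psi\<close> defined below.
\<close>

locale hodge_setup =
  fixes b :: "int^'m \<Rightarrow> int^'m \<Rightarrow> int" and J :: "(int^'m) set" and D :: "(complex^'m) set set"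
    and G :: "(real^'m^'m) set" and e1 e2 f1 f2 :: "complex^'m"
  assumes b_sym: "\<And>x y. b x y = b y x"
    and J_eq: "scalars_ext J = {a *s e1 + c *s e2 |a c. True}"
    and Jperp_eq: "scalars_ext (lperp b J) = {v. form_ext b v e1 = 0 \<and> form_ext b v e2 = 0}"
    and ee: "form_ext b e1 e1 = 0" "form_ext b e1 e2 = 0" "form_ext b e2 e2 = 0"
    and fe: "form_ext b f1 e1 = 1" "form_ext b f1 e2 = 0" "form_ext b f2 e1 = 0" "form_ext b f2 e2 = 1"
    and points: "\<And>x. x \<in> D \<Longrightarrow> \<exists>w. x = pline id w \<and> form_ext b w e2 = 1 \<and> form_ext b w w = 0"
    and G_bij: "\<And>g. g \<in> G \<Longrightarrow> bij (complexify g)"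
    and G_form: "\<And>g u v. g \<in> G \<Longrightarrow> form_ext b (complexify g u) (complexify g v) = form_ext b u v"
    and G_J: "\<And>g. g \<in> G \<Longrightarrow> complexify g ` scalars_ext J = scalars_ext J"
    and G_det: "\<And>g v. g \<in> G \<Longrightarrow>
         form_ext b (complexify g v) e1 *s e2 - form_ext b (complexify g v) e2 *s e1 =
         complexify g (form_ext b v e1 *s e2 - form_ext b v e2 *s e1)"
    and G_quot: "\<And>g v. g \<in> G \<Longrightarrow> v \<in> scalars_ext (lperp b J) \<Longrightarrow> complexify g v - v \<in> scalars_ext J"
    and G_D: "\<And>g x. g \<in> G \<Longrightarrow> x \<in> D \<Longrightarrow> act_point g x \<in> D"
begin

abbreviation B :: "complex^'m \<Rightarrow> complex^'m \<Rightarrow> complex" where "B \<equiv> form_ext b"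
abbreviation JC :: "(complex^'m) set" where "JC \<equiv> scalars_ext J"
abbreviation KC :: "(complex^'m) set" where "KC \<equiv> scalars_ext (lperp b J)"
abbreviation p :: "complex^'m \<Rightarrow> (complex^'m) set" where "p \<equiv> proj_J b J"
abbreviation W :: "(complex^'m) set cvs" where "W \<equiv> quot_vs full_vs KC"
abbreviation X :: "(complex^'m) set cspace" where "X \<equiv> domain_space D"
abbreviation H :: "(complex^'m) set set cspace" where "H \<equiv> HJ_space b J D"
abbreviation \<pi> :: "(complex^'m) set \<Rightarrow> (complex^'m) set set" where "\<pi> \<equiv> pi_J b J"

text \<open>
  The contraction of \<open>v\<close> with \<open>e1 \<and> e2\<close>; it identifies \<open>(L/J\<^sup>\<bottom>)\<^sub>\<complex>\<close> with \<open>J\<^sub>\<complex>\<close>.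
\<close>

definition Psi :: "complex^'m \<Rightarrow> complex^'m" where
  "Psi v = B v e1 *s e2 - B v e2 *s e1"

definition omega :: "(complex^'m) set \<Rightarrow> complex^'m" where
  "omega x = (SOME w. w \<in> x \<and> B w e2 = 1)"

lemma B_sym: "B x y = B y x"
  by (rule form_ext_commute[OF b_sym])

lemma ef: "B e1 f1 = 1" "B e2 f1 = 0" "B e1 f2 = 0" "B e2 f2 = 1" "B e2 e1 = 0"
  using fe ee by (simp_all add: B_sym[of _ f1] B_sym[of _ f2] B_sym[of e2 e1])

lemma Psi_scale: "Psi (c *s v) = c *s Psi v"
  by (simp add: Psi_def form_ext_linear vec_eq_iff algebra_simps)

lemma omega_pline:
  assumes "B v e2 \<noteq> 0" shows "omega (pline id v) = (1 / B v e2) *s v"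
  unfolding omega_def
proof (rule some_equality)
  show "(1 / B v e2) *s v \<in> pline id v \<and> B ((1 / B v e2) *s v) e2 = 1"
    using assms by (auto simp: pline_id form_ext_linear)
  fix w assume "w \<in> pline id v \<and> B w e2 = 1"
  then obtain c where c: "w = c *s v" "B w e2 = 1" by (auto simp: pline_id)
  then have "c * B v e2 = 1" by (simp add: form_ext_linear)
  then have "c = 1 / B v e2" using assms by (simp add: field_simps)
  then show "w = (1 / B v e2) *s v" using c by simp
qed

lemma
  assumes "x \<in> D"
  shows omega_e2: "B (omega x) e2 = 1" and omega_omega: "B (omega x) (omega x) = 0"
    and point_eq: "x = range (\<lambda>c. c *s omega x)" and point_pline: "x = pline id (omega x)"
proof -
  obtain w where w: "x = pline id w" "B w e2 = 1" "B w w = 0" using points[OF assms] by blast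
  have "omega x = w" using omega_pline[of w] w by simp
  then show "B (omega x) e2 = 1" "B (omega x) (omega x) = 0"
    "x = range (\<lambda>c. c *s omega x)" "x = pline id (omega x)"
    using w by (simp_all add: pline_id)
qed

lemma e2_omega: "x \<in> D \<Longrightarrow> B e2 (omega x) = 1"
  using omega_e2 B_sym by metis

lemma cperp_eq: "x \<in> D \<Longrightarrow> cperp b x = {v. B v (omega x) = 0}"
proof -
  assume x: "x \<in> D"
  have "cperp b x = cperp b (range (\<lambda>c. c *s omega x))" using point_eq[OF x] by simp
  also have "\<dots> = {v. B v (omega x) = 0}"
    by (auto simp: cperp_def form_ext_linear dest: spec[of _ 1])
  finally show ?thesis .
qed

lemma subspace_JC: "vec.subspace JC" and subspace_KC: "vec.subspace KC"
  by (simp_all add: scalars_ext_def vec.subspace_span)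

lemma subspace_point: "x \<in> D \<Longrightarrow> vec.subspace x"
  using point_eq[of x] vec.span_singleton[of "omega x"] vec.subspace_span[of "{omega x}"] by simp

lemma subspace_cperp: "vec.subspace (cperp b (S :: (complex^'m) set))"
  by (auto simp: vec.subspace_def cperp_def form_ext_linear)

lemma point_cperp: "x \<in> D \<Longrightarrow> x \<subseteq> cperp b x"
proof -
  assume x: "x \<in> D"
  have "range (\<lambda>c. c *s omega x) \<subseteq> cperp b x"
    using x by (auto simp: cperp_eq form_ext_linear omega_omega)
  then show ?thesis using point_eq[OF x] by simp
qed

lemma JC_KC: "JC \<subseteq> KC"
  by (auto simp: J_eq Jperp_eq form_ext_linear ee ef)

lemma Psi_omega: "x \<in> D \<Longrightarrow> Psi (omega x) = B (omega x) e1 *s e2 - e1"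
  by (simp add: Psi_def omega_e2)

lemma Psi_omega_f1: "x \<in> D \<Longrightarrow> B (Psi (omega x)) f1 = -1"
  by (simp add: Psi_omega form_ext_linear ef)

text \<open>
  A vector \<open>a e1 + c e2\<close> is orthogonal to the normalised period \<open>\<omega>\<close> iff \<open>a (\<omega>,e1) + c = 0\<close>, a condition
  that leaves one parameter.
\<close>

lemma cperp_JC: "x \<in> D \<Longrightarrow> cperp b x \<inter> JC = range (\<lambda>c. c *s Psi (omega x))"
proof -
  assume x: "x \<in> D"
  show ?thesis
  proof
    show "range (\<lambda>c. c *s Psi (omega x)) \<subseteq> cperp b x \<inter> JC"
    proof clarify
      fix c
      have "B (Psi (omega x)) (omega x) = 0"
        using x omega_e2[OF x] by (simp add: Psi_omega form_ext_linear B_sym[of e1] B_sym[of e2])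
      moreover have "c *s Psi (omega x) = (- c) *s e1 + (c * B (omega x) e1) *s e2"
        by (simp add: Psi_omega x vec_eq_iff algebra_simps)
      then have "c *s Psi (omega x) \<in> JC" unfolding J_eq by blast
      ultimately show "c *s Psi (omega x) \<in> cperp b x \<inter> JC"
        using x by (simp add: cperp_eq form_ext_linear)
    qed
    show "cperp b x \<inter> JC \<subseteq> range (\<lambda>c. c *s Psi (omega x))"
    proof
      fix v assume v: "v \<in> cperp b x \<inter> JC"
      then obtain a c where ac: "v = a *s e1 + c *s e2" by (auto simp: J_eq)
      have "a * B (omega x) e1 + c = 0"
        using v x omega_e2[OF x] by (simp add: cperp_eq ac form_ext_linear B_sym[of _ "omega x"])
      then have "c = - a * B (omega x) e1" by (simp add: add_eq_0_iff)
      then have "v = (- a) *s Psi (omega x)"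
        by (simp add: Psi_omega x ac vec_eq_iff algebra_simps)
      then show "v \<in> range (\<lambda>c. c *s Psi (omega x))" by blast
    qed
  qed
qed

lemma point_inter_JC: "x \<in> D \<Longrightarrow> v \<in> x \<Longrightarrow> v \<in> JC \<Longrightarrow> v = 0"
proof -
  assume x: "x \<in> D" and v: "v \<in> x" "v \<in> JC"
  obtain c where c: "v = c *s omega x" using v(1) point_eq[OF x] by blast
  have "B v e2 = 0" using v(2) JC_KC by (auto simp: Jperp_eq)
  then show "v = 0" using c omega_e2[OF x] by (simp add: form_ext_linear)
qed


section \<open>Fibres of the Hodge bundle and its filtration\<close>

abbreviation E where "E \<equiv> second_hodge b D"

abbreviation q :: "(complex^'m) set \<Rightarrow> complex^'m \<Rightarrow> (complex^'m) set" where
  "q x \<equiv> coset full_vs x"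

lemma fibre_E: "fibre E x = quot_vs (sub_vs full_vs (cperp b x)) x"
  by (simp add: second_hodge_def quotient_bundle_def sub_bundle_def trivial_bundle_def)

lemma parametrizes_E: "x \<in> D \<Longrightarrow> parametrizes (fibre E x) (cperp b x) (q x)"
  using parametrizes_quot[OF parametrizes_sub[OF parametrizes_full subspace_cperp subset_UNIV]
      subspace_point point_cperp, of x]
  by (simp add: fibre_E)

lemma subspace_J_line: "vec.subspace (cperp b x \<inter> JC)"
  by (simp add: vec.subspace_inter subspace_cperp subspace_JC)

lemma parametrizes_EJ: "x \<in> D \<Longrightarrow> parametrizes (fibre (EJ b J D) x) (cperp b x \<inter> JC) (q x)"
  using parametrizes_sub[OF parametrizes_E subspace_J_line, of x]
  by (simp add: EJ_def sub_bundle_def EJ_fibre_def)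

text \<open>
  The lifts to \<open>\<omega>\<^sup>\<bottom>\<close> of the elements of \<open>\<E>\<^sub>J\<^sup>\<bottom>\<close>: as \<open>Psi (omega x)\<close> spans the lift of \<open>\<E>\<^sub>J\<close>, orthogonality
  to it suffices.
\<close>

definition perp_lifts :: "(complex^'m) set \<Rightarrow> (complex^'m) set" where
  "perp_lifts x = {u. B u (omega x) = 0 \<and> B u (Psi (omega x)) = 0}"

lemma subspace_perp_lifts: "vec.subspace (perp_lifts x)"
  by (auto simp: vec.subspace_def perp_lifts_def form_ext_linear)

lemma perp_lifts_cperp: "x \<in> D \<Longrightarrow> perp_lifts x \<subseteq> cperp b x"
  by (auto simp: perp_lifts_def cperp_eq)

lemma q_eq_iff: "x \<in> D \<Longrightarrow> q x u = q x v \<longleftrightarrow> u - v \<in> x"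
  by (rule coset_full_eq_iff[OF subspace_point])

text \<open>
  The line \<open>x\<close> is isotropic and orthogonal to \<open>\<omega>\<^sup>\<bottom>\<close>, so the form is constant on pairs of cosets and the
  definite description picks that constant.
\<close>

lemma induced_form_q:
  assumes x: "x \<in> D" and u: "u \<in> cperp b x" and v: "v \<in> cperp b x"
  shows "induced_form b (q x u) (q x v) = B u v"
proof -
  have *: "B (u + k) (v + l) = B u v" if "k \<in> x" "l \<in> x" for k l
  proof -
    have "B u l = 0" "B v k = 0" "B k l = 0"
      using u v that point_cperp[OF x] by (auto simp: cperp_def)
    then show ?thesis by (simp add: form_ext_linear B_sym[of k v])
  qed
  have "0 \<in> x" using subspace_point[OF x] by (simp add: vec.subspace_0)
  then have **: "u \<in> q x u" "v \<in> q x v" by (force simp: coset_full)+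
  show ?thesis
    unfolding induced_form_def
  proof (rule the_equality)
    show "\<forall>v'\<in>q x u. \<forall>w\<in>q x v. B v' w = B u v" using * by (auto simp: coset_full)
    show "\<And>c. \<forall>v'\<in>q x u. \<forall>w\<in>q x v. B v' w = c \<Longrightarrow> c = B u v" using ** by auto
  qed
qed

lemma EJ_perp_fibre_eq: "x \<in> D \<Longrightarrow> EJ_perp_fibre b J D x = q x ` perp_lifts x"
proof -
  assume x: "x \<in> D"
  have c: "carr (fibre E x) = q x ` cperp b x" using parametrizes_E[OF x] by (simp add: parametrizes_def)
  have "(\<forall>A\<in>EJ_fibre b J x. induced_form b (q x u) A = 0) \<longleftrightarrow> B u (Psi (omega x)) = 0"
    if u: "u \<in> cperp b x" for u
  proof -
    have "(\<forall>A\<in>EJ_fibre b J x. induced_form b (q x u) A = 0) \<longleftrightarrow> (\<forall>k\<in>cperp b x \<inter> JC. B u k = 0)"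
      by (simp add: EJ_fibre_def induced_form_q x u)
    also have "\<dots> \<longleftrightarrow> B u (Psi (omega x)) = 0"
      by (auto simp: cperp_JC x form_ext_linear dest: spec[of _ 1])
    finally show ?thesis .
  qed
  then show ?thesis
    unfolding EJ_perp_fibre_def c using x by (auto simp: perp_lifts_def cperp_eq)
qed

lemma J_line_perp_lifts: "x \<in> D \<Longrightarrow> cperp b x \<inter> JC \<subseteq> perp_lifts x"
proof -
  assume x: "x \<in> D"
  have "B (Psi (omega x)) (Psi (omega x)) = 0" by (simp add: Psi_def form_ext_linear ee ef)
  then have "c *s Psi (omega x) \<in> perp_lifts x" if "c *s Psi (omega x) \<in> cperp b x" for c
    using that x by (simp add: perp_lifts_def cperp_eq form_ext_linear)
  moreover have "\<exists>c. v = c *s Psi (omega x)" if "v \<in> cperp b x \<inter> JC" for v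
    using that unfolding cperp_JC[OF x] by (rule imageE) blast
  ultimately show ?thesis by blast
qed

definition gr1_class :: "(complex^'m) set \<Rightarrow> complex^'m \<Rightarrow> (complex^'m) set set" where
  "gr1_class x u = coset (fibre E x) (EJ_fibre b J x) (q x u)"

definition gr2_class :: "(complex^'m) set \<Rightarrow> complex^'m \<Rightarrow> (complex^'m) set set" where
  "gr2_class x u = coset (fibre E x) (EJ_perp_fibre b J D x) (q x u)"

abbreviation Gr1 where "Gr1 \<equiv> quotient_bundle X (EJ_perp b J D) (EJ_fibre b J)"
abbreviation Gr2 where "Gr2 \<equiv> quotient_bundle X E (EJ_perp_fibre b J D)"

lemma fibre_EJ_perp: "fibre (EJ_perp b J D) x = sub_vs (fibre E x) (EJ_perp_fibre b J D x)"
  by (simp add: EJ_perp_def sub_bundle_def)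

lemma parametrizes_EJ_perp: "x \<in> D \<Longrightarrow> parametrizes (fibre (EJ_perp b J D) x) (perp_lifts x) (q x)"
  using parametrizes_sub[OF parametrizes_E subspace_perp_lifts perp_lifts_cperp, of x]
  by (simp add: fibre_EJ_perp EJ_perp_fibre_eq)

lemma parametrizes_Gr1: "x \<in> D \<Longrightarrow> parametrizes (fibre Gr1 x) (perp_lifts x) (gr1_class x)"
  using parametrizes_quot[OF parametrizes_EJ_perp subspace_J_line J_line_perp_lifts, of x]
  unfolding gr1_class_def[abs_def] by (simp add: quotient_bundle_def EJ_fibre_def[symmetric] fibre_EJ_perp)

lemma parametrizes_Gr2: "x \<in> D \<Longrightarrow> parametrizes (fibre Gr2 x) (cperp b x) (gr2_class x)"
  using parametrizes_quot[OF parametrizes_E subspace_perp_lifts perp_lifts_cperp, of x]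
  unfolding gr2_class_def[abs_def] by (simp add: quotient_bundle_def EJ_perp_fibre_eq[symmetric])

lemma gr1_class_eq_iff:
  assumes x: "x \<in> D" and "u \<in> cperp b x" "v \<in> cperp b x"
  shows "gr1_class x u = gr1_class x v \<longleftrightarrow> (\<exists>t\<in>cperp b x \<inter> JC. u - (v + t) \<in> x)"
  unfolding gr1_class_def EJ_fibre_def
  using coset_eq_iff_parametrized[OF parametrizes_E subspace_J_line _ assms(2,3)] x
  by (simp add: q_eq_iff)

text \<open>
  Pairing with \<open>\<Psi> \<omega>\<close> is thus a coordinate on the one-dimensional fibre of \<open>\<E>/\<E>\<^sub>J\<^sup>\<bottom>\<close>.
\<close>

lemma gr2_class_eq_iff:
  assumes x: "x \<in> D" and u: "u \<in> cperp b x" and v: "v \<in> cperp b x"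
  shows "gr2_class x u = gr2_class x v \<longleftrightarrow> B u (Psi (omega x)) = B v (Psi (omega x))"
proof -
  have "gr2_class x u = gr2_class x v \<longleftrightarrow> (\<exists>t\<in>perp_lifts x. u - (v + t) \<in> x)"
    unfolding gr2_class_def EJ_perp_fibre_eq[OF x]
    using coset_eq_iff_parametrized[OF parametrizes_E[OF x] subspace_perp_lifts perp_lifts_cperp[OF x] u v] x
    by (simp add: q_eq_iff)
  also have "\<dots> \<longleftrightarrow> B u (Psi (omega x)) = B v (Psi (omega x))"
  proof
    assume "\<exists>t\<in>perp_lifts x. u - (v + t) \<in> x"
    then obtain t where t: "t \<in> perp_lifts x" "u - (v + t) \<in> x" by blast
    have "1 *s Psi (omega x) \<in> cperp b x" using cperp_JC[OF x] by blast
    then have "B (Psi (omega x)) (u - (v + t)) = 0"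
      using t(2) by (simp add: cperp_def)
    then show "B u (Psi (omega x)) = B v (Psi (omega x))"
      using t(1) by (simp add: B_sym[of "Psi (omega x)"] form_ext_linear perp_lifts_def)
  next
    assume "B u (Psi (omega x)) = B v (Psi (omega x))"
    then have "u - v \<in> perp_lifts x"
      using u v x by (simp add: perp_lifts_def cperp_eq form_ext_linear)
    moreover have "u - (v + (u - v)) \<in> x" using subspace_point[OF x] by (simp add: vec.subspace_0)
    ultimately show "\<exists>t\<in>perp_lifts x. u - (v + t) \<in> x" by blast
  qed
  finally show ?thesis .
qed


section \<open>The half plane and its tautological bundle\<close>

lemma p_eq_iff: "p u = p v \<longleftrightarrow> B u e1 = B v e1 \<and> B u e2 = B v e2"
  unfolding proj_J_def coset_full_eq_iff[OF subspace_KC] by (simp add: Jperp_eq form_ext_linear)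

text \<open>
  For \<open>e \<in> J\<close> the pairing with \<open>e\<close> is constant on cosets of \<open>J\<^sup>\<bottom>\<close>, so that the choice of an element does
  not matter.
\<close>

definition quot_pair :: "complex^'m \<Rightarrow> (complex^'m) set \<Rightarrow> complex" where
  "quot_pair e A = B (SOME v. v \<in> A) e"

lemma quot_pair_p: "quot_pair e1 (p v) = B v e1" "quot_pair e2 (p v) = B v e2"
proof -
  have "v \<in> p v"
    using vec.subspace_0[OF subspace_KC] by (force simp: proj_J_def coset_full)
  then have "(SOME u. u \<in> p v) \<in> p v" by (rule someI)
  then have "(SOME u. u \<in> p v) - v \<in> KC" by (auto simp: proj_J_def coset_full)
  then show "quot_pair e1 (p v) = B v e1" "quot_pair e2 (p v) = B v e2"
    by (simp_all add: quot_pair_def Jperp_eq form_ext_linear)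
qed

text \<open>
  The global frame of \<open>\<L>\<^sub>J\<close>: over \<open>\<pi>(\<D>)\<close> the functional \<open>(\<cdot>,e2)\<close> does not vanish on the line \<open>y\<close>.
\<close>

definition frame :: "(complex^'m) set set \<Rightarrow> (complex^'m) set" where
  "frame y = (SOME A. A \<in> y \<and> quot_pair e2 A = 1)"

lemma frame_pline:
  assumes "B v e2 \<noteq> 0" shows "frame (pline p v) = p ((1 / B v e2) *s v)"
  unfolding frame_def
proof (rule some_equality)
  show "p ((1 / B v e2) *s v) \<in> pline p v \<and> quot_pair e2 (p ((1 / B v e2) *s v)) = 1"
    using assms by (auto simp: pline_def form_ext_linear quot_pair_p)
  fix A assume "A \<in> pline p v \<and> quot_pair e2 A = 1"
  then obtain c where c: "A = p (c *s v)" "c * B v e2 = 1" by (auto simp: pline_def form_ext_linear quot_pair_p)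
  then have "c = 1 / B v e2" using assms by (simp add: field_simps)
  then show "A = p ((1 / B v e2) *s v)" using c by simp
qed

lemma pi_pline: "\<pi> (pline id v) = pline p v"
  by (auto simp: pi_J_def pline_def)

lemma pi_eq: "x \<in> D \<Longrightarrow> \<pi> x = pline p (omega x)"
  using point_pline pi_pline by metis

lemma frame_pi: "x \<in> D \<Longrightarrow> frame (\<pi> x) = p (omega x)"
  using frame_pline[of "omega x"] by (simp add: pi_eq omega_e2)

lemma pi_range: "x \<in> D \<Longrightarrow> \<pi> x = range (\<lambda>c. p (c *s omega x))"
  by (simp add: pi_eq pline_def)

text \<open>
  The affine chart where \<open>(\<cdot>,e2) \<noteq> 0\<close>. Taking \<open>f\<close> to be the identity or the projection to \<open>L/J\<^sup>\<bottom>\<close> covers both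
  projective spaces at once.
\<close>

definition chart :: "(complex^'m \<Rightarrow> 'w) \<Rightarrow> 'w set set" where
  "chart f = {pline f v |v. B v e2 \<noteq> 0}"

lemma
  fixes f :: "complex^'m \<Rightarrow> 'w"
  assumes inv: "\<And>u v. f u = f v \<Longrightarrow> B u e2 = B v e2"
  shows pline_in_chart: "pline f v \<in> chart f \<longleftrightarrow> B v e2 \<noteq> 0"
    and openin_chart: "openin (top_of (proj_space f)) (chart f)"
proof -
  show *: "pline f v \<in> chart f \<longleftrightarrow> B v e2 \<noteq> 0" for v
  proof
    assume "pline f v \<in> chart f"
    then obtain v' where v': "pline f v = pline f v'" "B v' e2 \<noteq> 0" by (auto simp: chart_def)
    have "f (1 *s v') \<in> pline f v'" unfolding pline_def by blast
    then obtain c where "f v' = f (c *s v)" using v'(1) by (auto simp: pline_def)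
    from inv[OF this] show "B v e2 \<noteq> 0" using v'(2) by (auto simp: form_ext_linear)
  qed (auto simp: chart_def)
  have "open {v. B v e2 \<noteq> 0}"
    by (intro open_Collect_neq linear_continuous_on bounded_linear_form_ext continuous_on_const)
  moreover have "pline f v \<in> proj_points f" if "B v e2 \<noteq> 0" for v
    using inv[of v 0] that by (auto simp: proj_points_def form_ext_linear)
  ultimately show "openin (top_of (proj_space f)) (chart f)"
    unfolding openin_proj_space using * by (auto simp: chart_def)
qed

text \<open>
  Affine coordinates, quotients of two linear forms, are holomorphic. This one statement gives the holomorphy of
  the normalised period on \<open>\<D>\<close> and of the coordinate of the half plane.
\<close>

lemma hol_chart:
  fixes f :: "complex^'m \<Rightarrow> 'w"
  assumes inv: "\<And>u v. f u = f v \<Longrightarrow> B u e2 = B v e2"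
    and h: "\<And>v. B v e2 \<noteq> 0 \<Longrightarrow> h (pline f v) = l v / B v e2"
    and l: "\<And>u v. l (u + v) = l u + l v" "\<And>c v. l (c *s v) = c * l v"
    and U: "U \<subseteq> chart f"
  shows "h \<in> hol_of (subspace_of (proj_space f) S) U"
proof (rule hol_subspace_ofI)
  fix x assume "x \<in> U"
  have "{v. pline f v \<in> chart f} = {v. B v e2 \<noteq> 0}" using pline_in_chart[of f, OF inv] by auto
  moreover have "holo_on (\<lambda>v. h (pline f v)) {v. B v e2 \<noteq> 0}"
  proof -
    have ho: "holo_on (\<lambda>v. l v / B v e2) {v. B v e2 \<noteq> 0}"
      by (intro holo_on_divide holo_on_linear) (auto simp: l form_ext_linear)
    show ?thesis
      unfolding holo_on_def
    proof
      fix z assume z: "z \<in> {v. B v e2 \<noteq> 0}"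
      with ho obtain f' where f': "((\<lambda>v. l v / B v e2) has_derivative f') (at z)"
        "\<forall>c v. f' (c *s v) = c * f' v"
        by (auto simp: holo_on_def)
      have "open {v. B v e2 \<noteq> 0}"
        by (intro open_Collect_neq linear_continuous_on bounded_linear_form_ext continuous_on_const)
      then have "((\<lambda>v. h (pline f v)) has_derivative f') (at z)"
        by (rule has_derivative_transform_within_open[OF f'(1)]) (use z h in auto)
      with f'(2) show "\<exists>f'. ((\<lambda>v. h (pline f v)) has_derivative f') (at z) \<and> (\<forall>c v. f' (c *s v) = c * f' v)"
        by blast
    qed
  qed
  ultimately show "\<exists>V g. openin (top_of (proj_space f)) V \<and> x \<in> V \<and> g \<in> hol_of (proj_space f) V \<and>
      (\<forall>y\<in>U \<inter> V. h y = g y)"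
    using openin_chart[of f, OF inv] U \<open>x \<in> U\<close>
    by (intro exI[of _ "chart f"] exI[of _ h]) (auto simp: hol_proj_space_iff)
qed

sublocale X: function_sheaf X
  unfolding domain_space_def by (rule function_sheaf_subspace_of_proj_space)

sublocale H: function_sheaf H
  unfolding HJ_space_def by (rule function_sheaf_subspace_of_proj_space)

lemma D_chart: "D \<subseteq> chart id"
  using point_pline omega_e2 by (force simp: chart_def)

lemma hol_omega: "U \<subseteq> D \<Longrightarrow> X.hol_vector U omega"
  unfolding X.hol_vector_def
proof
  fix i assume U: "U \<subseteq> D"
  show "(\<lambda>x. omega x $ i) \<in> hol_of X U"
    unfolding domain_space_def
    by (rule hol_chart[where l = "\<lambda>v. v $ i"]) (use D_chart U in \<open>auto simp: omega_pline\<close>)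
qed

lemma H_chart: "\<pi> ` D \<subseteq> chart p"
  using pi_eq omega_e2 by (force simp: chart_def)

lemma hol_frame: "V \<subseteq> \<pi> ` D \<Longrightarrow> (\<lambda>y. quot_pair e1 (frame y)) \<in> hol_of H V"
  unfolding HJ_space_def
  by (intro hol_chart[where l = "\<lambda>v. B v e1"])
    (use H_chart in \<open>auto simp: frame_pline quot_pair_p form_ext_linear p_eq_iff\<close>)

lemma topspace_X: "topspace (top_of X) = D"
proof -
  have "D \<subseteq> topspace (top_of (proj_space id))"
    using D_chart openin_chart[of id] openin_subset by fastforce
  then show ?thesis by (auto simp: domain_space_def subspace_of_def)
qed

lemma topspace_H: "topspace (top_of H) = \<pi> ` D"
proof -
  have "\<pi> ` D \<subseteq> topspace (top_of (proj_space p))"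
    using H_chart openin_chart[of p] openin_subset p_eq_iff by fastforce
  then show ?thesis by (auto simp: HJ_space_def subspace_of_def)
qed

lemma open_X_subset: "openin (top_of X) U \<Longrightarrow> U \<subseteq> D"
  using openin_subset topspace_X by blast

lemma open_H_subset: "openin (top_of H) V \<Longrightarrow> V \<subseteq> \<pi> ` D"
  using openin_subset topspace_H by blast

lemma openin_H: "openin (top_of H) (\<pi> ` D)"
  using openin_topspace topspace_H by metis

text \<open>
  A local extension \<open>k\<close> of \<open>h\<close> pulls back to a local extension of \<open>h \<circ> \<pi>\<close>, since both projective spaces are
  presented by the same vectors of \<open>\<complex>\<^sup>m\<close>.
\<close>

lemma hol_pullback:
  assumes "h \<in> hol_of H V" "U \<subseteq> D" "\<pi> ` U \<subseteq> V"
  shows "(\<lambda>x. h (\<pi> x)) \<in> hol_of X U"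
  unfolding domain_space_def
proof (rule hol_subspace_ofI)
  fix x assume x: "x \<in> U"
  with assms have "\<pi> x \<in> V" by blast
  from hol_subspace_ofE[OF assms(1)[unfolded HJ_space_def] this]
  obtain V' k where V': "openin (top_of (proj_space p)) V'" "\<pi> x \<in> V'" "k \<in> hol_of (proj_space p) V'"
    "\<And>y. y \<in> V \<Longrightarrow> y \<in> V' \<Longrightarrow> h y = k y" by metis
  let ?V = "{l \<in> chart id. \<pi> l \<in> V'}"
  have iff: "pline id v \<in> ?V \<longleftrightarrow> pline id v \<in> chart id \<and> pline p v \<in> V'" for v
    by (simp add: pi_pline)
  have "openin (top_of (proj_space id)) (chart id)" by (rule openin_chart) simp
  then have "openin (top_of (proj_space id)) ?V"
    using V'(1) unfolding openin_proj_space iff by (auto simp: Collect_conj_eq)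
  moreover have "(\<lambda>x. k (\<pi> x)) \<in> hol_of (proj_space id) ?V"
    unfolding hol_proj_space_iff iff pi_pline
    by (rule holo_on_subset[OF V'(3)[unfolded hol_proj_space_iff]]) blast
  moreover have "x \<in> ?V" using x assms(2) D_chart V'(2) by blast
  moreover have "\<forall>y\<in>U \<inter> ?V. h (\<pi> y) = k (\<pi> y)"
    using V'(4) assms(3) by blast
  ultimately show "\<exists>V g. openin (top_of (proj_space id)) V \<and> x \<in> V \<and> g \<in> hol_of (proj_space id) V \<and>
      (\<forall>y\<in>U \<inter> V. h (\<pi> y) = g y)"
    by (intro exI[of _ ?V] exI[of _ "\<lambda>x. k (\<pi> x)"]) blast
qed

lemma parametrizes_W: "parametrizes W UNIV p"
  using parametrizes_quot_full[OF subspace_KC] by (simp add: proj_J_def[abs_def])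

abbreviation LJB where "LJB \<equiv> LJ b J D"

lemma fibre_LJ: "fibre LJB y = sub_vs W y"
  by (simp add: LJ_def sub_bundle_def trivial_bundle_def)

lemma W_ops: "add W (p u) (p v) = p (u + v)" "scl W c (p u) = p (c *s u)" "zer W = p 0" "carr W = range p"
  using parametrizes_W by (auto simp: parametrizes_def)

text \<open>
  The functional \<open>(\<cdot>,e2)\<close> is the coordinate with respect to \<open>frame\<close>.
\<close>

lemma hol_LJ_coordinate:
  assumes "t \<in> sections LJB V"
  shows "(\<lambda>y. quot_pair e2 (t y)) \<in> hol_of H V"
proof (rule H.hol_local)
  fix y assume y: "y \<in> V"
  have "t \<in> sections (trivial_bundle H W (\<lambda>g A. complexify g ` A)) V"
    using assms by (simp add: LJ_def sub_bundle_def)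
  from bspec[OF this[unfolded sections_trivial_bundle] y] obtain V' fws where
    *: "openin (top_of H) V'" "y \<in> V'" "V' \<subseteq> V"
    "\<forall>(f, w)\<in>set fws. f \<in> hol_of H V' \<and> w \<in> carr W"
    "\<forall>y\<in>V'. t y = lincomb W (map (\<lambda>(f, w). (f y, w)) fws)"
    by (elim exE conjE) (rule that)
  have t: "quot_pair e2 (t z) = (\<Sum>(f, w)\<leftarrow>fws. f z * quot_pair e2 w)" if "z \<in> V'" for z
  proof -
    have "quot_pair e2 (lincomb W (map (\<lambda>(f, w). (f z, w)) fws)) =
       (\<Sum>(c, w)\<leftarrow>map (\<lambda>(f, w). (f z, w)) fws. c * quot_pair e2 w)"
      by (rule lincomb_functional[where C = "carr W", THEN conjunct2])
        (use *(4) in \<open>auto simp: W_ops quot_pair_p form_ext_linear\<close>)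
    then show ?thesis using *(5) that by (simp add: o_def split_def)
  qed
  have "(\<lambda>z. \<Sum>(f, w)\<leftarrow>fws. f z * quot_pair e2 w) \<in> hol_of H V'"
    using H.hol_sum_list_pairs[OF *(1), of fws "quot_pair e2"] *(4) by blast
  then have "(\<lambda>y. quot_pair e2 (t y)) \<in> hol_of H V'"
    by (rule H.hol_cong) (simp add: t)
  with * show "\<exists>V'. openin (top_of H) V' \<and> y \<in> V' \<and> V' \<subseteq> V \<and> (\<lambda>y. quot_pair e2 (t y)) \<in> hol_of H V'"
    by blast
qed

text \<open>
  In the basis of \<open>L/J\<^sup>\<bottom>\<close> given by \<open>f1, f2\<close> the frame is \<open>\<tau> f1 + f2\<close> with \<open>\<tau> = (\<omega>,e1)\<close>.
\<close>

lemma frame_section: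
  assumes V: "openin (top_of H) V"
  shows "frame \<in> sections LJB V"
proof -
  have sub: "V \<subseteq> \<pi> ` D" by (rule open_H_subset[OF V])
  let ?l = "[(\<lambda>y. quot_pair e1 (frame y), p f1), (\<lambda>y. 1, p f2)]"
  have 1: "frame y = lincomb W (map (\<lambda>(f, w). (f y, w)) ?l)" if "y \<in> V" for y
  proof -
    have "y \<in> \<pi> ` D" using sub \<open>y \<in> V\<close> by blast
    then obtain x where x: "x \<in> D" "y = \<pi> x" by blast
    show ?thesis
      by (simp add: lincomb_def W_ops x frame_pi quot_pair_p p_eq_iff form_ext_linear fe omega_e2)
  qed
  have 2: "\<forall>(f, w)\<in>set ?l. f \<in> hol_of H V \<and> w \<in> carr W"
    using hol_frame[OF sub] H.hol_const[OF V] by (auto simp: W_ops)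
  have 3: "frame y \<in> y" if "y \<in> V" for y
  proof -
    have "y \<in> \<pi> ` D" using sub \<open>y \<in> V\<close> by blast
    then obtain x where x: "x \<in> D" "y = \<pi> x" by blast
    have "p (1 *s omega x) \<in> \<pi> x" unfolding pi_range[OF x(1)] by blast
    then show ?thesis using frame_pi x by simp
  qed
  have "frame \<in> sections (trivial_bundle H W (\<lambda>g A. complexify g ` A)) V"
    unfolding sections_trivial_bundle using 1 2 V by blast
  with 3 show ?thesis by (simp add: LJ_def sub_bundle_def)
qed

end

section \<open>Sections of the Hodge bundle and the group action\<close>

lemma bij_image_eq:
  assumes "bij f" "\<And>x. f x \<in> B \<longleftrightarrow> x \<in> A" shows "f ` A = B"
proof -
  have "A = f -` B" using assms(2) by blast
  then show ?thesis using assms(1) by (simp add: bij_is_surj surj_image_vimage_eq)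
qed

lemma sections_quotient_bundle:
  "s \<in> sections (quotient_bundle X E S) U \<longleftrightarrow>
    (\<forall>x\<in>U. \<exists>U'. openin (top_of X) U' \<and> x \<in> U' \<and> U' \<subseteq> U \<and>
          (\<exists>t\<in>sections E U'. \<forall>y\<in>U'. s y = coset (fibre E y) (S y) (t y)))"
  by (simp add: quotient_bundle_def)

lemma sections_pullback_bundle:
  "s \<in> sections (pullback_bundle X Y \<pi> E) U \<longleftrightarrow>
    (\<forall>x\<in>U. \<exists>U' V fts. openin (top_of X) U' \<and> x \<in> U' \<and> U' \<subseteq> U \<and>
          openin (top_of Y) V \<and> \<pi> ` U' \<subseteq> V \<and>
          (\<forall>(f, t)\<in>set fts. f \<in> hol_of X U' \<and> t \<in> sections E V) \<and>
          (\<forall>y\<in>U'. s y = lincomb (fibre E (\<pi> y)) (map (\<lambda>(f, t). (f y, t (\<pi> y))) fts)))"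
  by (simp add: pullback_bundle_def)

lemma sections_dual_bundle:
  "s \<in> sections (dual_bundle X E) U \<longleftrightarrow>
    (\<forall>x\<in>U. s x \<in> carr (dual_vs (fibre E x))) \<and>
          (\<forall>U' t. openin (top_of X) U' \<longrightarrow> U' \<subseteq> U \<longrightarrow> t \<in> sections E U' \<longrightarrow>
             (\<lambda>x. s x (t x)) \<in> hol_of X U')"
  by (simp add: dual_bundle_def)

lemma sections_sub_bundle:
  "s \<in> sections (sub_bundle E S) U \<longleftrightarrow> s \<in> sections E U \<and> (\<forall>x\<in>U. s x \<in> S x)"
  by (simp add: sub_bundle_def)

context hodge_setup begin

text \<open>
  The local lifts of a section to \<open>\<L>\<^sup>\<bottom>\<close> are holomorphic vectors orthogonal to the period.
\<close>

lemma sections_E: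
  "s \<in> sections E U \<longleftrightarrow>
    (\<forall>x\<in>U. \<exists>U'. openin (top_of X) U' \<and> x \<in> U' \<and> U' \<subseteq> U \<and>
      (\<exists>t. X.hol_vector U' t \<and> (\<forall>y\<in>U'. t y \<in> cperp b y \<and> s y = q y (t y))))"
proof -
  have "t \<in> sections (sub_bundle (trivial_bundle X full_vs complexify) (cperp b)) U' \<longleftrightarrow>
      X.hol_vector U' t \<and> (\<forall>y\<in>U'. t y \<in> cperp b y)" if "openin (top_of X) U'" for U' t
    using X.sections_trivial_full[OF that, of t complexify] by (simp add: sections_sub_bundle)
  moreover have "coset (fibre (sub_bundle (trivial_bundle X full_vs complexify) (cperp b)) y) y = q y" for y
    by (simp add: sub_bundle_def trivial_bundle_def fun_eq_iff)
  ultimately show ?thesis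
    unfolding second_hodge_def sections_quotient_bundle
    by (intro ball_cong refl ex_cong1 conj_cong) auto
qed

lemma section_E_lift:
  assumes "openin (top_of X) U" "X.hol_vector U t" "\<And>y. y \<in> U \<Longrightarrow> t y \<in> cperp b y \<and> s y = q y (t y)"
  shows "s \<in> sections E U"
  unfolding sections_E using assms by blast

lemma act_E: "act E g x A = complexify g ` A"
  by (simp add: second_hodge_def quotient_bundle_def sub_bundle_def trivial_bundle_def)

text \<open>
  \<open>J\<^sup>\<bottom>\<close> is determined by \<open>J\<close> and the form.
\<close>

lemma G_KC: "g \<in> G \<Longrightarrow> complexify g ` KC = KC"
proof -
  assume g: "g \<in> G"
  have KC: "KC = {v. \<forall>w\<in>JC. B v w = 0}"
    by (auto simp: Jperp_eq J_eq form_ext_linear dest: spec[of _ e1])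
      (metis ee add.right_neutral vec.scale_one vec.scale_zero_left add.left_neutral)+
  have iff: "complexify g v \<in> KC \<longleftrightarrow> v \<in> KC" for v
  proof -
    have "complexify g v \<in> KC \<longleftrightarrow> (\<forall>w\<in>complexify g ` JC. B (complexify g v) w = 0)"
      by (subst KC) (simp only: G_J[OF g] mem_Collect_eq)
    also have "\<dots> \<longleftrightarrow> v \<in> KC" by (subst KC) (simp add: G_form[OF g])
    finally show ?thesis .
  qed
  show ?thesis by (rule bij_image_eq[OF G_bij[OF g] iff])
qed

lemma G_p: "g \<in> G \<Longrightarrow> complexify g ` p v = p (complexify g v)"
  by (simp add: proj_J_def complexify_coset G_KC)

lemma G_Psi: "g \<in> G \<Longrightarrow> Psi (complexify g v) = complexify g (Psi v)"
  using G_det by (simp add: Psi_def)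

lemma G_point: "act_point g x = complexify g ` x"
  by (simp add: act_point_def)

text \<open>
  The group does not fix \<open>e2\<close>, so it preserves the normalisation only up to this factor of automorphy.
\<close>

lemma G_omega:
  assumes "g \<in> G" "x \<in> D"
  shows "complexify g (omega x) = B (complexify g (omega x)) e2 *s omega (act_point g x)"
    and "B (complexify g (omega x)) e2 \<noteq> 0"
proof -
  let ?y = "act_point g x"
  have y: "?y \<in> D" by (rule G_D[OF assms])
  have "1 *s omega x \<in> x" using point_eq[OF assms(2)] by blast
  then have "complexify g (omega x) \<in> ?y" unfolding G_point by simp
  then obtain c where c: "complexify g (omega x) = c *s omega ?y" using point_eq[OF y] by blast
  then have c': "c = B (complexify g (omega x)) e2" by (simp add: form_ext_linear omega_e2[OF y])
  with c show "complexify g (omega x) = B (complexify g (omega x)) e2 *s omega (act_point g x)" by simp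
  have "complexify g 0 = 0" using complexify_scale[of g 0 0] by simp
  moreover have "omega x \<noteq> 0" using omega_e2[OF assms(2)] by (auto simp: form_ext_linear)
  ultimately have "complexify g (omega x) \<noteq> 0"
    using G_bij[OF assms(1)] by (metis bij_pointE)
  then have "c \<noteq> 0" unfolding c by simp
  then show "B (complexify g (omega x)) e2 \<noteq> 0" unfolding c' .
qed

lemma G_cperp: "g \<in> G \<Longrightarrow> x \<in> D \<Longrightarrow> complexify g u \<in> cperp b (act_point g x) \<longleftrightarrow> u \<in> cperp b x"
  by (simp add: cperp_def G_point G_form)

lemma G_q: "complexify g ` q x u = q (act_point g x) (complexify g u)"
  by (simp add: complexify_coset G_point)

lemma G_JC: "g \<in> G \<Longrightarrow> complexify g u \<in> JC \<longleftrightarrow> u \<in> JC"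
  using G_J[of g] G_bij[of g] by (metis bij_is_inj inj_image_mem_iff)

lemma G_J_line: "g \<in> G \<Longrightarrow> x \<in> D \<Longrightarrow>
    complexify g ` (cperp b x \<inter> JC) = cperp b (act_point g x) \<inter> JC"
  by (rule bij_image_eq[OF G_bij]) (simp_all add: G_cperp G_JC)

lemma G_Psi_omega: "g \<in> G \<Longrightarrow> x \<in> D \<Longrightarrow>
    complexify g (Psi (omega x)) = B (complexify g (omega x)) e2 *s Psi (omega (act_point g x))"
  using G_omega(1)[of g x] by (simp flip: G_Psi Psi_scale)

lemma G_perp_lifts: "g \<in> G \<Longrightarrow> x \<in> D \<Longrightarrow> complexify g u \<in> perp_lifts (act_point g x) \<longleftrightarrow> u \<in> perp_lifts x"
proof -
  assume g: "g \<in> G" and x: "x \<in> D"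
  let ?m = "B (complexify g (omega x)) e2"
  have "B u (omega x) = ?m * B (complexify g u) (omega (act_point g x))"
    using G_form[OF g, of u "omega x"] G_omega(1)[OF g x] by (metis form_ext_scale_right)
  moreover have "B u (Psi (omega x)) = ?m * B (complexify g u) (Psi (omega (act_point g x)))"
    using G_form[OF g, of u "Psi (omega x)"] G_Psi_omega[OF g x] by (metis form_ext_scale_right)
  ultimately show ?thesis using G_omega(2)[OF g x] by (simp add: perp_lifts_def)
qed

lemma G_perp_lifts_image: "g \<in> G \<Longrightarrow> x \<in> D \<Longrightarrow> complexify g ` perp_lifts x = perp_lifts (act_point g x)"
  by (rule bij_image_eq[OF G_bij]) (simp_all add: G_perp_lifts)

section \<open>The line bundle \<open>\<E>\<^sub>J\<close>\<close>

text \<open>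
  As \<open>(\<Psi> \<omega>, f1) = -1\<close>, the coefficient of \<open>u\<close> with respect to \<open>\<Psi> \<omega>\<close> is \<open>- (u,f1)\<close>; so this is the map \<open>\<Psi> v \<mapsto> v\<close>
  on \<open>\<complex>\<omega>\<close>, with values modulo \<open>J\<^sup>\<bottom>\<close>.
\<close>

definition to_LJ :: "(complex^'m) set \<Rightarrow> complex^'m \<Rightarrow> (complex^'m) set" where
  "to_LJ x u = p ((- B u f1) *s omega x)"

lemma J_line_coeff: "x \<in> D \<Longrightarrow> u \<in> cperp b x \<inter> JC \<Longrightarrow> u = (- B u f1) *s Psi (omega x)"
proof -
  assume x: "x \<in> D" and "u \<in> cperp b x \<inter> JC"
  then obtain c where c: "u = c *s Psi (omega x)" using cperp_JC by blast
  then have "c = - B u f1" by (simp add: form_ext_linear Psi_omega_f1[OF x])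
  with c show ?thesis by simp
qed

lemma J_line_mem: "x \<in> D \<Longrightarrow> c *s Psi (omega x) \<in> cperp b x \<inter> JC"
  using cperp_JC by blast

lemma parametrizes_to_LJ:
  assumes x: "x \<in> D" shows "parametrizes (sub_vs W (\<pi> x)) (cperp b x \<inter> JC) (to_LJ x)"
  unfolding parametrizes_def
proof (intro conjI ballI allI subspace_J_line)
  have "p (c *s omega x) = to_LJ x (c *s Psi (omega x))" for c
    by (simp add: to_LJ_def form_ext_linear Psi_omega_f1[OF x])
  then have "\<pi> x \<subseteq> to_LJ x ` (cperp b x \<inter> JC)"
    using J_line_mem[OF x] unfolding pi_range[OF x] by blast
  moreover have "to_LJ x ` (cperp b x \<inter> JC) \<subseteq> \<pi> x"
    unfolding pi_range[OF x] to_LJ_def by blast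
  ultimately show "carr (sub_vs W (\<pi> x)) = to_LJ x ` (cperp b x \<inter> JC)" by simp
qed (simp_all add: to_LJ_def W_ops form_ext_linear vec.scale_left_distrib algebra_simps)

lemma to_LJ_eq_iff:
  assumes x: "x \<in> D" and u: "u \<in> cperp b x \<inter> JC" and v: "v \<in> cperp b x \<inter> JC"
  shows "q x u = q x v \<longleftrightarrow> to_LJ x u = to_LJ x v"
proof -
  have "q x u = q x v \<longleftrightarrow> u = v"
    using point_inter_JC[OF x, of "u - v"] u v subspace_JC subspace_point[OF x]
    by (auto simp: q_eq_iff[OF x] vec.subspace_diff vec.subspace_0)
  moreover have "to_LJ x u = to_LJ x v \<longleftrightarrow> u = v"
    using J_line_coeff[OF x u] J_line_coeff[OF x v] omega_e2[OF x]
    by (auto simp: to_LJ_def p_eq_iff form_ext_linear)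
  ultimately show ?thesis by simp
qed

abbreviation PL where "PL \<equiv> pullback_bundle X H \<pi> LJB"

text \<open>
  A holomorphic lift \<open>t\<close> of a section with values in \<open>\<omega>\<^sup>\<bottom>\<close> need not lie in \<open>J\<close>; subtracting \<open>(t,e2) \<omega>\<close> moves it there.
\<close>

lemma sections_EJ_iff:
  assumes U: "openin (top_of X) U" and u: "\<And>x. x \<in> U \<Longrightarrow> u x \<in> cperp b x \<inter> JC"
    and s: "\<And>x. x \<in> U \<Longrightarrow> s x = q x (u x)"
  shows "s \<in> sections (EJ b J D) U \<longleftrightarrow> (\<lambda>x. - B (u x) f1) \<in> hol_of X U"
proof
  have UD: "U \<subseteq> D" by (rule open_X_subset[OF U])
  {
    assume "s \<in> sections (EJ b J D) U"
    then have sE: "s \<in> sections E U" by (simp add: EJ_def sections_sub_bundle)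
    show "(\<lambda>x. - B (u x) f1) \<in> hol_of X U"
    proof (rule X.hol_local)
      fix x assume "x \<in> U"
      from bspec[OF sE[unfolded sections_E] this] obtain U' t where
        *: "openin (top_of X) U'" "x \<in> U'" "U' \<subseteq> U" "X.hol_vector U' t"
          "\<forall>y\<in>U'. t y \<in> cperp b y \<and> s y = q y (t y)" by blast
      have hol: "(\<lambda>y. - B (t y - B (t y) e2 *s omega y) f1) \<in> hol_of X U'"
        using *(1,3,4) UD by (intro X.hol_minus X.hol_form_ext X.hol_vector_const X.hol_vector_diff
            X.hol_vector_scale hol_omega) auto
      have lift: "t y - B (t y) e2 *s omega y = u y" if "y \<in> U'" for y
      proof -
        have y: "y \<in> D" "y \<in> U" using that * UD by auto
        have "q y (t y) = q y (u y)" using * s y that by metis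
        then have "t y - u y \<in> y" using q_eq_iff[OF y(1)] by simp
        then obtain c where c: "t y - u y = c *s omega y" using point_eq[OF y(1)] by blast
        moreover have "B (u y) e2 = 0" using u[OF y(2)] JC_KC by (auto simp: Jperp_eq)
        ultimately have "B (t y) e2 = c"
          using omega_e2[OF y(1)] by (metis form_ext_diff_left form_ext_scale_left mult_1_right diff_zero)
        with c show ?thesis by (simp add: algebra_simps)
      qed
      have "(\<lambda>x. - B (u x) f1) \<in> hol_of X U'"
        by (rule X.hol_cong[OF hol]) (simp add: lift)
      with * show "\<exists>U'. openin (top_of X) U' \<and> x \<in> U' \<and> U' \<subseteq> U \<and> (\<lambda>x. - B (u x) f1) \<in> hol_of X U'"
        by blast
    qed
  next
    assume a: "(\<lambda>x. - B (u x) f1) \<in> hol_of X U"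
    have "X.hol_vector U (\<lambda>x. (- B (u x) f1) *s (B (omega x) e1 *s e2 - e1))"
      using U a UD by (intro X.hol_vector_scale X.hol_vector_diff X.hol_vector_const X.hol_form_ext hol_omega) auto
    moreover have "(- B (u x) f1) *s (B (omega x) e1 *s e2 - e1) = u x" if "x \<in> U" for x
      using J_line_coeff[of x "u x"] u[OF that] UD that by (auto simp: Psi_omega)
    ultimately have "X.hol_vector U u" by (rule X.hol_vector_cong)
    then have "s \<in> sections E U" by (rule section_E_lift[OF U]) (use u s in auto)
    then show "s \<in> sections (EJ b J D) U"
      using u s by (auto simp: EJ_def sections_sub_bundle EJ_fibre_def)
  }
qed

text \<open>
  A section of a pullback is locally a combination of pulled back sections with holomorphic coefficients, so a
  functional that is linear on fibres and holomorphic on sections over the half plane is holomorphic on sections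
  of the pullback. The set \<open>C\<close> confines the values of sections to where linearity is known.
\<close>

lemma hol_pullback_coordinate:
  assumes s: "s \<in> sections (pullback_bundle X H \<pi> F) U" and UD: "U \<subseteq> D"
    and hol: "\<And>V t. openin (top_of H) V \<Longrightarrow> t \<in> sections F V \<Longrightarrow> (\<lambda>z. l z (t z)) \<in> hol_of H V"
    and mem: "\<And>V t z. openin (top_of H) V \<Longrightarrow> t \<in> sections F V \<Longrightarrow> z \<in> V \<Longrightarrow> t z \<in> C"
    and lin: "\<And>x xs. x \<in> D \<Longrightarrow> (\<And>c w. (c, w) \<in> set xs \<Longrightarrow> w \<in> C) \<Longrightarrow>
      l (\<pi> x) (lincomb (fibre F (\<pi> x)) xs) = (\<Sum>(c, w)\<leftarrow>xs. c * l (\<pi> x) w)"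
  shows "(\<lambda>x. l (\<pi> x) (s x)) \<in> hol_of X U"
proof (rule X.hol_local)
  fix x assume "x \<in> U"
  from bspec[OF s[unfolded sections_pullback_bundle] this] obtain U' V fts where
    *: "openin (top_of X) U'" "x \<in> U'" "U' \<subseteq> U" "openin (top_of H) V" "\<pi> ` U' \<subseteq> V"
      "\<forall>(f, t)\<in>set fts. f \<in> hol_of X U' \<and> t \<in> sections F V"
      "\<forall>y\<in>U'. s y = lincomb (fibre F (\<pi> y)) (map (\<lambda>(f, t). (f y, t (\<pi> y))) fts)"
    by (elim exE conjE) (rule that)
  have U': "U' \<subseteq> D" using *(3) UD by blast
  have sum: "l (\<pi> y) (s y) = (\<Sum>(f, t)\<leftarrow>fts. f y * l (\<pi> y) (t (\<pi> y)))" if y: "y \<in> U'" for y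
  proof -
    have w: "w \<in> C" if cw: "(c, w) \<in> set (map (\<lambda>(f, t). (f y, t (\<pi> y))) fts)" for c w
    proof -
      obtain f t where "(f, t) \<in> set fts" "w = t (\<pi> y)" using cw by auto
      then show ?thesis using mem[OF *(4), of t "\<pi> y"] *(5,6) y by blast
    qed
    have "y \<in> D" using y U' by blast
    have "l (\<pi> y) (s y) = (\<Sum>(c, w)\<leftarrow>map (\<lambda>(f, t). (f y, t (\<pi> y))) fts. c * l (\<pi> y) w)"
      unfolding bspec[OF *(7) y] by (rule lin[OF \<open>y \<in> D\<close>]) (rule w)
    then show ?thesis by (simp add: o_def split_def)
  qed
  have "(\<lambda>y. \<Sum>ft\<leftarrow>fts. fst ft y * l (\<pi> y) (snd ft (\<pi> y))) \<in> hol_of X U'"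
  proof (rule X.hol_sum_list[OF *(1)])
    fix ft assume "ft \<in> set fts"
    then have ft: "fst ft \<in> hol_of X U'" "snd ft \<in> sections F V" using *(6) by auto
    from hol_pullback[OF hol[OF *(4) ft(2)] U' *(5)] ft(1)
    show "(\<lambda>y. fst ft y * l (\<pi> y) (snd ft (\<pi> y))) \<in> hol_of X U'" by (intro X.hol_mult)
  qed
  then have "(\<lambda>x. l (\<pi> x) (s x)) \<in> hol_of X U'"
    by (rule X.hol_cong) (simp add: sum split_def)
  with * show "\<exists>U'. openin (top_of X) U' \<and> x \<in> U' \<and> U' \<subseteq> U \<and> (\<lambda>x. l (\<pi> x) (s x)) \<in> hol_of X U'"
    by blast
qed

lemma sections_PL_iff:
  assumes U: "openin (top_of X) U" and s: "\<And>x. x \<in> U \<Longrightarrow> s x = p (a x *s omega x)"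
  shows "s \<in> sections PL U \<longleftrightarrow> a \<in> hol_of X U"
proof
  have UD: "U \<subseteq> D" by (rule open_X_subset[OF U])
  {
    assume sP: "s \<in> sections PL U"
    have "(\<lambda>x. quot_pair e2 (s x)) \<in> hol_of X U"
    proof (rule hol_pullback_coordinate[OF sP UD, where C = "range p"])
      fix V t z assume "openin (top_of H) V" "t \<in> sections LJB V" "z \<in> V"
      then have "t z \<in> z" "z \<in> \<pi> ` D" using open_H_subset by (auto simp: LJ_def sections_sub_bundle)
      then show "t z \<in> range p" using pi_range by blast
    next
      fix x and xs :: "(complex \<times> _) list" assume "\<And>c w. (c, w) \<in> set xs \<Longrightarrow> w \<in> range p"
      then show "quot_pair e2 (lincomb (fibre LJB (\<pi> x)) xs) = (\<Sum>(c, w)\<leftarrow>xs. c * quot_pair e2 w)"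
        unfolding fibre_LJ lincomb_sub_vs
        by (intro lincomb_functional[where C = "range p", THEN conjunct2])
          (auto simp: W_ops quot_pair_p form_ext_linear)
    qed (rule hol_LJ_coordinate)
    then show "a \<in> hol_of X U"
      by (rule X.hol_cong) (use s UD in \<open>auto simp: quot_pair_p form_ext_linear omega_e2 subset_iff\<close>)
  next
    assume a: "a \<in> hol_of X U"
    have "s x = lincomb (fibre LJB (\<pi> x)) (map (\<lambda>(f, t). (f x, t (\<pi> x))) [(a, frame)])" if "x \<in> U" for x
      using that UD by (auto simp: lincomb_def fibre_LJ s frame_pi W_ops)
    moreover have "\<forall>(f, t)\<in>set [(a, frame)]. f \<in> hol_of X U \<and> t \<in> sections LJB (\<pi> ` D)"
      using a frame_section[OF openin_H] by auto
    moreover have "\<pi> ` U \<subseteq> \<pi> ` D" using UD by blast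
    ultimately show "s \<in> sections PL U"
      unfolding sections_pullback_bundle using U openin_H by blast
  }
qed

text \<open>
  Equivariance comes from \<open>\<Psi> (g v) = g (\<Psi> v)\<close>: the factor of automorphy of \<open>\<omega>\<close> appears in \<open>\<Psi> \<omega>\<close> as well.
\<close>

theorem EJ_iso: "equiv_iso X G act_point (EJ b J D) PL"
proof (rule equiv_iso_parametrized[where S = "\<lambda>x. cperp b x \<inter> JC" and r = q and r' = to_LJ and h = complexify];
    (unfold topspace_X)?)
  fix x assume x: "x \<in> D"
  show "parametrizes (fibre (EJ b J D) x) (cperp b x \<inter> JC) (q x)" by (rule parametrizes_EJ[OF x])
  show "parametrizes (fibre PL x) (cperp b x \<inter> JC) (to_LJ x)"
    using parametrizes_to_LJ[OF x] by (simp add: pullback_bundle_def fibre_LJ)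
  show "q x u = q x v \<longleftrightarrow> to_LJ x u = to_LJ x v" if "u \<in> cperp b x \<inter> JC" "v \<in> cperp b x \<inter> JC" for u v
    by (rule to_LJ_eq_iff[OF x that])
  fix g assume g: "g \<in> G"
  show "act_point g x \<in> D" by (rule G_D[OF g x])
  fix u assume u: "u \<in> cperp b x \<inter> JC"
  let ?y = "act_point g x" and ?a = "- B u f1" and ?m = "B (complexify g (omega x)) e2"
  have "complexify g u = ?a *s complexify g (Psi (omega x))"
    using J_line_coeff[OF x u] complexify_scale by metis
  also have "\<dots> = (?a * ?m) *s Psi (omega ?y)"
    by (simp add: G_Psi_omega[OF g x])
  finally have "- B (complexify g u) f1 = ?a * ?m"
    by (simp add: form_ext_linear Psi_omega_f1[OF G_D[OF g x]])
  then have "to_LJ ?y (complexify g u) = p (?a *s (?m *s omega ?y))"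
    by (simp add: to_LJ_def)
  also have "\<dots> = complexify g ` to_LJ x u"
    by (simp only: to_LJ_def G_p[OF g] complexify_scale G_omega(1)[OF g x, symmetric])
  finally show "complexify g u \<in> cperp b ?y \<inter> JC \<and>
       act (EJ b J D) g x (q x u) = q ?y (complexify g u) \<and>
       act PL g x (to_LJ x u) = to_LJ ?y (complexify g u)"
    using G_cperp[OF g x] G_JC[OF g] u
    by (simp add: EJ_def sub_bundle_def act_E[simplified] G_q pullback_bundle_def LJ_def trivial_bundle_def)
next
  fix U s t u
  assume U: "openin (top_of X) U" and u: "\<And>x. x \<in> U \<Longrightarrow> u x \<in> cperp b x \<inter> JC"
    and s: "\<And>x. x \<in> U \<Longrightarrow> s x = q x (u x)" and t: "\<And>x. x \<in> U \<Longrightarrow> t x = to_LJ x (u x)"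
  show "s \<in> sections (EJ b J D) U \<longleftrightarrow> t \<in> sections PL U"
    using sections_EJ_iff[OF U u s] sections_PL_iff[OF U t[unfolded to_LJ_def]] by blast
qed


section \<open>The middle graded piece\<close>

text \<open>
  On \<open>\<complex>\<omega> \<oplus> J\<^sup>\<bottom>\<close> this is the projection to the second summand.
\<close>

definition Jperp_part :: "(complex^'m) set \<Rightarrow> complex^'m \<Rightarrow> complex^'m" where
  "Jperp_part x u = u - B u e2 *s omega x"

text \<open>
  This projection has kernel \<open>J\<close>, so its components are linear coordinates on \<open>V(J)\<close>, though redundant ones.
\<close>

definition mod_J :: "complex^'m \<Rightarrow> complex^'m" where
  "mod_J w = w - B w f1 *s e1 - B w f2 *s e2"

text \<open>
  A projection onto \<open>J\<^sup>\<bottom>\<close>; it turns the standard basis of \<open>\<complex>\<^sup>m\<close> into a generating set of \<open>J\<^sup>\<bottom>\<close>.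
\<close>

definition Jperp_proj :: "complex^'m \<Rightarrow> complex^'m" where
  "Jperp_proj w = w - B w e1 *s f1 - B w e2 *s f2"

definition to_VJ :: "(complex^'m) set \<Rightarrow> complex^'m \<Rightarrow> (complex^'m) set" where
  "to_VJ x u = coset full_vs JC (Jperp_part x u)"

lemma Jperp_part_add: "Jperp_part x (u + v) = Jperp_part x u + Jperp_part x v" and Jperp_part_scale: "Jperp_part x (c *s u) = c *s Jperp_part x u"
  by (simp_all add: Jperp_part_def form_ext_linear vec_eq_iff algebra_simps)

lemma mod_J_add: "mod_J (u + v) = mod_J u + mod_J v" and mod_J_scale: "mod_J (c *s u) = c *s mod_J u"
  by (simp_all add: mod_J_def form_ext_linear vec_eq_iff algebra_simps)

lemma Jperp_proj_add: "Jperp_proj (u + v) = Jperp_proj u + Jperp_proj v" and Jperp_proj_scale: "Jperp_proj (c *s u) = c *s Jperp_proj u"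
  by (simp_all add: Jperp_proj_def form_ext_linear vec_eq_iff algebra_simps)

lemma Jperp_part_diff: "Jperp_part x (u - v) = Jperp_part x u - Jperp_part x v"
  using Jperp_part_add[of x "u - v" v] by simp

lemma Jperp_proj_KC: "Jperp_proj w \<in> KC"
  by (simp add: Jperp_proj_def Jperp_eq form_ext_linear fe)

lemma Jperp_proj_ident: "w \<in> KC \<Longrightarrow> Jperp_proj w = w"
  by (simp add: Jperp_proj_def Jperp_eq)

lemma mod_J_JC: "j \<in> JC \<Longrightarrow> mod_J j = 0"
  by (auto simp: J_eq mod_J_def form_ext_linear ef)

lemma mod_J_diff_JC: "w - mod_J w \<in> JC"
  by (auto simp: J_eq mod_J_def)

lemma mod_J_KC: "w \<in> KC \<Longrightarrow> mod_J w \<in> KC"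
  by (simp add: mod_J_def Jperp_eq form_ext_linear ee ef)

lemma Psi_JC: "Psi v \<in> JC"
proof -
  have "Psi v = (- B v e2) *s e1 + B v e1 *s e2" by (simp add: Psi_def)
  then show ?thesis unfolding J_eq by blast
qed

lemma KC_JC: "w \<in> KC \<Longrightarrow> j \<in> JC \<Longrightarrow> B w j = 0"
  by (auto simp: Jperp_eq J_eq form_ext_linear)

lemma Jperp_part_KC: "x \<in> D \<Longrightarrow> u \<in> perp_lifts x \<Longrightarrow> Jperp_part x u \<in> KC"
  using e2_omega[of x] by (auto simp: Jperp_part_def Jperp_eq perp_lifts_def form_ext_linear omega_e2 Psi_omega algebra_simps)

lemma Jperp_part_cperp: "x \<in> D \<Longrightarrow> u \<in> cperp b x \<Longrightarrow> Jperp_part x u \<in> cperp b x"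
  by (simp add: Jperp_part_def cperp_eq form_ext_linear omega_omega)

lemma Jperp_part_diff_mem: "x \<in> D \<Longrightarrow> u - Jperp_part x u \<in> x"
proof -
  assume x: "x \<in> D"
  have "B u e2 *s omega x \<in> x" using point_eq[OF x] by blast
  then show ?thesis by (simp add: Jperp_part_def)
qed

lemma Jperp_part_point: "x \<in> D \<Longrightarrow> k \<in> x \<Longrightarrow> Jperp_part x k = 0"
proof -
  assume x: "x \<in> D" and "k \<in> x"
  then obtain c where "k = c *s omega x" using point_eq[OF x] by blast
  then show ?thesis by (simp add: Jperp_part_def form_ext_linear omega_e2[OF x])
qed

lemma Jperp_part_KC_ident: "w \<in> KC \<Longrightarrow> Jperp_part x w = w"
  by (simp add: Jperp_part_def Jperp_eq)

lemma coset_J_eq_iff: "coset full_vs JC u = coset full_vs JC v \<longleftrightarrow> u - v \<in> JC"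
  by (rule coset_full_eq_iff[OF subspace_JC])

lemma parametrizes_VJ: "parametrizes (VJ b J) KC (coset full_vs JC)"
  using parametrizes_quot[OF parametrizes_sub[OF parametrizes_full subspace_KC subset_UNIV] subspace_JC JC_KC]
  by (simp add: VJ_def)

lemma VJ_ops:
  "add (VJ b J) (coset full_vs JC u) (coset full_vs JC v) = coset full_vs JC (u + v)"
  "scl (VJ b J) c (coset full_vs JC u) = coset full_vs JC (c *s u)"
  "zer (VJ b J) = coset full_vs JC 0"
  "carr (VJ b J) = coset full_vs JC ` KC"
proof -
  have "add (VJ b J) = add (quot_vs full_vs JC)" "scl (VJ b J) = scl (quot_vs full_vs JC)"
    "zer (VJ b J) = zer (quot_vs full_vs JC)"
    by (simp_all add: VJ_def quot_vs_def)
  then show "add (VJ b J) (coset full_vs JC u) (coset full_vs JC v) = coset full_vs JC (u + v)"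
    "scl (VJ b J) c (coset full_vs JC u) = coset full_vs JC (c *s u)"
    "zer (VJ b J) = coset full_vs JC 0"
    using parametrizes_quot_full[OF subspace_JC] by (simp_all add: parametrizes_def)
  show "carr (VJ b J) = coset full_vs JC ` KC" using parametrizes_VJ by (simp add: parametrizes_def)
qed

text \<open>
  Subtracting a multiple of \<open>e2\<close> moves a vector of \<open>J\<^sup>\<bottom>\<close> into \<open>\<omega>\<^sup>\<bottom>\<close> without changing its class modulo \<open>J\<close>.
\<close>

lemma lift_perp_lifts:
  assumes x: "x \<in> D" and w: "w \<in> KC"
  shows "w - B w (omega x) *s e2 \<in> perp_lifts x \<inter> KC"
proof -
  have *: "w - B w (omega x) *s e2 \<in> KC"
    using w by (simp add: Jperp_eq form_ext_linear ee ef)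
  from KC_JC[OF this Psi_JC] have "B (w - B w (omega x) *s e2) (Psi (omega x)) = 0" .
  with * show ?thesis using e2_omega[OF x] by (simp add: perp_lifts_def form_ext_linear)
qed

lemma e2_JC: "c *s e2 \<in> JC"
proof -
  have "c *s e2 = 0 *s e1 + c *s e2" by simp
  then show ?thesis unfolding J_eq by blast
qed

lemma parametrizes_to_VJ:
  assumes x: "x \<in> D" shows "parametrizes (VJ b J) (perp_lifts x) (to_VJ x)"
  unfolding parametrizes_def
proof (intro conjI ballI allI subspace_perp_lifts)
  have "to_VJ x ` perp_lifts x \<subseteq> carr (VJ b J)" using Jperp_part_KC[OF x] by (auto simp: to_VJ_def VJ_ops)
  moreover have "coset full_vs JC w \<in> to_VJ x ` perp_lifts x" if w: "w \<in> KC" for w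
  proof -
    let ?u = "w - B w (omega x) *s e2"
    have "Jperp_part x ?u = ?u" using lift_perp_lifts[OF x w] by (intro Jperp_part_KC_ident) blast
    moreover have "coset full_vs JC w = coset full_vs JC ?u"
      using e2_JC by (simp add: coset_J_eq_iff)
    ultimately have "coset full_vs JC w = to_VJ x ?u" by (simp add: to_VJ_def)
    then show ?thesis using lift_perp_lifts[OF x w] by blast
  qed
  ultimately show "carr (VJ b J) = to_VJ x ` perp_lifts x" by (auto simp: VJ_ops)
qed (simp_all add: to_VJ_def VJ_ops Jperp_part_add Jperp_part_scale, simp add: Jperp_part_def form_ext_linear)

lemma gr1_class_eq_iff_to_VJ:
  assumes x: "x \<in> D" and u: "u \<in> cperp b x" and v: "v \<in> cperp b x"
  shows "gr1_class x u = gr1_class x v \<longleftrightarrow> to_VJ x u = to_VJ x v"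
proof -
  have "(\<exists>t\<in>cperp b x \<inter> JC. u - (v + t) \<in> x) \<longleftrightarrow> Jperp_part x u - Jperp_part x v \<in> JC"
  proof
    assume "\<exists>t\<in>cperp b x \<inter> JC. u - (v + t) \<in> x"
    then obtain t where t: "t \<in> JC" "u - (v + t) \<in> x" by blast
    have "Jperp_part x u - Jperp_part x v = Jperp_part x (u - (v + t)) + Jperp_part x t" by (simp add: Jperp_part_diff Jperp_part_add)
    also have "\<dots> = t" using t JC_KC Jperp_part_point[OF x] Jperp_part_KC_ident by auto
    finally show "Jperp_part x u - Jperp_part x v \<in> JC" using t by simp
  next
    assume "Jperp_part x u - Jperp_part x v \<in> JC"
    moreover have "Jperp_part x u - Jperp_part x v \<in> cperp b x"
      using Jperp_part_cperp[OF x] u v subspace_cperp by (simp add: vec.subspace_diff)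
    moreover have "u - (v + (Jperp_part x u - Jperp_part x v)) = (u - Jperp_part x u) - (v - Jperp_part x v)" by simp
    then have "u - (v + (Jperp_part x u - Jperp_part x v)) \<in> x"
      using Jperp_part_diff_mem[OF x] subspace_point[OF x] vec.subspace_diff by metis
    ultimately show "\<exists>t\<in>cperp b x \<inter> JC. u - (v + t) \<in> x" by blast
  qed
  then show ?thesis by (simp add: gr1_class_eq_iff[OF assms] to_VJ_def coset_J_eq_iff)
qed

lemma mod_J_of_to_VJ: "to_VJ x u = to_VJ x v \<Longrightarrow> mod_J (Jperp_part x u) = mod_J (Jperp_part x v)"
proof -
  assume "to_VJ x u = to_VJ x v"
  then have "mod_J (Jperp_part x u - Jperp_part x v) = 0" by (simp add: to_VJ_def coset_J_eq_iff mod_J_JC)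
  moreover have "mod_J (Jperp_part x u) = mod_J (Jperp_part x u - Jperp_part x v) + mod_J (Jperp_part x v)" by (simp flip: mod_J_add)
  ultimately show ?thesis by simp
qed

text \<open>
  The function \<open>mod_J (Jperp_part x u)\<close> depends only on the class of \<open>u\<close>, so it can be computed from a holomorphic lift.
  Conversely, it is itself a holomorphic lift once corrected by a multiple of \<open>e2\<close> to be orthogonal to \<open>\<omega>\<close>.
\<close>

lemma sections_Gr1_iff:
  assumes U: "openin (top_of X) U" and u: "\<And>x. x \<in> U \<Longrightarrow> u x \<in> perp_lifts x"
    and s: "\<And>x. x \<in> U \<Longrightarrow> s x = gr1_class x (u x)"
  shows "s \<in> sections Gr1 U \<longleftrightarrow> X.hol_vector U (\<lambda>x. mod_J (Jperp_part x (u x)))"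
proof
  have UD: "U \<subseteq> D" by (rule open_X_subset[OF U])
  {
    assume sG: "s \<in> sections Gr1 U"
    show "X.hol_vector U (\<lambda>x. mod_J (Jperp_part x (u x)))"
    proof (rule X.hol_vector_local)
      fix x assume "x \<in> U"
      from bspec[OF sG[unfolded sections_quotient_bundle] this] obtain U1 t where
        1: "openin (top_of X) U1" "x \<in> U1" "U1 \<subseteq> U" "t \<in> sections (EJ_perp b J D) U1"
          "\<forall>y\<in>U1. s y = coset (fibre (EJ_perp b J D) y) (EJ_fibre b J y) (t y)" by blast
      have "t \<in> sections E U1" using 1(4) by (simp add: EJ_perp_def sections_sub_bundle)
      from bspec[OF this[unfolded sections_E] 1(2)] obtain U' \<tau> where
        *: "openin (top_of X) U'" "x \<in> U'" "U' \<subseteq> U1" "X.hol_vector U' \<tau>"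
          "\<forall>y\<in>U'. \<tau> y \<in> cperp b y \<and> t y = q y (\<tau> y)" by blast
      have U': "U' \<subseteq> U" "U' \<subseteq> D" using 1(3) *(3) UD by auto
      have hol: "X.hol_vector U' (\<lambda>y. mod_J (Jperp_part y (\<tau> y)))"
        unfolding mod_J_def Jperp_part_def using *(1,4) U'
        by (intro X.hol_form_ext X.hol_vector_const X.hol_vector_diff X.hol_vector_scale hol_omega) auto
      have eq: "mod_J (Jperp_part y (\<tau> y)) = mod_J (Jperp_part y (u y))" if "y \<in> U'" for y
      proof -
        have y: "y \<in> D" "y \<in> U" "y \<in> U1" using that U' * by auto
        have "gr1_class y (\<tau> y) = gr1_class y (u y)"
          using 1(5) *(5) y that s[OF y(2)] by (simp add: gr1_class_def fibre_EJ_perp)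
        then show ?thesis
          using gr1_class_eq_iff_to_VJ[OF y(1), of "\<tau> y" "u y"] mod_J_of_to_VJ *(5) that u[OF y(2)] perp_lifts_cperp[OF y(1)] by blast
      qed
      have "X.hol_vector U' (\<lambda>x. mod_J (Jperp_part x (u x)))"
        by (rule X.hol_vector_cong[OF hol]) (simp add: eq)
      with * U' show "\<exists>U'. openin (top_of X) U' \<and> x \<in> U' \<and> U' \<subseteq> U \<and> X.hol_vector U' (\<lambda>x. mod_J (Jperp_part x (u x)))"
        by blast
    qed
  next
    assume a: "X.hol_vector U (\<lambda>x. mod_J (Jperp_part x (u x)))"
    define t where "t x = mod_J (Jperp_part x (u x)) - B (mod_J (Jperp_part x (u x))) (omega x) *s e2" for x
    have "X.hol_vector U t"
      unfolding t_def using U a UD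
      by (intro X.hol_vector_scale X.hol_vector_diff X.hol_vector_const X.hol_form_ext hol_omega) auto
    moreover have t: "t x \<in> perp_lifts x \<inter> KC" if "x \<in> U" for x
      unfolding t_def using lift_perp_lifts[OF _ mod_J_KC[OF Jperp_part_KC]] UD that u by blast
    moreover have "gr1_class x (t x) = gr1_class x (u x)" if "x \<in> U" for x
    proof -
      have x: "x \<in> D" using UD that by blast
      have "Jperp_part x (t x) = t x" using Jperp_part_KC_ident t[OF that] by blast
      then have "Jperp_part x (u x) - Jperp_part x (t x) = (Jperp_part x (u x) - mod_J (Jperp_part x (u x))) + B (mod_J (Jperp_part x (u x))) (omega x) *s e2"
        by (simp add: t_def)
      then have "to_VJ x (u x) = to_VJ x (t x)"
        unfolding to_VJ_def coset_J_eq_iff using vec.subspace_add[OF subspace_JC mod_J_diff_JC e2_JC] by metis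
      then show ?thesis
        using gr1_class_eq_iff_to_VJ[OF x, of "t x" "u x"] t[OF that] u[OF that] perp_lifts_cperp[OF x] by blast
    qed
    moreover have "(\<lambda>x. q x (t x)) \<in> sections E U"
      by (rule section_E_lift[OF U calculation(1)]) (use t perp_lifts_cperp UD in blast)
    then have "(\<lambda>x. q x (t x)) \<in> sections (EJ_perp b J D) U"
      using t UD by (auto simp: EJ_perp_def sections_sub_bundle EJ_perp_fibre_eq subset_iff)
    moreover have "coset (fibre (EJ_perp b J D) y) (EJ_fibre b J y) (q y v) = gr1_class y v" for y v
      by (simp add: gr1_class_def fibre_EJ_perp)
    ultimately have "\<exists>t\<in>sections (EJ_perp b J D) U.
        \<forall>y\<in>U. s y = coset (fibre (EJ_perp b J D) y) (EJ_fibre b J y) (t y)"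
      using s by (intro bexI[of _ "\<lambda>x. q x (t x)"]) auto
    then show "s \<in> sections Gr1 U"
      unfolding sections_quotient_bundle using U by blast
  }
qed

abbreviation VJB :: "(real^'m^'m, (complex^'m) set, (complex^'m) set) ebundle" where
  "VJB \<equiv> trivial_bundle X (VJ b J) (\<lambda>g v. v)"

lemma mod_J_SOME: "mod_J (SOME v. v \<in> coset full_vs JC w) = mod_J w"
proof -
  have "w \<in> coset full_vs JC w"
    using vec.subspace_0[OF subspace_JC] by (force simp: coset_full)
  then have "(SOME v. v \<in> coset full_vs JC w) \<in> coset full_vs JC w" by (rule someI)
  then obtain k where k: "k \<in> JC" "(SOME v. v \<in> coset full_vs JC w) = w + k" by (auto simp: coset_full)
  then show ?thesis by (simp add: mod_J_add mod_J_JC)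
qed

text \<open>
  For the converse the constant vectors are the projections to \<open>J\<^sup>\<bottom>\<close> of the standard basis: they combine with the
  components of \<open>mod_J (w x)\<close> to \<open>mod_J (w x)\<close>, which has the same class as \<open>w x\<close>.
\<close>

lemma sections_VJB_iff:
  assumes U: "openin (top_of X) U" and w: "\<And>x. x \<in> U \<Longrightarrow> w x \<in> KC"
    and s: "\<And>x. x \<in> U \<Longrightarrow> s x = coset full_vs JC (w x)"
  shows "s \<in> sections VJB U \<longleftrightarrow> X.hol_vector U (\<lambda>x. mod_J (w x))"
proof
  assume sV: "s \<in> sections VJB U"
  show "X.hol_vector U (\<lambda>x. mod_J (w x))"
  proof (rule X.hol_vector_local)
    fix x assume "x \<in> U"
    from bspec[OF sV[unfolded sections_trivial_bundle] this] obtain U' fws where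
      *: "openin (top_of X) U'" "x \<in> U'" "U' \<subseteq> U"
      "\<forall>(f, w)\<in>set fws. f \<in> hol_of X U' \<and> w \<in> carr (VJ b J)"
      "\<forall>y\<in>U'. s y = lincomb (VJ b J) (map (\<lambda>(f, w). (f y, w)) fws)"
      by (elim exE conjE) (rule that)
    define l where "l i A = mod_J (SOME v. v \<in> A) $ i" for i A
    have l: "l i (coset full_vs JC v) = mod_J v $ i" for i v by (simp add: l_def mod_J_SOME)
    have sum: "mod_J (w y) $ i = (\<Sum>(f, v)\<leftarrow>fws. f y * l i v)" if y: "y \<in> U'" for y i
    proof -
      have "l i (lincomb (VJ b J) (map (\<lambda>(f, w). (f y, w)) fws)) =
         (\<Sum>(c, v)\<leftarrow>map (\<lambda>(f, w). (f y, w)) fws. c * l i v)"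
      proof (rule lincomb_functional[where C = "range (coset full_vs JC)", THEN conjunct2])
        show "l i (zer (VJ b J)) = 0" using mod_J_JC[OF vec.subspace_0[OF subspace_JC]] by (simp add: VJ_ops l)
        show "zer (VJ b J) \<in> range (coset full_vs JC)" by (simp add: VJ_ops)
        fix c v assume "(c, v) \<in> set (map (\<lambda>(f, w). (f y, w)) fws)"
        then show "v \<in> range (coset full_vs JC)" using *(4) by (auto simp: VJ_ops)
      qed (auto simp: VJ_ops l mod_J_add mod_J_scale)
      moreover have "l i (s y) = mod_J (w y) $ i" using s[of y] y *(3) by (auto simp: l)
      ultimately show ?thesis using *(5) y by (simp add: o_def split_def)
    qed
    have hol: "(\<lambda>y. \<Sum>(f, v)\<leftarrow>fws. f y * l i v) \<in> hol_of X U'" for i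
      using X.hol_sum_list_pairs[OF *(1), of fws "l i"] *(4) by blast
    have "X.hol_vector U' (\<lambda>x. mod_J (w x))"
      unfolding X.hol_vector_def by (intro allI X.hol_cong[OF hol]) (simp add: sum)
    with * show "\<exists>U'. openin (top_of X) U' \<and> x \<in> U' \<and> U' \<subseteq> U \<and> X.hol_vector U' (\<lambda>x. mod_J (w x))"
      by blast
  qed
next
  assume a: "X.hol_vector U (\<lambda>x. mod_J (w x))"
  obtain ks :: "'m list" where ks: "set ks = UNIV" "distinct ks"
    using finite_distinct_list[of "UNIV :: 'm set"] by auto
  let ?l = "map (\<lambda>i. (\<lambda>x. mod_J (w x) $ i, coset full_vs JC (Jperp_proj (axis i 1)))) ks"
  have "s y = lincomb (VJ b J) (map (\<lambda>(f, w). (f y, w)) ?l)" if y: "y \<in> U" for y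
  proof -
    have "lincomb (VJ b J) (map (\<lambda>(c, w). (c, coset full_vs JC w)) (map (\<lambda>i. (mod_J (w y) $ i, Jperp_proj (axis i 1))) ks)) =
        coset full_vs JC (\<Sum>(c, w)\<leftarrow>map (\<lambda>i. (mod_J (w y) $ i, Jperp_proj (axis i 1))) ks. c *s w)"
      by (rule lincomb_parametrized[OF parametrizes_VJ, THEN conjunct2]) (auto simp: Jperp_proj_KC)
    also have "(\<Sum>(c, w)\<leftarrow>map (\<lambda>i. (mod_J (w y) $ i, Jperp_proj (axis i 1))) ks. c *s w) =
        (\<Sum>i\<in>UNIV. Jperp_proj (mod_J (w y) $ i *s axis i 1))"
      using ks by (simp add: o_def sum_list_distinct_conv_sum_set Jperp_proj_scale)
    also have "\<dots> = Jperp_proj (\<Sum>i\<in>UNIV. mod_J (w y) $ i *s axis i 1)"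
    proof -
      have "Jperp_proj (sum g A) = (\<Sum>i\<in>A. Jperp_proj (g i))" for g :: "'m \<Rightarrow> complex^'m" and A
        by (induction A rule: infinite_finite_induct) (simp_all add: Jperp_proj_add, simp_all add: Jperp_proj_def form_ext_linear)
      then show ?thesis by simp
    qed
    also have "\<dots> = mod_J (w y)"
      using Jperp_proj_ident[OF mod_J_KC[OF w[OF y]]] by (simp only: basis_expansion)
    also have "coset full_vs JC (mod_J (w y)) = s y"
      using s[OF y] mod_J_diff_JC[of "w y"] by (metis coset_J_eq_iff)
    finally show ?thesis by (simp add: o_def)
  qed
  moreover have "\<forall>(f, w)\<in>set ?l. f \<in> hol_of X U \<and> w \<in> carr (VJ b J)"
    using a Jperp_proj_KC by (auto simp: X.hol_vector_def VJ_ops)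
  ultimately show "s \<in> sections VJB U"
    unfolding sections_trivial_bundle using U by blast
qed

lemma G_Jperp_part: "g \<in> G \<Longrightarrow> x \<in> D \<Longrightarrow> u \<in> perp_lifts x \<Longrightarrow>
   Jperp_part (act_point g x) (complexify g u) = complexify g (Jperp_part x u)"
proof -
  assume g: "g \<in> G" and x: "x \<in> D" and u: "u \<in> perp_lifts x"
  have "complexify g u - complexify g (Jperp_part x u) \<in> act_point g x"
    using Jperp_part_diff_mem[OF x, of u] by (simp add: G_point complexify_diff[symmetric])
  then have "Jperp_part (act_point g x) (complexify g u) = Jperp_part (act_point g x) (complexify g (Jperp_part x u))"
    using Jperp_part_point[OF G_D[OF g x]] Jperp_part_diff by (metis eq_iff_diff_eq_0)
  also have "\<dots> = complexify g (Jperp_part x u)"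
    using G_KC[OF g] Jperp_part_KC[OF x u] by (intro Jperp_part_KC_ident) blast
  finally show ?thesis .
qed

text \<open>
  The decomposition \<open>\<complex>\<omega> \<oplus> J\<^sup>\<bottom>\<close> is equivariant, and the group acts trivially on \<open>J\<^sup>\<bottom>/J\<close>.
\<close>

theorem Gr1_iso: "equiv_iso X G act_point Gr1 VJB"
proof (rule equiv_iso_parametrized[where S = perp_lifts and r = gr1_class and r' = to_VJ and h = complexify];
    (unfold topspace_X)?)
  fix x assume x: "x \<in> D"
  show "parametrizes (fibre Gr1 x) (perp_lifts x) (gr1_class x)" by (rule parametrizes_Gr1[OF x])
  show "parametrizes (fibre VJB x) (perp_lifts x) (to_VJ x)"
    using parametrizes_to_VJ[OF x] by (simp add: trivial_bundle_def)
  show "gr1_class x u = gr1_class x v \<longleftrightarrow> to_VJ x u = to_VJ x v" if "u \<in> perp_lifts x" "v \<in> perp_lifts x" for u v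
    using gr1_class_eq_iff_to_VJ[OF x] perp_lifts_cperp[OF x] that by blast
  fix g assume g: "g \<in> G"
  show y: "act_point g x \<in> D" by (rule G_D[OF g x])
  fix u assume u: "u \<in> perp_lifts x"
  let ?y = "act_point g x"
  have 1: "complexify g u \<in> perp_lifts ?y" using G_perp_lifts[OF g x] u by simp
  have "to_VJ ?y (complexify g u) = to_VJ x u"
    unfolding to_VJ_def G_Jperp_part[OF g x u] coset_J_eq_iff by (rule G_quot[OF g Jperp_part_KC[OF x u]])
  moreover have "act Gr1 g x (gr1_class x u) = gr1_class ?y (complexify g u)"
  proof -
    have im: "complexify g ` q x v = q ?y (complexify g v)" for v by (rule G_q)
    have "act Gr1 g x A = (\<lambda>B. complexify g ` B) ` A" for A
      by (simp add: quotient_bundle_def EJ_perp_def sub_bundle_def act_E[simplified])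
    moreover have "gr1_class x u = {q x (u + t) |t. t \<in> cperp b x \<inter> JC}"
      unfolding gr1_class_def EJ_fibre_def
      by (rule coset_parametrized[OF parametrizes_E[OF x]]) (use u perp_lifts_cperp[OF x] in auto)
    moreover have "gr1_class ?y (complexify g u) = {q ?y (complexify g u + t) |t. t \<in> complexify g ` (cperp b x \<inter> JC)}"
      unfolding gr1_class_def EJ_fibre_def G_J_line[OF g x]
      by (rule coset_parametrized[OF parametrizes_E[OF y]]) (use 1 perp_lifts_cperp[OF y] in auto)
    ultimately show ?thesis
      by (simp only: setcompr_eq_image image_image im complexify_add Collect_mem_eq)
  qed
  ultimately show "complexify g u \<in> perp_lifts ?y \<and>
       act Gr1 g x (gr1_class x u) = gr1_class ?y (complexify g u) \<and> act VJB g x (to_VJ x u) = to_VJ ?y (complexify g u)"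
    using 1 by (simp add: trivial_bundle_def)
next
  fix U s t u
  assume U: "openin (top_of X) U" and u: "\<And>x. x \<in> U \<Longrightarrow> u x \<in> perp_lifts x"
    and s: "\<And>x. x \<in> U \<Longrightarrow> s x = gr1_class x (u x)" and t: "\<And>x. x \<in> U \<Longrightarrow> t x = to_VJ x (u x)"
  have "t \<in> sections VJB U \<longleftrightarrow> X.hol_vector U (\<lambda>x. mod_J (Jperp_part x (u x)))"
    by (rule sections_VJB_iff[OF U]) (use Jperp_part_KC u t open_X_subset[OF U] in \<open>auto simp: to_VJ_def\<close>)
  moreover have "s \<in> sections Gr1 U \<longleftrightarrow> X.hol_vector U (\<lambda>x. mod_J (Jperp_part x (u x)))"
    by (rule sections_Gr1_iff[OF U u s])
  ultimately show "s \<in> sections Gr1 U \<longleftrightarrow> t \<in> sections VJB U" by blast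
qed


section \<open>The top graded piece\<close>

text \<open>
  The map induced by \<open>Psi\<close> on \<open>L/J\<^sup>\<bottom>\<close>.
\<close>

definition Psi_quot :: "(complex^'m) set \<Rightarrow> complex^'m" where
  "Psi_quot A = quot_pair e1 A *s e2 - quot_pair e2 A *s e1"

definition to_dual :: "(complex^'m) set \<Rightarrow> complex^'m \<Rightarrow> (complex^'m) set \<Rightarrow> complex" where
  "to_dual x u = (\<lambda>A\<in>\<pi> x. B u (Psi_quot A))"

text \<open>
  A holomorphically varying vector of \<open>\<omega>\<^sup>\<bottom>\<close> that pairs to \<open>1\<close> with \<open>\<Psi> \<omega>\<close>: its class is a frame of \<open>\<E>/\<E>\<^sub>J\<^sup>\<bottom>\<close>. As
  \<open>(f1, \<Psi> \<omega>) = -1\<close>, take \<open>- f1\<close> and correct it by a multiple of \<open>e2\<close>.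
\<close>

definition dual_lift :: "(complex^'m) set \<Rightarrow> complex^'m" where
  "dual_lift x = B (omega x) f1 *s e2 - f1"

lemma Psi_quot_p: "Psi_quot (p v) = Psi v"
  by (simp add: Psi_quot_def Psi_def quot_pair_p)

lemma dual_lift_cperp: "x \<in> D \<Longrightarrow> dual_lift x \<in> cperp b x"
  by (simp add: dual_lift_def cperp_eq form_ext_linear e2_omega B_sym[of f1])

lemma dual_lift_Psi: "x \<in> D \<Longrightarrow> B (dual_lift x) (Psi (omega x)) = 1"
  by (simp add: dual_lift_def Psi_omega form_ext_linear ee ef fe)

abbreviation DLJ where "DLJ \<equiv> dual_bundle H LJB"
abbreviation PD where "PD \<equiv> pullback_bundle X H \<pi> DLJ"

lemma fibre_DLJ: "fibre DLJ y = dual_vs (sub_vs W y)"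
  by (simp add: dual_bundle_def fibre_LJ)

lemma dual_vs_simps:
  "carr (dual_vs V) = {f. clinear_map V \<lparr>carr = UNIV, zer = 0, add = (+), scl = (*)\<rparr> f
               \<and> f \<in> extensional (carr V)}"
  "zer (dual_vs V) = (\<lambda>v\<in>carr V. 0)"
  "add (dual_vs V) f g = (\<lambda>v\<in>carr V. f v + g v)"
  "scl (dual_vs V) c f = (\<lambda>v\<in>carr V. c * f v)"
  by (simp_all add: dual_vs_def)

lemma pi_memE:
  assumes "x \<in> D" "A \<in> \<pi> x" obtains c where "A = p (c *s omega x)"
  using assms pi_range by blast

lemma pi_mem: "x \<in> D \<Longrightarrow> p (c *s omega x) \<in> \<pi> x"
  using pi_range by blast

text \<open>
  The fibre is the line spanned by \<open>p (omega x)\<close>, on which homogeneity implies additivity.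
\<close>

lemma dual_LJ_I:
  assumes x: "x \<in> D" and l: "\<And>c. f (p (c *s omega x)) = c * a" and ext: "f \<in> extensional (\<pi> x)"
  shows "f \<in> carr (dual_vs (sub_vs W (\<pi> x)))"
proof -
  have "f (add W A A') = f A + f A'" if A: "A \<in> \<pi> x" and A': "A' \<in> \<pi> x" for A A'
  proof -
    obtain c where c: "A = p (c *s omega x)" by (rule pi_memE[OF x A])
    obtain c' where c': "A' = p (c' *s omega x)" by (rule pi_memE[OF x A'])
    show ?thesis by (simp only: c c' W_ops vec.scale_left_distrib[symmetric] l distrib_right)
  qed
  moreover have "f (scl W k A) = k * f A" if A: "A \<in> \<pi> x" for A k
  proof -
    obtain c where "A = p (c *s omega x)" by (rule pi_memE[OF x A])
    then show ?thesis by (simp only: W_ops vec.scale_scale l mult.assoc)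
  qed
  ultimately show ?thesis using ext by (simp add: dual_vs_simps clinear_map_def)
qed

lemma to_dual_p: "x \<in> D \<Longrightarrow> to_dual x u (p (c *s omega x)) = c * B u (Psi (omega x))"
  by (simp add: to_dual_def pi_mem Psi_quot_p Psi_scale form_ext_linear)

lemma parametrizes_to_dual:
  assumes x: "x \<in> D" shows "parametrizes (dual_vs (sub_vs W (\<pi> x))) (cperp b x) (to_dual x)"
  unfolding parametrizes_def
proof (intro conjI ballI allI subspace_cperp)
  have "to_dual x u \<in> carr (dual_vs (sub_vs W (\<pi> x)))" for u
    by (rule dual_LJ_I[OF x to_dual_p[OF x]]) (simp add: to_dual_def extensional_def)
  moreover have "f \<in> to_dual x ` cperp b x" if f: "f \<in> carr (dual_vs (sub_vs W (\<pi> x)))" for f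
  proof
    let ?u = "f (p (1 *s omega x)) *s dual_lift x"
    show "?u \<in> cperp b x" using dual_lift_cperp[OF x] subspace_cperp by (rule vec.subspace_scale[rotated])
    show "f = to_dual x ?u"
    proof (rule extensionalityI)
      show "f \<in> extensional (\<pi> x)" using f by (simp add: dual_vs_simps)
      show "to_dual x ?u \<in> extensional (\<pi> x)" by (simp add: to_dual_def)
      fix A assume "A \<in> \<pi> x"
      then obtain c where A: "A = p (c *s omega x)" by (rule pi_memE[OF x])
      have "f (scl W c (p (1 *s omega x))) = c * f (p (1 *s omega x))"
        using f pi_mem[OF x, of 1] by (simp add: dual_vs_simps clinear_map_def)
      then show "f A = to_dual x ?u A"
        using to_dual_p[OF x, of ?u c] by (simp add: A W_ops form_ext_linear dual_lift_Psi[OF x])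
    qed
  qed
  ultimately show "carr (dual_vs (sub_vs W (\<pi> x))) = to_dual x ` cperp b x" by blast
qed (auto simp: dual_vs_simps to_dual_def form_ext_linear fun_eq_iff restrict_def)

lemma to_dual_eq_iff:
  assumes x: "x \<in> D" shows "to_dual x u = to_dual x v \<longleftrightarrow> B u (Psi (omega x)) = B v (Psi (omega x))"
proof
  assume "to_dual x u = to_dual x v"
  then show "B u (Psi (omega x)) = B v (Psi (omega x))" using to_dual_p[OF x, of u 1] to_dual_p[OF x, of v 1] by simp
next
  assume *: "B u (Psi (omega x)) = B v (Psi (omega x))"
  show "to_dual x u = to_dual x v"
  proof (rule extensionalityI[of _ "\<pi> x"])
    fix A assume "A \<in> \<pi> x"
    then obtain c where A: "A = p (c *s omega x)" by (rule pi_memE[OF x])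
    show "to_dual x u A = to_dual x v A" unfolding A to_dual_p[OF x] * ..
  qed (simp_all add: to_dual_def)
qed

lemma sections_Gr2_iff:
  assumes U: "openin (top_of X) U" and u: "\<And>x. x \<in> U \<Longrightarrow> u x \<in> cperp b x"
    and s: "\<And>x. x \<in> U \<Longrightarrow> s x = gr2_class x (u x)"
  shows "s \<in> sections Gr2 U \<longleftrightarrow> (\<lambda>x. B (u x) (Psi (omega x))) \<in> hol_of X U"
proof
  have UD: "U \<subseteq> D" by (rule open_X_subset[OF U])
  {
    assume sG: "s \<in> sections Gr2 U"
    show "(\<lambda>x. B (u x) (Psi (omega x))) \<in> hol_of X U"
    proof (rule X.hol_local)
      fix x assume "x \<in> U"
      from bspec[OF sG[unfolded sections_quotient_bundle] this] obtain U1 t where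
        1: "openin (top_of X) U1" "x \<in> U1" "U1 \<subseteq> U" "t \<in> sections E U1"
          "\<forall>y\<in>U1. s y = coset (fibre E y) (EJ_perp_fibre b J D y) (t y)" by blast
      from bspec[OF 1(4)[unfolded sections_E] 1(2)] obtain U' \<tau> where
        *: "openin (top_of X) U'" "x \<in> U'" "U' \<subseteq> U1" "X.hol_vector U' \<tau>"
          "\<forall>y\<in>U'. \<tau> y \<in> cperp b y \<and> t y = q y (\<tau> y)" by blast
      have U': "U' \<subseteq> U" "U' \<subseteq> D" using 1(3) *(3) UD by auto
      have hol: "(\<lambda>y. B (\<tau> y) (B (omega y) e1 *s e2 - e1)) \<in> hol_of X U'"
        using *(1,4) U'
        by (intro X.hol_form_ext X.hol_vector_const X.hol_vector_diff X.hol_vector_scale hol_omega) auto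
      have eq: "B (\<tau> y) (B (omega y) e1 *s e2 - e1) = B (u y) (Psi (omega y))" if "y \<in> U'" for y
      proof -
        have y: "y \<in> D" "y \<in> U" "y \<in> U1" using that U' * by auto
        have "gr2_class y (\<tau> y) = gr2_class y (u y)"
          using 1(5) *(5) y that s[OF y(2)] by (simp add: gr2_class_def)
        then show ?thesis
          using gr2_class_eq_iff[OF y(1), of "\<tau> y" "u y"] *(5) that u[OF y(2)] by (simp add: Psi_omega[OF y(1)])
      qed
      have "(\<lambda>x. B (u x) (Psi (omega x))) \<in> hol_of X U'"
        by (rule X.hol_cong[OF hol]) (simp add: eq)
      with * U' show "\<exists>U'. openin (top_of X) U' \<and> x \<in> U' \<and> U' \<subseteq> U \<and>
          (\<lambda>x. B (u x) (Psi (omega x))) \<in> hol_of X U'"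
        by blast
    qed
  next
    assume a: "(\<lambda>x. B (u x) (Psi (omega x))) \<in> hol_of X U"
    define t where "t x = B (u x) (Psi (omega x)) *s dual_lift x" for x
    have "X.hol_vector U t"
      unfolding t_def dual_lift_def using U UD
      by (intro X.hol_vector_scale[OF a] X.hol_vector_scale X.hol_vector_diff X.hol_vector_const X.hol_form_ext hol_omega) auto
    moreover have t: "t x \<in> cperp b x" if "x \<in> U" for x
      unfolding t_def using dual_lift_cperp[of x] UD that by (intro vec.subspace_scale subspace_cperp) auto
    moreover have r: "gr2_class x (t x) = gr2_class x (u x)" if "x \<in> U" for x
      using gr2_class_eq_iff[OF _ t[OF that] u[OF that]] UD that
      by (auto simp: t_def form_ext_linear dual_lift_Psi)
    moreover have "(\<lambda>x. q x (t x)) \<in> sections E U"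
      by (rule section_E_lift[OF U calculation(1)]) (use t in blast)
    ultimately have "\<exists>t\<in>sections E U. \<forall>y\<in>U. s y = coset (fibre E y) (EJ_perp_fibre b J D y) (t y)"
      using s by (intro bexI[of _ "\<lambda>x. q x (t x)"]) (auto simp: gr2_class_def)
    then show "s \<in> sections Gr2 U"
      unfolding sections_quotient_bundle using U by blast
  }
qed

text \<open>
  The functional \<open>(\<cdot>,e2)\<close>, the dual of \<open>frame\<close>, is a global holomorphic frame of \<open>\<L>\<^sub>J\<^sup>-\<^sup>1\<close>.
\<close>

lemma DLJ_frame: "(\<lambda>y. \<lambda>A\<in>y. quot_pair e2 A) \<in> sections DLJ (\<pi> ` D)"
  unfolding sections_dual_bundle
proof (intro conjI ballI allI impI)
  fix y assume "y \<in> \<pi> ` D"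
  then obtain x where x: "x \<in> D" "y = \<pi> x" by blast
  show "(\<lambda>A\<in>y. quot_pair e2 A) \<in> carr (dual_vs (fibre LJB y))"
    unfolding fibre_LJ x(2)
    by (rule dual_LJ_I[OF x(1), of _ 1]) (simp_all add: pi_mem[OF x(1)] quot_pair_p form_ext_linear omega_e2[OF x(1)])
next
  fix V t assume "openin (top_of H) V" "V \<subseteq> \<pi> ` D" and t: "t \<in> sections LJB V"
  have "t y \<in> y" if "y \<in> V" for y using t that by (simp add: LJ_def sections_sub_bundle)
  then show "(\<lambda>y. (\<lambda>A\<in>y. quot_pair e2 A) (t y)) \<in> hol_of H V"
    by (intro H.hol_cong[OF hol_LJ_coordinate[OF t]]) simp
qed

text \<open>
  Evaluation at \<open>frame\<close> recovers the coefficient with respect to the dual frame.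
\<close>

lemma sections_PD_iff:
  assumes U: "openin (top_of X) U" and s: "\<And>x. x \<in> U \<Longrightarrow> s x = to_dual x (u x)"
  shows "s \<in> sections PD U \<longleftrightarrow> (\<lambda>x. B (u x) (Psi (omega x))) \<in> hol_of X U" (is "_ \<longleftrightarrow> ?a \<in> _")
proof
  have UD: "U \<subseteq> D" by (rule open_X_subset[OF U])
  {
    assume sP: "s \<in> sections PD U"
    have "(\<lambda>x. s x (frame (\<pi> x))) \<in> hol_of X U"
    proof (rule hol_pullback_coordinate[OF sP UD, where C = UNIV and l = "\<lambda>z w. w (frame z)"])
      fix V t assume V: "openin (top_of H) V" and "t \<in> sections DLJ V"
      then show "(\<lambda>z. t z (frame z)) \<in> hol_of H V"
        using frame_section[OF V] unfolding sections_dual_bundle by blast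
    next
      fix x xs assume x: "x \<in> D"
      have m: "p (omega x) \<in> \<pi> x" using pi_mem[OF x, of 1] by simp
      show "lincomb (fibre DLJ (\<pi> x)) xs (frame (\<pi> x)) = (\<Sum>(c, w)\<leftarrow>xs. c * w (frame (\<pi> x)))"
        by (rule lincomb_functional[where C = UNIV and l = "\<lambda>w. w (frame (\<pi> x))", THEN conjunct2])
          (simp_all add: dual_vs_simps fibre_DLJ frame_pi[OF x] m)
    qed simp
    moreover have "s x (frame (\<pi> x)) = ?a x" if "x \<in> U" for x
      using s[OF that] to_dual_p[of x "u x" 1] frame_pi[of x] UD that by auto
    ultimately show "?a \<in> hol_of X U" by (rule X.hol_cong)
  next
    assume a: "?a \<in> hol_of X U"
    \<comment> \<open>The dual frame, with the single coefficient \<open>?a\<close>, represents the section over all of \<open>U\<close>.\<close>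
    let ?l = "[(?a, \<lambda>y. \<lambda>A\<in>y. quot_pair e2 A)]"
    have "s x = lincomb (fibre DLJ (\<pi> x)) (map (\<lambda>(f, t). (f x, t (\<pi> x))) ?l)" if "x \<in> U" for x
    proof -
      have x: "x \<in> D" using that UD by blast
      have "to_dual x (u x) = (\<lambda>A\<in>\<pi> x. ?a x * quot_pair e2 A)"
      proof (rule extensionalityI[of _ "\<pi> x"])
        fix A assume A: "A \<in> \<pi> x"
        then obtain c where c: "A = p (c *s omega x)" by (rule pi_memE[OF x])
        show "to_dual x (u x) A = (\<lambda>A\<in>\<pi> x. ?a x * quot_pair e2 A) A"
          using A to_dual_p[OF x] by (simp add: c quot_pair_p form_ext_linear omega_e2[OF x])
      qed (simp_all add: to_dual_def)
      then show ?thesis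
        using s[OF that] by (auto simp: lincomb_def fibre_DLJ dual_vs_simps fun_eq_iff restrict_def)
    qed
    moreover have "\<forall>(f, t)\<in>set ?l. f \<in> hol_of X U \<and> t \<in> sections DLJ (\<pi> ` D)"
      using a DLJ_frame by auto
    moreover have "\<pi> ` U \<subseteq> \<pi> ` D" using UD by blast
    ultimately show "s \<in> sections PD U"
      unfolding sections_pullback_bundle using U openin_H by blast
  }
qed

lemma G_pi: "g \<in> G \<Longrightarrow> x \<in> D \<Longrightarrow> (`) (complexify g) ` \<pi> x = \<pi> (act_point g x)"
  by (simp add: pi_J_def G_point image_image G_p)

lemma act_PD:
  assumes g: "g \<in> G" and x: "x \<in> D"
  shows "act PD g x (to_dual x u) = to_dual (act_point g x) (complexify g u)"
proof -
  let ?c = "(`) (complexify g)"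
  have act: "act PD g x f = (\<lambda>w\<in>?c ` \<pi> x. f (inv_into (\<pi> x) ?c w))" for f
    by (simp add: pullback_bundle_def dual_bundle_def LJ_def sub_bundle_def trivial_bundle_def)
  have inj: "inj_on ?c (\<pi> x)"
    using G_bij[OF g] by (intro inj_onI) (simp add: bij_is_inj inj_image_eq_iff)
  show ?thesis
  proof (rule extensionalityI[of _ "\<pi> (act_point g x)"])
    fix w assume w: "w \<in> \<pi> (act_point g x)"
    then obtain A where A: "A \<in> \<pi> x" "w = complexify g ` A" using G_pi[OF g x] by blast
    obtain c where c: "A = p (c *s omega x)" by (rule pi_memE[OF x A(1)])
    have "act PD g x (to_dual x u) w = to_dual x u A"
      using A by (simp add: act inv_into_f_f[OF inj])
    also have "\<dots> = B u (Psi (c *s omega x))" using A by (simp add: to_dual_def c Psi_quot_p)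
    also have "\<dots> = B (complexify g u) (Psi (complexify g (c *s omega x)))"
      by (simp only: G_Psi[OF g] G_form[OF g])
    also have "\<dots> = to_dual (act_point g x) (complexify g u) w"
      using w by (simp add: to_dual_def A(2) c G_p[OF g] Psi_quot_p)
    finally show "act PD g x (to_dual x u) w = to_dual (act_point g x) (complexify g u) w" .
  qed (simp_all add: act to_dual_def G_pi[OF g x])
qed

text \<open>
  Equivariance is \<open>(g u, \<Psi> (g v)) = (g u, g (\<Psi> v)) = (u, \<Psi> v)\<close>.
\<close>

theorem Gr2_iso: "equiv_iso X G act_point Gr2 PD"
proof (rule equiv_iso_parametrized[where S = "cperp b" and r = gr2_class and r' = to_dual and h = complexify];
    (unfold topspace_X)?)
  fix x assume x: "x \<in> D"
  show "parametrizes (fibre Gr2 x) (cperp b x) (gr2_class x)" by (rule parametrizes_Gr2[OF x])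
  show "parametrizes (fibre PD x) (cperp b x) (to_dual x)"
    using parametrizes_to_dual[OF x] by (simp add: pullback_bundle_def fibre_DLJ)
  show "gr2_class x u = gr2_class x v \<longleftrightarrow> to_dual x u = to_dual x v" if "u \<in> cperp b x" "v \<in> cperp b x" for u v
    using gr2_class_eq_iff[OF x that] to_dual_eq_iff[OF x] by simp
  fix g assume g: "g \<in> G"
  show y: "act_point g x \<in> D" by (rule G_D[OF g x])
  fix u assume u: "u \<in> cperp b x"
  let ?y = "act_point g x"
  have 1: "complexify g u \<in> cperp b ?y" using G_cperp[OF g x] u by simp
  have "act Gr2 g x (gr2_class x u) = gr2_class ?y (complexify g u)"
  proof -
    have im: "complexify g ` q x v = q ?y (complexify g v)" for v by (rule G_q)
    have "act Gr2 g x A = (\<lambda>B. complexify g ` B) ` A" for A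
      by (simp add: quotient_bundle_def act_E[simplified])
    moreover have "gr2_class x u = {q x (u + t) |t. t \<in> perp_lifts x}"
      unfolding gr2_class_def EJ_perp_fibre_eq[OF x]
      by (rule coset_parametrized[OF parametrizes_E[OF x] perp_lifts_cperp[OF x] u])
    moreover have "gr2_class ?y (complexify g u) = {q ?y (complexify g u + t) |t. t \<in> complexify g ` perp_lifts x}"
      unfolding gr2_class_def EJ_perp_fibre_eq[OF y] G_perp_lifts_image[OF g x]
      by (rule coset_parametrized[OF parametrizes_E[OF y] perp_lifts_cperp[OF y] 1])
    ultimately show ?thesis
      by (simp only: setcompr_eq_image image_image im complexify_add Collect_mem_eq)
  qed
  then show "complexify g u \<in> cperp b ?y \<and>
       act Gr2 g x (gr2_class x u) = gr2_class ?y (complexify g u) \<and> act PD g x (to_dual x u) = to_dual ?y (complexify g u)"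
    using 1 act_PD[OF g x] by simp
next
  fix U s t u
  assume U: "openin (top_of X) U" and u: "\<And>x. x \<in> U \<Longrightarrow> u x \<in> cperp b x"
    and s: "\<And>x. x \<in> U \<Longrightarrow> s x = gr2_class x (u x)" and t: "\<And>x. x \<in> U \<Longrightarrow> t x = to_dual x (u x)"
  from sections_Gr2_iff[OF U u s] sections_PD_iff[OF U t]
  show "s \<in> sections Gr2 U \<longleftrightarrow> t \<in> sections PD U" by blast
qed

end

section \<open>Rank two sublattices over a field\<close>

lemma module_int_vec: "module ((*s) :: int \<Rightarrow> int^'m \<Rightarrow> int^'m)"
  by unfold_locales (auto simp: vec_eq_iff algebra_simps)

lemma rank_2_basis:
  fixes J :: "(int^'m) set"
  assumes "has_rank J 2"
  obtains j1 j2 where "J = {k *s j1 + l *s j2 |k l. True}"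
    and "\<And>k l. k *s j1 + l *s j2 = 0 \<Longrightarrow> k = 0 \<and> l = 0"
proof -
  obtain S where S: "finite S" "card S = 2" "\<not> module.dependent (*s) S" "module.span (*s) S = J"
    using assms unfolding has_rank_def by blast
  obtain j1 j2 where j: "S = {j1, j2}" "j1 \<noteq> j2" using S(2) by (auto simp: card_2_iff)
  have "J = range (\<lambda>u. \<Sum>v\<in>S. u v *s v)"
    using module.span_finite[OF module_int_vec S(1)] S(4) by simp
  also have "\<dots> = {k *s j1 + l *s j2 |k l. True}"
  proof
    show "range (\<lambda>u. \<Sum>v\<in>S. u v *s v) \<subseteq> {k *s j1 + l *s j2 |k l. True}"
      using j by auto
    show "{k *s j1 + l *s j2 |k l. True} \<subseteq> range (\<lambda>u. \<Sum>v\<in>S. u v *s v)"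
    proof clarify
      fix k l
      have "k *s j1 + l *s j2 = (\<Sum>v\<in>S. (if v = j1 then k else l) *s v)" using j by simp
      then show "k *s j1 + l *s j2 \<in> range (\<lambda>u. \<Sum>v\<in>S. u v *s v)"
        by (rule range_eqI[where x = "\<lambda>v. if v = j1 then k else l"])
    qed
  qed
  finally have 1: "J = {k *s j1 + l *s j2 |k l. True}" .
  have 2: "k = 0 \<and> l = 0" if "k *s j1 + l *s j2 = 0" for k l
  proof (rule ccontr)
    assume ne: "\<not> (k = 0 \<and> l = 0)"
    let ?u = "\<lambda>v. if v = j1 then k else l"
    have "(\<Sum>v\<in>S. ?u v *s v) = 0" using j that by simp
    moreover have "\<exists>v\<in>S. ?u v \<noteq> 0" using j ne by auto
    ultimately have "module.dependent (*s) S"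
      unfolding module.dependent_explicit[OF module_int_vec] using S(1)
      by (intro exI[of _ S] exI[of _ ?u]) auto
    then show False using S(3) by blast
  qed
  show ?thesis by (rule that[OF 1 2])
qed

definition emb :: "int^'m \<Rightarrow> 'a::field_char_0^'m" where
  "emb x = (\<chi> i. of_int (x $ i))"

lemma emb_simps: "emb (x + y) = emb x + emb y" "emb (k *s x) = of_int k *s emb x"
  by (simp_all add: emb_def vec_eq_iff)

lemma scalars_ext_emb: "scalars_ext M = vec.span (emb ` M)"
  by (simp add: scalars_ext_def emb_def[abs_def])

lemma subspace_span_2: "vec.subspace {a *s u + c *s v |a c. True}"
proof -
  have "x - a *s u \<in> range (\<lambda>k. k *s v) \<longleftrightarrow> (\<exists>c. x = a *s u + c *s v)" for x a
    by (simp add: image_iff diff_eq_eq add.commute)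
  then have "vec.span {u, v} = {a *s u + c *s v |a c. True}"
    by (simp add: vec.span_insert[of u] vec.span_singleton)
  then show ?thesis using vec.subspace_span[of "{u, v}"] by simp
qed

lemma scalars_ext_rank_2:
  assumes "J = {k *s j1 + l *s j2 |k l. True}"
  shows "scalars_ext J = {a *s emb j1 + c *s emb j2 |a c. True}"
  unfolding scalars_ext_emb
proof
  show "vec.span (emb ` J) \<subseteq> {a *s emb j1 + c *s emb j2 |a c. True}"
  proof (rule vec.span_minimal[OF _ subspace_span_2])
    have "emb (k *s j1 + l *s j2) = of_int k *s emb j1 + of_int l *s emb j2" for k l
      by (simp add: emb_simps)
    then show "emb ` J \<subseteq> {a *s emb j1 + c *s emb j2 |a c. True}"
      unfolding assms by blast
  qed
  have "j1 = 1 *s j1 + 0 *s j2" "j2 = 0 *s j1 + 1 *s j2" by simp_all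
  then have "j1 \<in> J" "j2 \<in> J" unfolding assms by blast+
  then show "{a *s emb j1 + c *s emb j2 |a c. True} \<subseteq> vec.span (emb ` J)"
    by (safe, intro vec.span_add vec.span_scale vec.span_base imageI)
qed

locale integral_form =
  fixes b :: "int^'m \<Rightarrow> int^'m \<Rightarrow> int"
  assumes lattice: "lattice_form b"
begin

lemma b_sym: "b x y = b y x" and b_add: "b (x + y) z = b x z + b y z"
  using lattice by (auto simp: lattice_form_def)

lemma b_0: "b 0 y = 0"
  using b_add[of 0 0 y] by simp

lemma b_minus: "b (- x) y = - b x y"
  using b_add[of x "- x" y] by (simp add: b_0)

lemma b_scale: "b (k *s x) y = k * b x y"
proof -
  have *: "b (int n *s x) y = int n * b x y" for n
    by (induction n) (simp_all add: b_0 b_add vector_sadd_rdistrib algebra_simps)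
  show ?thesis
  proof (cases k)
    case (nonneg n)
    then show ?thesis using * by simp
  next
    case (neg n)
    have "k *s x = - (int (Suc n) *s x)" unfolding neg by (simp add: vec_eq_iff)
    then show ?thesis using *[of "Suc n"] by (simp only: b_minus neg)
  qed
qed

lemma b_sum: "b (sum f A) y = (\<Sum>i\<in>A. b (f i) y)"
  by (induction A rule: infinite_finite_induct) (simp_all add: b_0 b_add)

lemma int_expansion: "(x :: int^'m) = (\<Sum>i\<in>UNIV. x $ i *s axis i 1)"
  by (simp add: vec_eq_iff axis_def if_distrib cong: if_cong)

lemma b_expand: "b x y = (\<Sum>i\<in>UNIV. x $ i * b (axis i 1) y)"
  by (subst int_expansion[of x]) (simp only: b_sum b_scale)

lemma form_ext_emb: "form_ext b v (emb y) = (\<Sum>i\<in>UNIV. v $ i * of_int (b (axis i 1) y))"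
proof -
  have "b (axis i 1) y = (\<Sum>j\<in>UNIV. y $ j * b (axis i 1) (axis j 1))" for i
    unfolding b_sym[of "axis i 1"] by (rule b_expand)
  then show ?thesis
    by (simp add: form_ext_def emb_def sum_distrib_left mult_ac)
qed

lemma form_ext_emb_emb: "form_ext b (emb x) (emb y) = of_int (b x y)"
  unfolding form_ext_emb b_expand[of x y] by (simp add: emb_def)

lemma form_ext_axis: "form_ext b (axis i 1) (emb y) = of_int (b (axis i 1) y)"
  by (simp add: form_ext_emb axis_def if_distrib[of "\<lambda>c. c * _"] cong: if_cong)

text \<open>
  If all minors vanished, then, choosing \<open>p\<close> with \<open>(axis p, j1) \<noteq> 0\<close>, the integral vector
  \<open>(axis p, j1) j2 - (axis p, j2) j1\<close> would be orthogonal to the whole lattice, hence zero, contrary to independence.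
\<close>

lemma nonzero_minor:
  assumes ind: "\<And>k l. k *s j1 + l *s j2 = 0 \<Longrightarrow> k = 0 \<and> l = 0"
  obtains p q where "b (axis p 1) j1 * b (axis q 1) j2 - b (axis q 1) j1 * b (axis p 1) j2 \<noteq> 0"
proof (rule ccontr)
  assume "\<not> thesis"
  with that have 0: "b (axis p 1) j1 * b (axis q 1) j2 = b (axis q 1) j1 * b (axis p 1) j2" for p q
    by (metis right_minus_eq)
  have nd: "x = 0" if "\<And>i. b (axis i 1) x = 0" for x
  proof -
    have "b x y = 0" for y using b_expand[of y x] that b_sym[of x y] by simp
    then show ?thesis using lattice by (auto simp: lattice_form_def)
  qed
  have "j1 \<noteq> 0" using ind[of 1 0] by auto
  then obtain p where p: "b (axis p 1) j1 \<noteq> 0" using nd by blast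
  have "b (axis i 1) (b (axis p 1) j1 *s j2 + (- b (axis p 1) j2) *s j1) = 0" for i
    unfolding b_sym[of "axis i 1"] b_add b_scale
    using 0[of p i] by (simp add: b_sym[of _ "axis i 1"] mult_ac)
  from nd[OF this] have "(- b (axis p 1) j2) *s j1 + b (axis p 1) j1 *s j2 = 0" by (simp add: add_ac)
  from ind[OF this] p show False by simp
qed

text \<open>
  A system of two integral linear equations has its solution space spanned by integral vectors. Cramer's rule for a nonzero
  minor \<open>d\<close> gives an integral matrix, with columns \<open>M k\<close>, whose image lies in \<open>J\<^sup>\<bottom>\<close> and which is multiplication by
  \<open>d\<close> on the solutions.
\<close>

lemma scalars_ext_lperp:
  fixes j1 j2 :: "int^'m"
  assumes J: "J = {k *s j1 + l *s j2 |k l. True}"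
    and minor: "b (axis p 1) j1 * b (axis q 1) j2 - b (axis q 1) j1 * b (axis p 1) j2 \<noteq> 0"
  shows "(scalars_ext (lperp b J) :: ('a::field_char_0^'m) set) =
    {v. form_ext b v (emb j1) = 0 \<and> form_ext b v (emb j2) = 0}"
proof -
  have lperp: "x \<in> lperp b J \<longleftrightarrow> b x j1 = 0 \<and> b x j2 = 0" for x
  proof
    assume x: "x \<in> lperp b J"
    have "j1 = 1 *s j1 + 0 *s j2" "j2 = 0 *s j1 + 1 *s j2" by simp_all
    then have "j1 \<in> J" "j2 \<in> J" unfolding J by blast+
    then show "b x j1 = 0 \<and> b x j2 = 0" using x by (simp add: lperp_def)
  next
    assume "b x j1 = 0 \<and> b x j2 = 0"
    then show "x \<in> lperp b J"
      by (auto simp: lperp_def J b_sym[of x] b_add b_scale)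
  qed
  show ?thesis
  proof
    have "vec.subspace {v :: 'a^'m. form_ext b v (emb j1) = 0 \<and> form_ext b v (emb j2) = 0}"
      by (auto simp: vec.subspace_def form_ext_linear)
    then show "(scalars_ext (lperp b J) :: ('a^'m) set) \<subseteq> {v. form_ext b v (emb j1) = 0 \<and> form_ext b v (emb j2) = 0}"
      unfolding scalars_ext_emb
      by (intro vec.span_minimal) (auto simp: lperp form_ext_emb_emb)
    show "{v. form_ext b v (emb j1) = 0 \<and> form_ext b v (emb j2) = 0} \<subseteq> (scalars_ext (lperp b J) :: ('a^'m) set)"
    proof clarify
      fix v :: "'a^'m"
      assume v: "form_ext b v (emb j1) = 0" "form_ext b v (emb j2) = 0"
      define c1 where "c1 k = b (axis k 1) j1" for k
      define c2 where "c2 k = b (axis k 1) j2" for k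
      define d where "d = c1 p * c2 q - c1 q * c2 p"
      have d: "d \<noteq> 0" using minor by (simp add: d_def c1_def c2_def)
      define M where "M k = d *s axis k 1 - (c1 k * c2 q - c2 k * c1 q) *s axis p 1
          - (c1 p * c2 k - c2 p * c1 k) *s axis q 1" for k :: 'm
      have bd: "b (x - y) z = b x z - b y z" for x y z
        using b_add[of "x - y" y z] by simp
      have "M k \<in> lperp b J" for k
        unfolding lperp M_def bd b_scale c1_def[symmetric] c2_def[symmetric]
        by (simp add: d_def algebra_simps)
      then have M: "emb (M k) \<in> (scalars_ext (lperp b J) :: ('a^'m) set)" for k
        unfolding scalars_ext_emb by (intro vec.span_base) blast
      have v': "(\<Sum>k\<in>UNIV. v $ k * of_int (c1 k)) = 0" "(\<Sum>k\<in>UNIV. v $ k * of_int (c2 k)) = 0"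
        using v by (simp_all add: form_ext_emb c1_def c2_def)
      have "of_int d *s v = (\<Sum>k\<in>UNIV. v $ k *s emb (M k))"
      proof (rule vec_eq_iff[THEN iffD2], rule allI)
        fix i
        have "(\<Sum>k\<in>UNIV. v $ k *s emb (M k)) $ i =
            (\<Sum>k\<in>UNIV. (if k = i then of_int d * v $ k else 0)
              - (of_int (c2 q) * (v $ k * of_int (c1 k)) - of_int (c1 q) * (v $ k * of_int (c2 k))) * (if i = p then 1 else 0)
              - (of_int (c1 p) * (v $ k * of_int (c2 k)) - of_int (c2 p) * (v $ k * of_int (c1 k))) * (if i = q then 1 else 0))"
          unfolding sum_component
          by (intro sum.cong refl) (auto simp: M_def emb_def axis_def algebra_simps)
        also have "\<dots> = of_int d * v $ i"
          by (simp add: sum_subtractf v' flip: sum_distrib_left sum_distrib_right)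
        finally show "(of_int d *s v) $ i = (\<Sum>k\<in>UNIV. v $ k *s emb (M k)) $ i" by simp
      qed
      also have "\<dots> \<in> scalars_ext (lperp b J)"
        using M by (auto simp: scalars_ext_def intro!: vec.span_sum vec.span_scale)
      finally have "(1 / of_int d) *s (of_int d *s v) \<in> (scalars_ext (lperp b J) :: ('a^'m) set)"
        unfolding scalars_ext_def by (rule vec.span_scale)
      then show "v \<in> (scalars_ext (lperp b J) :: ('a^'m) set)" using d by simp
    qed
  qed
qed

text \<open>
  Cramer's rule again, in the span of the two basis vectors of the minor.
\<close>

lemma dual_basis:
  fixes j1 j2 :: "int^'m"
  assumes "b (axis p 1) j1 * b (axis q 1) j2 - b (axis q 1) j1 * b (axis p 1) j2 \<noteq> 0"
  obtains f1 f2 :: "'a::field_char_0^'m" where "form_ext b f1 (emb j1) = 1" "form_ext b f1 (emb j2) = 0"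
    "form_ext b f2 (emb j1) = 0" "form_ext b f2 (emb j2) = 1"
proof -
  define a1 where "a1 k = (of_int (b (axis k 1) j1) :: 'a)" for k
  define a2 where "a2 k = (of_int (b (axis k 1) j2) :: 'a)" for k
  define d where "d = a1 p * a2 q - a1 q * a2 p"
  have "d = of_int (b (axis p 1) j1 * b (axis q 1) j2 - b (axis q 1) j1 * b (axis p 1) j2)"
    by (simp add: d_def a1_def a2_def)
  then have d: "d \<noteq> 0" by (simp only: of_int_eq_0_iff assms not_False_eq_True)
  let ?f1 = "(1 / d) *s (a2 q *s axis p 1 - a2 p *s axis q 1)"
  let ?f2 = "(1 / d) *s (a1 p *s axis q 1 - a1 q *s axis p 1)"
  show ?thesis
  proof (rule that[of ?f1 ?f2])
    have 1: "form_ext b (axis k 1) (emb j1) = a1 k" and 2: "form_ext b (axis k 1) (emb j2) = a2 k" for k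
      by (simp_all add: form_ext_axis a1_def a2_def)
    have "(1 / d) * (a2 q * a1 p - a2 p * a1 q) = 1" "(1 / d) * (a1 p * a2 q - a1 q * a2 p) = 1"
      using d by (simp_all add: d_def mult.commute)
    then show "form_ext b ?f1 (emb j1) = 1" "form_ext b ?f2 (emb j2) = 1"
      by (simp_all only: form_ext_linear 1 2)
    show "form_ext b ?f1 (emb j2) = 0" "form_ext b ?f2 (emb j1) = 0"
      by (simp_all only: form_ext_linear 1 2) simp_all
  qed
qed

end


section \<open>Signature\<close>

text \<open>
  A semidefinite subspace meets the negative summand \<open>N\<close>, of dimension \<open>s\<close>, trivially.
\<close>

lemma signature_semidefinite_dim:
  fixes q :: "real^'m \<Rightarrow> real^'m \<Rightarrow> real"
  assumes sig: "signature q r s" and S: "subspace S" and nn: "\<And>x. x \<in> S \<Longrightarrow> q x x \<ge> 0"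
  shows "dim S \<le> r"
proof -
  obtain P N where PN: "subspace P" "subspace N" "dim P = r" "dim N = s"
        "\<forall>x\<in>P. x \<noteq> 0 \<longrightarrow> q x x > 0" "\<forall>x\<in>N. x \<noteq> 0 \<longrightarrow> q x x < 0"
        "{x + y |x y. x \<in> P \<and> y \<in> N} = UNIV"
    using sig unfolding signature_def by (elim exE conjE) (rule that)
  have "x = 0" if "x \<in> P" "x \<in> N" for x
    using PN(5,6) that less_asym by blast
  moreover have "x = 0" if "x \<in> S" "x \<in> N" for x
    using PN(6) nn[OF that(1)] that(2) by (meson not_le)
  ultimately have "P \<inter> N \<subseteq> {0}" "S \<inter> N \<subseteq> {0}" by blast+
  then have 0: "dim (P \<inter> N) = 0" "dim (S \<inter> N) = 0" by (simp_all only: dim_eq_0)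
  have "dim (UNIV :: (real^'m) set) = r + s"
    using dim_sums_Int[OF PN(1,2)] PN(3,4,7) 0 by simp
  moreover have "dim {x + y |x y. x \<in> S \<and> y \<in> N} = dim S + s"
    using dim_sums_Int[OF S PN(2)] PN(4) 0 by simp
  ultimately show ?thesis
    using dim_subset[of "{x + y |x y. x \<in> S \<and> y \<in> N}" UNIV] by simp
qed

lemma no_semidefinite_triple:
  fixes u v w :: "real^'m"
  assumes sig: "signature (form_ext b) 2 n"
    and ind: "\<And>x y z. x *\<^sub>R u + y *\<^sub>R v + z *\<^sub>R w = 0 \<Longrightarrow> x = 0 \<and> y = 0 \<and> z = 0"
    and nn: "\<And>x y z. form_ext b (x *\<^sub>R u + y *\<^sub>R v + z *\<^sub>R w) (x *\<^sub>R u + y *\<^sub>R v + z *\<^sub>R w) \<ge> 0"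
  shows False
proof -
  let ?S = "span {u, v, w}"
  have S: "\<exists>x y z. t = x *\<^sub>R u + y *\<^sub>R v + z *\<^sub>R w" if "t \<in> ?S" for t
  proof -
    from that obtain x where "t - x *\<^sub>R u \<in> span {v, w}" by (auto simp: span_insert[of u])
    then obtain y where "t - x *\<^sub>R u - y *\<^sub>R v \<in> span {w}" by (auto simp: span_insert[of v])
    then obtain z where "t - x *\<^sub>R u - y *\<^sub>R v = z *\<^sub>R w" by (auto simp: span_singleton)
    then have "t = x *\<^sub>R u + y *\<^sub>R v + z *\<^sub>R w" by (simp add: algebra_simps)
    then show ?thesis by blast
  qed
  have w: "w \<noteq> 0" using ind[of 0 0 1] by auto
  have v: "v \<notin> span {w}"
  proof
    assume "v \<in> span {w}"
    then obtain z where "v = z *\<^sub>R w" by (auto simp: span_singleton)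
    then show False using ind[of 0 1 "- z"] by simp
  qed
  have u: "u \<notin> span {v, w}"
  proof
    assume "u \<in> span {v, w}"
    then obtain y where "u - y *\<^sub>R v \<in> span {w}" by (auto simp: span_insert[of v])
    then obtain z where "u - y *\<^sub>R v = z *\<^sub>R w" by (auto simp: span_singleton)
    then show False using ind[of 1 "- y" "- z"] by (simp add: algebra_simps)
  qed
  have "independent {u, v, w}"
    using u v w by (auto simp: independent_insert)
  moreover have "card {u, v, w} = 3"
  proof -
    have "v \<noteq> w" using v span_base by blast
    moreover have "u \<noteq> v" "u \<noteq> w"
      using u span_base[of v "{v, w}"] span_base[of w "{v, w}"] by auto
    ultimately show ?thesis by simp
  qed
  ultimately have "dim ?S = 3" using dim_span_eq_card_independent by metis
  moreover have "dim ?S \<le> 2"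
  proof (rule signature_semidefinite_dim[OF sig subspace_span])
    fix t assume "t \<in> ?S"
    then obtain x y z where "t = x *\<^sub>R u + y *\<^sub>R v + z *\<^sub>R w" using S by blast
    then show "form_ext b t t \<ge> 0" using nn by simp
  qed
  ultimately show False by simp
qed

section \<open>Real and imaginary parts\<close>

text \<open>
  The complexification of a real vector.
\<close>

definition cv :: "real^'m \<Rightarrow> complex^'m" where
  "cv v = (\<chi> i. of_real (v $ i))"

definition reV :: "complex^'m \<Rightarrow> real^'m" where
  "reV v = (\<chi> i. Re (v $ i))"

definition imV :: "complex^'m \<Rightarrow> real^'m" where
  "imV v = (\<chi> i. Im (v $ i))"

lemma cv_reV_imV: "v = cv (reV v) + \<i> *s cv (imV v)"
  by (simp add: vec_eq_iff cv_def reV_def imV_def complex_eq_iff)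

lemma cnj_reV_imV: "(\<chi> i. cnj (v $ i)) = cv (reV v) - \<i> *s cv (imV v)"
  by (simp add: vec_eq_iff cv_def reV_def imV_def complex_eq_iff)

lemma cv_simps: "cv (u + v) = cv u + cv v" "cv (u - v) = cv u - cv v" "cv (r *s v) = of_real r *s cv v"
  "cv (r *\<^sub>R v) = of_real r *s cv v"
  by (simp_all add: cv_def vec_eq_iff)

lemma imV_simps: "imV (u + v) = imV u + imV v" "imV (of_real r *s v) = r *\<^sub>R imV v" "imV (u - v) = imV u - imV v"
  "imV (c *s cv w) = Im c *\<^sub>R w"
  by (simp_all add: imV_def cv_def vec_eq_iff)

lemma cv_emb: "cv (emb x) = emb x"
  by (simp add: cv_def emb_def)

lemma form_ext_cv: "form_ext b (cv u) (cv v) = of_real (form_ext b u v)"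
  by (simp add: form_ext_def cv_def)

lemma form_ext_cv_right: "form_ext b w (cv v) = Complex (form_ext b (reV w) v) (form_ext b (imV w) v)"
  by (subst cv_reV_imV[of w]) (simp add: form_ext_linear form_ext_cv complex_eq_iff)

lemma map_matrix_vector_cv: "complexify g (cv v) = cv (g *v v)"
  by (simp add: complexify_def cv_def map_matrix_def matrix_vector_mult_def vec_eq_iff)

lemma complexify_cv: "complexify g w = cv (g *v reV w) + \<i> *s cv (g *v imV w)"
  by (subst cv_reV_imV[of w]) (simp add: complexify_add complexify_scale map_matrix_vector_cv)

lemma Re_mult_real: "Re (of_real r * z) = r * Re z"
  by simp

lemma smult_eq_scaleR: "c *s v = c *\<^sub>R (v :: real^'m)"
  by (simp add: vec_eq_iff)


section \<open>Periods and the tube domain\<close>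

text \<open>
  These are the real and imaginary parts of \<open>(w,w) = 0\<close>. The consequence for the hermitian form is that the points of the period
  quadric are those with \<open>(Im w, Im w) > 0\<close>.
\<close>

lemma period_parts:
  assumes sym: "\<And>x y. b x y = b y x" and iso: "form_ext b w w = 0"
  shows "form_ext b (reV w) (imV w) = 0"
    and "form_ext b (reV w) (reV w) = form_ext b (imV w) (imV w)"
    and "Re (form_ext b w (\<chi> i. cnj (w $ i))) = 2 * form_ext b (imV w) (imV w)"
proof -
  have s: "form_ext b (imV w) (reV w) = form_ext b (reV w) (imV w)" by (rule form_ext_commute[OF sym])
  have "form_ext b (cv (reV w) + \<i> *s cv (imV w)) (cv (reV w) + \<i> *s cv (imV w)) = 0"
    using iso cv_reV_imV[of w] by simp
  then have "Complex (form_ext b (reV w) (reV w) - form_ext b (imV w) (imV w)) (2 * form_ext b (reV w) (imV w)) = 0"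
    by (simp add: form_ext_linear form_ext_cv s complex_eq_iff)
  then show 1: "form_ext b (reV w) (imV w) = 0"
    and 2: "form_ext b (reV w) (reV w) = form_ext b (imV w) (imV w)" by (simp_all add: complex_eq_iff)
  have "form_ext b w (\<chi> i. cnj (w $ i)) =
      form_ext b (cv (reV w) + \<i> *s cv (imV w)) (cv (reV w) - \<i> *s cv (imV w))"
    using cv_reV_imV[of w] by (simp add: cnj_reV_imV)
  then show "Re (form_ext b w (\<chi> i. cnj (w $ i))) = 2 * form_ext b (imV w) (imV w)"
    by (simp add: form_ext_linear form_ext_cv s 2)
qed

lemma hermitian_scale_pos:
  assumes "Re (form_ext b u (\<chi> i. cnj (u $ i))) > 0" "k \<noteq> 0"
  shows "Re (form_ext b (k *s u) (\<chi> i. cnj ((k *s u) $ i))) > 0"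
proof -
  have "(\<chi> i. cnj ((k *s u) $ i)) = cnj k *s (\<chi> i. cnj (u $ i))"
    by (simp add: vec_eq_iff)
  then have "form_ext b (k *s u) (\<chi> i. cnj ((k *s u) $ i)) = (k * cnj k) * form_ext b u (\<chi> i. cnj (u $ i))"
    by (simp add: form_ext_linear)
  also have "k * cnj k = of_real ((cmod k)\<^sup>2)"
    by (simp only: complex_norm_square)
  finally have "Re (form_ext b (k *s u) (\<chi> i. cnj ((k *s u) $ i))) =
      (cmod k)\<^sup>2 * Re (form_ext b u (\<chi> i. cnj (u $ i)))"
    by (simp only: Re_mult_real)
  then show ?thesis using assms by simp
qed

lemma pline_scale:
  assumes "k \<noteq> 0" shows "pline id (k *s u) = pline id (u :: complex^'m)"
proof -
  have "pline id u \<subseteq> pline id (k *s u)"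
    unfolding pline_id
  proof clarify
    fix c
    have "c *s u = (c / k) *s (k *s u)" using assms by simp
    then show "c *s u \<in> range (\<lambda>c. c *s (k *s u))" by (rule range_eqI)
  qed
  moreover have "pline id (k *s u) \<subseteq> pline id u" by (auto simp: pline_id)
  ultimately show ?thesis by blast
qed

locale isotropic_plane =
  fixes b :: "int^'m \<Rightarrow> int^'m \<Rightarrow> int" and n :: nat and e1 e2 :: "real^'m"
  assumes b_sym: "\<And>x y. b x y = b y x"
    and sig: "signature (form_ext b) 2 n"
    and ee: "form_ext b e1 e1 = 0" "form_ext b e1 e2 = 0" "form_ext b e2 e2 = 0"
    and ind: "\<And>x y. x *\<^sub>R e1 + y *\<^sub>R e2 = 0 \<Longrightarrow> x = 0 \<and> y = 0"
begin

abbreviation BR :: "real^'m \<Rightarrow> real^'m \<Rightarrow> real" where "BR \<equiv> form_ext b"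

lemma B_sym: "BR x y = BR y x"
  by (rule form_ext_commute[OF b_sym])

lemma B_scaleR: "BR (r *\<^sub>R x) y = r * BR x y" "BR x (r *\<^sub>R y) = r * BR x y"
  by (simp_all only: smult_eq_scaleR[symmetric] form_ext_scale_left form_ext_scale_right)

lemmas B_linear = form_ext_linear B_scaleR

lemma ee': "BR e2 e1 = 0" using ee B_sym[of e2 e1] by simp

text \<open>
  The real and imaginary parts of \<open>w\<close> span a positive definite plane. If \<open>e\<close> were nonzero and orthogonal to it, then
  \<open>Re w, Im w, e\<close> would span a three-dimensional semidefinite space.
\<close>

lemma period_not_orthogonal:
  assumes iso: "form_ext b w w = 0" and pos: "BR (imV w) (imV w) > 0"
    and e: "e = x *\<^sub>R e1 + y *\<^sub>R e2" and orth: "form_ext b w (cv e) = 0"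
  shows "x = 0 \<and> y = 0"
proof (rule ccontr)
  assume ne: "\<not> (x = 0 \<and> y = 0)"
  have e0: "e \<noteq> 0" using ne ind[of x y] e by auto
  let ?a = "reV w" and ?c = "imV w"
  have o: "BR ?a e = 0" "BR ?c e = 0" using orth by (simp_all add: form_ext_cv_right complex_eq_iff)
  then have o': "BR e ?a = 0" "BR e ?c = 0" using B_sym[of e ?a] B_sym[of e ?c] by simp_all
  have aa: "BR ?a ?a = BR ?c ?c" "BR ?a ?c = 0" "BR ?c ?a = 0"
    using period_parts[OF b_sym iso] B_sym[of ?c ?a] by simp_all
  have E: "BR e e = 0" by (simp add: e B_linear ee ee')
  have form: "BR (s *\<^sub>R ?a + t *\<^sub>R ?c + z *\<^sub>R e) (s *\<^sub>R ?a + t *\<^sub>R ?c + z *\<^sub>R e) = (s\<^sup>2 + t\<^sup>2) * BR ?c ?c" for s t z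
    by (simp add: B_linear aa o o' E algebra_simps power2_eq_square)
  show False
  proof (rule no_semidefinite_triple[OF sig, of ?a ?c e])
    fix s t z assume 0: "s *\<^sub>R ?a + t *\<^sub>R ?c + z *\<^sub>R e = 0"
    with form[of s t z] have "(s\<^sup>2 + t\<^sup>2) * BR ?c ?c = 0" by (simp add: form_ext_zero)
    then have "s = 0 \<and> t = 0" using pos by (simp add: sum_power2_eq_zero_iff)
    with 0 e0 show "s = 0 \<and> t = 0 \<and> z = 0" by simp
  next
    fix s t z show "0 \<le> BR (s *\<^sub>R ?a + t *\<^sub>R ?c + z *\<^sub>R e) (s *\<^sub>R ?a + t *\<^sub>R ?c + z *\<^sub>R e)"
      unfolding form using pos by simp
  qed
qed

text \<open>
  A vector of positive norm orthogonal to \<open>J\<close> would span with \<open>J\<close> a three-dimensional semidefinite space.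
\<close>

lemma perp_nonpos:
  assumes "BR x e1 = 0" "BR x e2 = 0" shows "BR x x \<le> 0"
proof (rule ccontr)
  assume "\<not> BR x x \<le> 0"
  then have pos: "BR x x > 0" by simp
  have form: "BR (s *\<^sub>R x + t *\<^sub>R e1 + z *\<^sub>R e2) (s *\<^sub>R x + t *\<^sub>R e1 + z *\<^sub>R e2) = s\<^sup>2 * BR x x" for s t z
    by (simp add: B_linear assms ee ee' B_sym[of e1 x] B_sym[of e2 x] power2_eq_square)
  show False
  proof (rule no_semidefinite_triple[OF sig, of x e1 e2])
    fix s t z assume 0: "s *\<^sub>R x + t *\<^sub>R e1 + z *\<^sub>R e2 = 0"
    with form[of s t z] have "s\<^sup>2 * BR x x = 0" by (simp add: form_ext_zero)
    then have "s = 0" using pos by simp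
    with 0 ind[of t z] show "s = 0 \<and> t = 0 \<and> z = 0" by simp
  next
    fix s t z show "0 \<le> BR (s *\<^sub>R x + t *\<^sub>R e1 + z *\<^sub>R e2) (s *\<^sub>R x + t *\<^sub>R e1 + z *\<^sub>R e2)"
      unfolding form using pos by simp
  qed
qed

text \<open>
  The reverse Cauchy-Schwarz inequality in the Lorentzian space \<open>e2\<^sup>\<bottom> / e2\<close>. The multiple \<open>r\<close> of \<open>v\<close> is chosen to make
  \<open>u - r v\<close> orthogonal to \<open>e1\<close>; then \<open>perp_nonpos\<close> applies to the difference.
\<close>

lemma positive_cone_pairing:
  assumes u: "BR u e2 = 0" "BR u u > 0" "BR u e1 > 0" and v: "BR v e2 = 0" "BR v v > 0" "BR v e1 > 0"
  shows "BR u v > 0"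
proof -
  define r where "r = BR u e1 / BR v e1"
  have r: "r > 0" using u v by (simp add: r_def)
  have "BR (u - r *\<^sub>R v) (u - r *\<^sub>R v) \<le> 0"
    by (rule perp_nonpos) (use u v in \<open>simp_all add: B_linear r_def\<close>)
  then have "BR u u + r\<^sup>2 * BR v v \<le> 2 * r * BR u v"
    by (simp add: B_linear B_sym[of v u] power2_eq_square algebra_simps)
  moreover have "0 < BR u u + r\<^sup>2 * BR v v" using u v by (simp add: add_pos_nonneg)
  ultimately have "0 < 2 * r * BR u v" by linarith
  then show ?thesis using r by (simp add: zero_less_mult_iff)
qed

lemma positive_cone_segment:
  assumes u: "BR u e2 = 0" "BR u u > 0" "BR u e1 > 0" and v: "BR v e2 = 0" "BR v v > 0" "BR v e1 > 0"
    and t: "0 \<le> t" "t \<le> 1"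
  shows "BR ((1 - t) *\<^sub>R u + t *\<^sub>R v) ((1 - t) *\<^sub>R u + t *\<^sub>R v) > 0"
proof -
  have p: "BR u v > 0" by (rule positive_cone_pairing[OF u v])
  have "BR ((1 - t) *\<^sub>R u + t *\<^sub>R v) ((1 - t) *\<^sub>R u + t *\<^sub>R v) =
     (1 - t)\<^sup>2 * BR u u + 2 * (t * (1 - t)) * BR u v + t\<^sup>2 * BR v v"
    unfolding form_ext_add_left form_ext_add_right B_scaleR B_sym[of v u]
    by (simp add: power2_eq_square algebra_simps)
  moreover have "t * (1 - t) \<ge> 0" using t by simp
  then have "2 * (t * (1 - t)) * BR u v \<ge> 0" using p by simp
  moreover have "(1 - t)\<^sup>2 * BR u u + t\<^sup>2 * BR v v > 0"
  proof (cases "t = 0")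
    case False
    then have "t\<^sup>2 * BR v v > 0" using v by simp
    then show ?thesis using u by (simp add: add_nonneg_pos)
  qed (use u in simp)
  ultimately show ?thesis by linarith
qed

text \<open>
  The segment from \<open>w\<close> to \<open>w'\<close> stays in the tube domain of vectors \<open>z\<close> with \<open>(z,e2) = 1\<close> and \<open>Im z\<close> in the positive
  cone, which is convex. Subtracting \<open>(z,z)/2\<close> times \<open>e2\<close> makes its points isotropic. This changes neither \<open>(z,e2)\<close> nor the norm
  of \<open>Im z\<close>, as \<open>e2\<close> is isotropic and orthogonal to \<open>Im z\<close>.
\<close>

lemma period_path:
  assumes w: "form_ext b w w = 0" "form_ext b w (cv e2) = 1" "BR (imV w) (imV w) > 0" "BR (imV w) e1 > 0"
    and w': "form_ext b w' w' = 0" "form_ext b w' (cv e2) = 1" "BR (imV w') (imV w') > 0" "BR (imV w') e1 > 0"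
  obtains \<gamma> :: "real \<Rightarrow> complex^'m" where "continuous_on {0..1} \<gamma>" "\<gamma> 0 = w" "\<gamma> 1 = w'"
    "\<And>t. t \<in> {0..1} \<Longrightarrow> pline id (\<gamma> t) \<in> period_quadric b"
proof -
  define \<zeta> where "\<zeta> t = of_real (1 - t) *s w + of_real t *s w'" for t
  define \<gamma> where "\<gamma> t = \<zeta> t - (form_ext b (\<zeta> t) (\<zeta> t) / 2) *s cv e2" for t
  have c\<zeta>: "continuous_on {0..1} (\<lambda>t. \<zeta> t $ i)" for i
    unfolding \<zeta>_def by (simp, intro continuous_intros)
  have "continuous_on {0..1} (\<lambda>t. form_ext b (\<zeta> t) (\<zeta> t))"
    unfolding form_ext_def by (intro continuous_on_sum continuous_on_mult continuous_on_const c\<zeta>)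
  then have "continuous_on {0..1} (\<lambda>t. \<gamma> t $ i)" for i
    unfolding \<gamma>_def by (simp, intro continuous_intros c\<zeta>) auto
  then have "continuous_on {0..1} (\<lambda>t. \<chi> i. \<gamma> t $ i)"
    by (rule continuous_on_vec_lambda)
  then have 1: "continuous_on {0..1} \<gamma>" by simp
  have 2: "\<gamma> 0 = w" "\<gamma> 1 = w'" using w w' by (simp_all add: \<gamma>_def \<zeta>_def)
  have e2: "form_ext b (cv e2) (cv e2) = 0" by (simp add: form_ext_cv ee)
  have "pline id (\<gamma> t) \<in> period_quadric b" if t: "t \<in> {0..1}" for t
  proof -
    have z: "form_ext b (\<zeta> t) (cv e2) = 1"
      using w w' by (simp add: \<zeta>_def form_ext_linear)
    then have z': "form_ext b (cv e2) (\<zeta> t) = 1" using form_ext_commute[of b "cv e2" "\<zeta> t", OF b_sym] by simp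
    have iso: "form_ext b (\<gamma> t) (\<gamma> t) = 0"
      by (simp add: \<gamma>_def form_ext_linear z z' e2)
    have ge: "form_ext b (\<gamma> t) (cv e2) = 1" by (simp add: \<gamma>_def form_ext_linear z e2)
    have "\<gamma> t \<noteq> 0" using ge by (auto simp: form_ext_linear)
    moreover have "BR (imV (\<gamma> t)) (imV (\<gamma> t)) > 0"
    proof -
      have i\<zeta>: "imV (\<zeta> t) = (1 - t) *\<^sub>R imV w + t *\<^sub>R imV w'"
        unfolding \<zeta>_def by (simp only: imV_simps)
      have "BR (imV w) e2 = 0" "BR (imV w') e2 = 0"
        using w(2) w'(2) by (simp_all add: form_ext_cv_right complex_eq_iff)
      then have pos: "BR (imV (\<zeta> t)) (imV (\<zeta> t)) > 0"
        unfolding i\<zeta> using w w' t by (intro positive_cone_segment) auto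
      \<comment> \<open>So the correction by a multiple of \<open>e2\<close> leaves the norm of the imaginary part unchanged.\<close>
      have "BR (imV (\<zeta> t)) e2 = 0"
        using z by (simp add: form_ext_cv_right complex_eq_iff)
      then have "BR (imV (\<gamma> t)) (imV (\<gamma> t)) = BR (imV (\<zeta> t)) (imV (\<zeta> t))"
        by (simp add: \<gamma>_def imV_simps B_linear ee B_sym[of e2 "imV (\<zeta> t)"])
      with pos show ?thesis by simp
    qed
    then have "Re (form_ext b (\<gamma> t) (\<chi> i. cnj (\<gamma> t $ i))) > 0"
      using period_parts(3)[OF b_sym iso] by simp
    ultimately show ?thesis unfolding period_quadric_def using iso by blast
  qed
  with 1 2 show ?thesis using that by blast
qed

lemma same_component:
  assumes D: "period_domain b D" and x: "pline id w \<in> D"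
    and w: "form_ext b w w = 0" "form_ext b w (cv e2) = 1" "BR (imV w) (imV w) > 0" "BR (imV w) e1 > 0"
    and w': "form_ext b w' w' = 0" "form_ext b w' (cv e2) = 1" "BR (imV w') (imV w') > 0" "BR (imV w') e1 > 0"
  shows "pline id w' \<in> D"
proof -
  let ?T = "subtopology (top_of (proj_space id)) (period_quadric b)"
  obtain \<gamma> where \<gamma>: "continuous_on {0..1::real} \<gamma>" "\<gamma> 0 = w" "\<gamma> 1 = w'"
    "\<And>t. t \<in> {0..1} \<Longrightarrow> pline id (\<gamma> t) \<in> period_quadric b"
    using period_path[OF w w'] by blast
  have pp: "period_quadric b \<subseteq> proj_points id"
    by (auto simp: period_quadric_def proj_points_def)
  have "continuous_map (top_of_set {0..1}) (top_of (proj_space id)) (\<lambda>t. pline id (\<gamma> t))"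
    unfolding continuous_map_def
  proof (intro conjI allI impI)
    have "openin (top_of (proj_space (id :: complex^'m \<Rightarrow> complex^'m))) (proj_points id)"
    proof -
      have "{v :: complex^'m. pline id v \<in> proj_points id} = - {0}"
      proof safe
        assume "pline id (0 :: complex^'m) \<in> proj_points id"
        then obtain v :: "complex^'m" where v: "pline id 0 = pline id v" "v \<noteq> 0"
          by (auto simp: proj_points_def)
        have "1 *s v \<in> pline id v" unfolding pline_def by (rule range_eqI[where x = 1]) simp
        moreover have "pline id (0 :: complex^'m) = {0}" by (auto simp: pline_def)
        ultimately show False using v by auto
      qed (auto simp: proj_points_def)
      then show ?thesis by (auto simp: openin_proj_space)
    qed
    then have "proj_points id \<subseteq> topspace (top_of (proj_space (id :: complex^'m \<Rightarrow> complex^'m)))"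
      by (rule openin_subset)
    then have "pline id (\<gamma> t) \<in> topspace (top_of (proj_space id))" if "t \<in> {0..1}" for t
      using \<gamma>(4)[OF that] pp by blast
    then show "(\<lambda>t. pline id (\<gamma> t)) \<in> topspace (top_of_set {0..1}) \<rightarrow> topspace (top_of (proj_space id))"
      by simp
    fix U :: "(complex^'m) set set" assume "openin (top_of (proj_space id)) U"
    then have "open {v. pline id v \<in> U}" by (simp add: openin_proj_space)
    from continuous_openin_preimage_gen[OF \<gamma>(1) this]
    show "openin (top_of_set {0..1}) {t \<in> topspace (top_of_set {0..1}). pline id (\<gamma> t) \<in> U}"
      by (simp add: Int_def vimage_def)
  qed
  then have "continuous_map (top_of_set {0..1}) ?T (\<lambda>t. pline id (\<gamma> t))"
    using \<gamma>(4) by (auto simp: continuous_map_in_subtopology)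
  moreover have "connectedin (top_of_set {0..1::real}) {0..1}"
    by (simp add: connectedin_subtopology)
  ultimately have "connectedin ?T ((\<lambda>t. pline id (\<gamma> t)) ` {0..1})"
    by (rule connectedin_continuous_map_image)
  moreover have "pline id w \<in> (\<lambda>t. pline id (\<gamma> t)) ` {0..1}" "pline id w' \<in> (\<lambda>t. pline id (\<gamma> t)) ` {0..1}"
    using \<gamma>(2,3) by (auto intro: image_eqI[of _ _ 0] image_eqI[of _ _ 1])
  moreover have "D \<in> connected_components_of ?T" using D by (simp add: period_domain_def)
  ultimately show ?thesis
    using connected_components_of_maximal[of D ?T "(\<lambda>t. pline id (\<gamma> t)) ` {0..1}"] x
    by (auto simp: disjnt_iff)
qed

end


section \<open>The action of \<open>\<Gamma>(J)\<close>\<close>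

lemma invertible_bij_complexify:
  assumes "invertible g" shows "bij (complexify g)"
proof -
  obtain g' where g': "g ** g' = mat 1" "g' ** g = mat 1" using assms by (auto simp: invertible_def)
  have "complexify h (complexify k w) = w" if "h ** k = mat 1" for h k :: "real^'m^'m" and w
  proof -
    have "complexify h (complexify k w) = cv ((h ** k) *v reV w) + \<i> *s cv ((h ** k) *v imV w)"
      by (simp add: complexify_cv[of k] complexify_add complexify_scale map_matrix_vector_cv
          matrix_vector_mul_assoc)
    then show ?thesis using that cv_reV_imV[of w] by simp
  qed
  from this[OF g'(1)] this[OF g'(2)] show ?thesis by (intro o_bij[of "complexify g'"]) auto
qed

lemma isometry_complexify:
  assumes "\<And>x y. form_ext b (g *v x) (g *v y) = form_ext b x y"
  shows "form_ext b (complexify g u) (complexify g v) = form_ext b u v"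
proof -
  have "form_ext b (complexify g u) (complexify g v) =
     form_ext b (cv (reV u) + \<i> *s cv (imV u)) (cv (reV v) + \<i> *s cv (imV v))"
    by (simp add: complexify_cv form_ext_linear form_ext_cv assms)
  then show ?thesis using cv_reV_imV[of u] cv_reV_imV[of v] by simp
qed

lemma wedge_combination:
  "wedge (a *\<^sub>R u + c *\<^sub>R v) (a' *\<^sub>R u + c' *\<^sub>R v) = (a * c' - c * a') *\<^sub>R wedge u v"
  by (simp add: wedge_def vec_eq_iff algebra_simps)

lemma wedge_eq_0:
  assumes "wedge u v = 0" shows "u = 0 \<or> (\<exists>r. v = r *\<^sub>R u)"
proof (cases "u = 0")
  case False
  then obtain i where i: "u $ i \<noteq> 0" by (auto simp: vec_eq_iff)
  have "u $ i * v $ j = v $ i * u $ j" for j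
    using assms by (simp add: wedge_def vec_eq_iff)
  then have "v = (v $ i / u $ i) *\<^sub>R u" using i by (simp add: vec_eq_iff field_simps)
  then show ?thesis by blast
qed simp

text \<open>
  On the plane the wedge product is multiplied by the determinant, and it is nonzero on a basis.
\<close>

lemma GammaJ_matrix:
  assumes g: "g \<in> GammaJ b J"
    and J: "scalars_ext J = {a *s e1 + c *s e2 |a c. True}"
    and ind: "\<And>x y. x *\<^sub>R e1 + y *\<^sub>R e2 = 0 \<Longrightarrow> x = 0 \<and> y = (0 :: real)"
  obtains \<alpha> \<beta> \<gamma> \<delta> where "g *v e1 = \<alpha> *\<^sub>R e1 + \<beta> *\<^sub>R e2" "g *v e2 = \<gamma> *\<^sub>R e1 + \<delta> *\<^sub>R e2"
    "\<alpha> * \<delta> - \<beta> * \<gamma> = 1"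
proof -
  have "e1 = 1 *s e1 + 0 *s e2" "e2 = 0 *s e1 + 1 *s e2" by simp_all
  then have e: "e1 \<in> scalars_ext J" "e2 \<in> scalars_ext J" unfolding J by blast+
  have gJ: "(*v) g ` scalars_ext J = scalars_ext J"
    and w: "wedge (g *v e1) (g *v e2) = wedge e1 e2"
    using g e by (auto simp: GammaJ_def)
  have "g *v e1 \<in> scalars_ext J" "g *v e2 \<in> scalars_ext J" using gJ e by blast+
  then obtain \<alpha> \<beta> \<gamma> \<delta> where m: "g *v e1 = \<alpha> *\<^sub>R e1 + \<beta> *\<^sub>R e2" "g *v e2 = \<gamma> *\<^sub>R e1 + \<delta> *\<^sub>R e2"
    unfolding J smult_eq_scaleR by blast
  have "wedge e1 e2 \<noteq> 0"
  proof
    assume "wedge e1 e2 = 0"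
    from wedge_eq_0[OF this] show False
    proof
      assume "e1 = 0" then show False using ind[of 1 0] by simp
    next
      assume "\<exists>r. e2 = r *\<^sub>R e1"
      then obtain r where "e2 = r *\<^sub>R e1" by blast
      then show False using ind[of "- r" 1] by simp
    qed
  qed
  moreover have "(\<alpha> * \<delta> - \<beta> * \<gamma>) *\<^sub>R wedge e1 e2 = 1 *\<^sub>R wedge e1 e2"
    using w by (simp only: m wedge_combination scaleR_one)
  ultimately have "\<alpha> * \<delta> - \<beta> * \<gamma> = 1" by (metis scaleR_cancel_right)
  with m show ?thesis by (rule that)
qed

context isotropic_plane
begin

text \<open>
  With \<open>\<tau> = (w,e1)\<close>, the pairings \<open>s, s'\<close> of \<open>g w\<close> with \<open>e1, e2\<close> solve a linear system of determinant one, and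
  \<open>s / s' = (\<delta> \<tau> - \<beta>) / (\<alpha> - \<gamma> \<tau>)\<close>. So the action on the half plane is by a Moebius transformation, which preserves
  the sign of the imaginary part, and \<open>same_component\<close> applies to the normalised \<open>g w\<close>.
\<close>

lemma isometry_preserves_component:
  assumes D: "period_domain b D" and x: "pline id w \<in> D"
    and w: "form_ext b w w = 0" "form_ext b w (cv e2) = 1" "BR (imV w) (imV w) > 0" "BR (imV w) e1 > 0"
    and iso: "\<And>x y. BR (g *v x) (g *v y) = BR x y"
    and m: "g *v e1 = \<alpha> *\<^sub>R e1 + \<beta> *\<^sub>R e2" "g *v e2 = \<gamma> *\<^sub>R e1 + \<delta> *\<^sub>R e2" "\<alpha> * \<delta> - \<beta> * \<gamma> = 1"
  shows "pline id (complexify g w) \<in> D"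
proof -
  let ?v = "complexify g w"
  define s where "s = form_ext b ?v (cv e1)"
  define s' where "s' = form_ext b ?v (cv e2)"
  define \<tau> where "\<tau> = form_ext b w (cv e1)"
  have gcv: "complexify g (cv e1) = of_real \<alpha> *s cv e1 + of_real \<beta> *s cv e2"
    "complexify g (cv e2) = of_real \<gamma> *s cv e1 + of_real \<delta> *s cv e2"
    by (simp_all add: map_matrix_vector_cv m cv_simps)
  have E1: "of_real \<alpha> * s + of_real \<beta> * s' = \<tau>" and E2: "of_real \<gamma> * s + of_real \<delta> * s' = 1"
    using isometry_complexify[OF iso, of w "cv e1"] isometry_complexify[OF iso, of w "cv e2"] w(2)
    by (simp_all add: gcv form_ext_linear s_def s'_def \<tau>_def)
  have det: "of_real \<alpha> * of_real \<delta> - of_real \<beta> * of_real \<gamma> = (1 :: complex)"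
    using arg_cong[OF m(3), of complex_of_real] by simp
  have "(of_real \<alpha> * of_real \<delta> - of_real \<beta> * of_real \<gamma>) * s = of_real \<delta> * \<tau> - of_real \<beta>"
    unfolding E1[symmetric] using E2 by algebra
  then have s: "s = of_real \<delta> * \<tau> - of_real \<beta>" by (simp only: det mult_1)
  have "(of_real \<alpha> * of_real \<delta> - of_real \<beta> * of_real \<gamma>) * s' = of_real \<alpha> - of_real \<gamma> * \<tau>"
    unfolding E1[symmetric] using E2 by algebra
  then have s': "s' = of_real \<alpha> - of_real \<gamma> * \<tau>" by (simp only: det mult_1)
  have \<tau>: "Im \<tau> > 0" using w(4) by (simp add: \<tau>_def form_ext_cv_right)
  have "Im (s * cnj s') = (\<alpha> * \<delta> - \<beta> * \<gamma>) * Im \<tau>"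
    by (simp add: s s' algebra_simps)
  then have im: "Im (s * cnj s') > 0" using \<tau> m(3) by simp
  then have "s' \<noteq> 0" by auto
  define w' where "w' = (1 / s') *s ?v"
  have w'1: "form_ext b w' (cv e2) = 1" using \<open>s' \<noteq> 0\<close> by (simp add: w'_def form_ext_linear s'_def)
  have w'2: "form_ext b w' w' = 0"
    using isometry_complexify[OF iso, of w w] w(1) by (simp add: w'_def form_ext_linear)
  have "form_ext b w' (cv e1) = s / s'" by (simp add: w'_def form_ext_linear s_def)
  moreover have "Im (s / s') = Im (s * cnj s') / (cmod s')\<^sup>2"
    unfolding complex_div_cnj[of s s'] by (simp only: of_real_power[symmetric] Im_divide_of_real)
  ultimately have w'3: "BR (imV w') e1 > 0"
    using im \<open>s' \<noteq> 0\<close> by (simp add: form_ext_cv_right complex_eq_iff)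
  have "Re (form_ext b ?v (\<chi> i. cnj (?v $ i))) > 0"
  proof -
    have "imV ?v = g *v imV w"
      by (simp add: complexify_cv imV_def cv_def)
    moreover have "form_ext b ?v ?v = 0" using isometry_complexify[OF iso, of w w] w(1) by simp
    ultimately show ?thesis using period_parts(3)[where w = ?v, OF b_sym] w(3) by (simp add: iso)
  qed
  then have "Re (form_ext b w' (\<chi> i. cnj (w' $ i))) > 0"
    unfolding w'_def by (rule hermitian_scale_pos) (use \<open>s' \<noteq> 0\<close> in simp)
  then have w'4: "BR (imV w') (imV w') > 0"
    using period_parts(3)[OF b_sym w'2] by simp
  have "pline id w' \<in> D"
    by (rule same_component[OF D x w w'2 w'1 w'4 w'3])
  moreover have "pline id w' = pline id ?v"
    unfolding w'_def by (rule pline_scale) (use \<open>s' \<noteq> 0\<close> in simp)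
  ultimately show ?thesis by simp
qed

end

section \<open>Normalised periods and invariance of the period domain\<close>

context isotropic_plane
begin

lemma isotropic_plane_negate:
  "isotropic_plane b n (- e1) e2"
proof
  show "x = 0 \<and> y = 0" if "x *\<^sub>R (- e1) + y *\<^sub>R e2 = 0" for x y
    using ind[of "- x" y] that by simp
qed (use b_sym sig ee ee' in \<open>auto simp: form_ext_minus\<close>)

text \<open>
  By \<open>period_not_orthogonal\<close> both \<open>(u,e2)\<close> and, for the normalised period, \<open>(w,e1 - r e2)\<close> with \<open>r\<close> real are nonzero, so that
  \<open>(w,e1)\<close> is not real.
\<close>

lemma normalised_period:
  assumes "pline id v \<in> period_quadric b"
  obtains w where "pline id v = pline id w" "form_ext b w w = 0" "form_ext b w (cv e2) = 1"
    "BR (imV w) (imV w) > 0" "BR (imV w) e1 \<noteq> 0"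
proof -
  obtain u where u: "pline id v = pline id u" "form_ext b u u = 0" "Re (form_ext b u (\<chi> i. cnj (u $ i))) > 0"
    using assms by (auto simp: period_quadric_def)
  have pu: "BR (imV u) (imV u) > 0" using u period_parts(3)[where w = u, OF b_sym u(2)] by simp
  define c where "c = form_ext b u (cv e2)"
  have c: "c \<noteq> 0"
    using period_not_orthogonal[OF u(2) pu, of e2 0 1] by (auto simp: c_def)
  define w where "w = (1 / c) *s u"
  have 1: "form_ext b w (cv e2) = 1" using c by (simp add: w_def form_ext_linear c_def)
  have 2: "form_ext b w w = 0" by (simp add: w_def form_ext_linear u)
  have "Re (form_ext b w (\<chi> i. cnj (w $ i))) > 0"
    unfolding w_def by (rule hermitian_scale_pos) (use c u(3) in simp_all)
  then have 3: "BR (imV w) (imV w) > 0" using period_parts(3)[where w = w, OF b_sym 2] by simp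
  have 4: "BR (imV w) e1 \<noteq> 0"
  proof
    assume "BR (imV w) e1 = 0"
    moreover have "BR (imV w) e2 = 0" "BR (reV w) e2 = 1" using 1 by (simp_all add: form_ext_cv_right complex_eq_iff)
    ultimately have "form_ext b w (cv (1 *\<^sub>R e1 + (- BR (reV w) e1) *\<^sub>R e2)) = 0"
      by (simp add: form_ext_cv_right B_linear complex_eq_iff)
    from period_not_orthogonal[OF 2 3 refl this] show False by simp
  qed
  have "pline id w = pline id u"
    unfolding w_def by (rule pline_scale) (use c in simp)
  then show ?thesis
    using that[OF _ 2 1 3 4] u(1) by simp
qed

lemma period_domain_subset: "period_domain b D \<Longrightarrow> D \<subseteq> period_quadric b"
  using connected_components_of_subset[of D "subtopology (top_of (proj_space id)) (period_quadric b)"]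
  by (auto simp: period_domain_def)

text \<open>
  If the imaginary part of the period is negative on \<open>e1\<close>, the basis \<open>- e1, e2\<close> is used instead.
\<close>

lemma GammaJ_preserves_domain:
  assumes D: "period_domain b D" and g: "g \<in> GammaJ b J" and x: "x \<in> D"
    and J: "scalars_ext J = {a *s e1 + c *s e2 |a c. True}"
  shows "act_point g x \<in> D"
proof -
  have xQ: "x \<in> period_quadric b" using period_domain_subset[OF D] x by blast
  then obtain v where v: "x = pline id v" by (auto simp: period_quadric_def)
  obtain w where w: "x = pline id w" "form_ext b w w = 0" "form_ext b w (cv e2) = 1"
    "BR (imV w) (imV w) > 0" "BR (imV w) e1 \<noteq> 0"
    using normalised_period[of v] xQ v by auto
  have iso: "\<And>x y. BR (g *v x) (g *v y) = BR x y" using g by (simp add: GammaJ_def)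
  obtain \<alpha> \<beta> \<gamma> \<delta> where m: "g *v e1 = \<alpha> *\<^sub>R e1 + \<beta> *\<^sub>R e2" "g *v e2 = \<gamma> *\<^sub>R e1 + \<delta> *\<^sub>R e2"
    "\<alpha> * \<delta> - \<beta> * \<gamma> = 1"
    by (rule GammaJ_matrix[OF g J ind])
  have "pline id (complexify g w) \<in> D"
  proof (cases "BR (imV w) e1 > 0")
    case True
    show ?thesis
      by (rule isometry_preserves_component[OF D _ w(2-4) True iso m]) (use x w in simp)
  next
    case False
    interpret neg: isotropic_plane b n "- e1" e2 by (rule isotropic_plane_negate)
    have minus: "g *v (- e1) = - (g *v e1)"
      by (simp add: matrix_vector_mult_def vec_eq_iff sum_negf)
    have "BR (imV w) (- e1) > 0" using False w(5) by (simp add: form_ext_minus)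
    moreover have "g *v (- e1) = \<alpha> *\<^sub>R (- e1) + (- \<beta>) *\<^sub>R e2" "g *v e2 = (- \<gamma>) *\<^sub>R (- e1) + \<delta> *\<^sub>R e2"
      "\<alpha> * \<delta> - (- \<beta>) * (- \<gamma>) = 1"
      using m by (simp_all add: minus)
    ultimately show ?thesis
      by (intro neg.isometry_preserves_component[OF D _ w(2-4) _ iso]) (use x w in simp)
  qed
  also have "pline id (complexify g w) = act_point g x"
    by (auto simp: w(1) act_point_def pline_id complexify_scale image_iff)
  finally show ?thesis .
qed

end

section \<open>The graded pieces of the filtration\<close>

text \<open>
  The proof exhibits the data of \<open>hodge_setup\<close>: the basis of \<open>J\<close> comes from the rank, the dual vectors from a
  nonzero minor, and the properties of \<open>\<Gamma>(J)\<^sub>\<real>\<close> pass from real to complex vectors by linearity.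
\<close>

theorem proposition8p2:
  fixes b :: "int^'m \<Rightarrow> int^'m \<Rightarrow> int"
    and n :: nat
    and J :: "(int^'m) set"
    and D :: "(complex^'m) set set"
  assumes "lattice_form b"
    and "signature (form_ext b) 2 n"
    and "n \<ge> 3"
    and "sublattice J" and "primitive J" and "isotropic b J" and "has_rank J 2"
    and "period_domain b D"
  shows "equiv_iso (domain_space D) (GammaJ b J) act_point
           (EJ b J D)
           (pullback_bundle (domain_space D) (HJ_space b J D) (pi_J b J) (LJ b J D)) \<and>
         equiv_iso (domain_space D) (GammaJ b J) act_point
           (quotient_bundle (domain_space D) (EJ_perp b J D) (EJ_fibre b J))
           (trivial_bundle (domain_space D) (VJ b J) (\<lambda>g v. v)) \<and>
         equiv_iso (domain_space D) (GammaJ b J) act_point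
           (quotient_bundle (domain_space D) (second_hodge b D) (EJ_perp_fibre b J D))
           (pullback_bundle (domain_space D) (HJ_space b J D) (pi_J b J)
              (dual_bundle (HJ_space b J D) (LJ b J D)))"
proof -
  interpret integral_form b by standard (rule assms(1))
  obtain j1 j2 where J: "J = {k *s j1 + l *s j2 |k l. True}"
    and ind: "\<And>k l. k *s j1 + l *s j2 = 0 \<Longrightarrow> k = 0 \<and> l = 0"
    by (rule rank_2_basis[OF assms(7)]) (rule that)
  obtain p q where minor: "b (axis p 1) j1 * b (axis q 1) j2 - b (axis q 1) j1 * b (axis p 1) j2 \<noteq> 0"
    by (rule nonzero_minor[OF ind])
  obtain f1 f2 :: "complex^'m" where f: "form_ext b f1 (emb j1) = 1" "form_ext b f1 (emb j2) = 0"
    "form_ext b f2 (emb j1) = 0" "form_ext b f2 (emb j2) = 1"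
    by (rule dual_basis[OF minor])
  obtain h1 h2 :: "real^'m" where h: "form_ext b h1 (emb j1) = 1" "form_ext b h1 (emb j2) = 0"
    "form_ext b h2 (emb j1) = 0" "form_ext b h2 (emb j2) = 1"
    by (rule dual_basis[OF minor])
  define e1 where "e1 = (emb j1 :: real^'m)"
  define e2 where "e2 = (emb j2 :: real^'m)"
  have cve: "cv e1 = emb j1" "cv e2 = emb j2" by (simp_all add: e1_def e2_def cv_emb)
  have "j1 = 1 *s j1 + 0 *s j2" "j2 = 0 *s j1 + 1 *s j2" by simp_all
  then have "j1 \<in> J" "j2 \<in> J" unfolding J by blast+
  then have jj: "b j1 j1 = 0" "b j1 j2 = 0" "b j2 j2 = 0"
    using assms(6) by (auto simp: isotropic_def)
  interpret isotropic_plane b n e1 e2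
  proof
    show "form_ext b e1 e1 = 0" "form_ext b e1 e2 = 0" "form_ext b e2 e2 = 0"
      by (simp_all add: e1_def e2_def form_ext_emb_emb jj)
    fix x y :: real assume "x *\<^sub>R e1 + y *\<^sub>R e2 = 0"
    then have "form_ext b h1 (x *s e1 + y *s e2) = 0" "form_ext b h2 (x *s e1 + y *s e2) = 0"
      by (simp_all add: smult_eq_scaleR form_ext_zero)
    then show "x = 0 \<and> y = 0" using h by (simp add: form_ext_linear e1_def e2_def)
  qed (use b_sym assms(2) in auto)
  have JR: "scalars_ext J = {a *s e1 + c *s e2 |a c. True}"
    unfolding e1_def e2_def by (rule scalars_ext_rank_2[OF J])
  have JCx: "scalars_ext J = {a *s cv e1 + c *s cv e2 |a c. True}"
    unfolding cve by (rule scalars_ext_rank_2[OF J])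
  have KCx: "scalars_ext (lperp b J) = {v. form_ext b v (cv e1) = 0 \<and> form_ext b v (cv e2) = 0}"
    unfolding cve by (rule scalars_ext_lperp[OF J minor])
  have cvJ: "cv v \<in> scalars_ext J" if v: "v \<in> scalars_ext J" for v
  proof -
    obtain a c where "v = a *s e1 + c *s e2" using v unfolding JR by blast
    then have "cv v = of_real a *s cv e1 + of_real c *s cv e2" by (simp add: cv_simps)
    then show ?thesis unfolding JCx by blast
  qed
  have hodge: "hodge_setup b J D (GammaJ b J) (cv e1) (cv e2) f1 f2"
  proof (rule hodge_setup.intro)
    show "b x y = b y x" for x y by (rule b_sym)
    show "scalars_ext J = {a *s cv e1 + c *s cv e2 |a c. True}" by (rule JCx)
    show "scalars_ext (lperp b J) = {v. form_ext b v (cv e1) = 0 \<and> form_ext b v (cv e2) = 0}" by (rule KCx)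
    show "form_ext b (cv e1) (cv e1) = 0" "form_ext b (cv e1) (cv e2) = 0" "form_ext b (cv e2) (cv e2) = 0"
      by (simp_all add: form_ext_cv ee)
    show "form_ext b f1 (cv e1) = 1" "form_ext b f1 (cv e2) = 0" "form_ext b f2 (cv e1) = 0" "form_ext b f2 (cv e2) = 1"
      by (simp_all add: cve f)
    show "\<exists>w. x = pline id w \<and> form_ext b w (cv e2) = 1 \<and> form_ext b w w = 0" if "x \<in> D" for x
    proof -
      have "x \<in> period_quadric b" using period_domain_subset[OF assms(8)] that by blast
      moreover then obtain v where "x = pline id v" by (auto simp: period_quadric_def)
      ultimately show ?thesis using normalised_period[of v] by metis
    qed
    fix g assume g: "g \<in> GammaJ b J"
    have iso: "\<And>x y. form_ext b (g *v x) (g *v y) = form_ext b x y" using g by (simp add: GammaJ_def)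
    show "bij (complexify g)" using g by (intro invertible_bij_complexify) (simp add: GammaJ_def)
    show isoC: "form_ext b (complexify g u) (complexify g v) = form_ext b u v" for u v
      by (rule isometry_complexify[OF iso])
    show "act_point g x \<in> D" if "x \<in> D" for x
      by (rule GammaJ_preserves_domain[OF assms(8) g that JR])
    obtain \<alpha> \<beta> \<gamma> \<delta> where m: "g *v e1 = \<alpha> *\<^sub>R e1 + \<beta> *\<^sub>R e2" "g *v e2 = \<gamma> *\<^sub>R e1 + \<delta> *\<^sub>R e2"
      "\<alpha> * \<delta> - \<beta> * \<gamma> = 1"
      by (rule GammaJ_matrix[OF g JR ind])
    let ?\<alpha> = "complex_of_real \<alpha>" and ?\<beta> = "complex_of_real \<beta>"
      and ?\<gamma> = "complex_of_real \<gamma>" and ?\<delta> = "complex_of_real \<delta>"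
    have gcv: "complexify g (cv e1) = ?\<alpha> *s cv e1 + ?\<beta> *s cv e2"
      "complexify g (cv e2) = ?\<gamma> *s cv e1 + ?\<delta> *s cv e2"
      by (simp_all add: map_matrix_vector_cv m cv_simps)
    have det: "?\<alpha> * ?\<delta> - ?\<beta> * ?\<gamma> = 1"
      using arg_cong[OF m(3), of complex_of_real] by simp
    have g_comb: "complexify g (a *s cv e1 + c *s cv e2) =
        (a * ?\<alpha> + c * ?\<gamma>) *s cv e1 + (a * ?\<beta> + c * ?\<delta>) *s cv e2" for a c
      by (simp add: complexify_add complexify_scale gcv vec_eq_iff algebra_simps)
    show "complexify g ` scalars_ext J = scalars_ext J"
      unfolding JCx
    proof
      show "complexify g ` {a *s cv e1 + c *s cv e2 |a c. True} \<subseteq> {a *s cv e1 + c *s cv e2 |a c. True}"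
        using g_comb by blast
      show "{a *s cv e1 + c *s cv e2 |a c. True} \<subseteq> complexify g ` {a *s cv e1 + c *s cv e2 |a c. True}"
      proof clarify
        fix a c
        have "(a * ?\<delta> - c * ?\<gamma>) * ?\<alpha> + (c * ?\<alpha> - a * ?\<beta>) * ?\<gamma> = a * (?\<alpha> * ?\<delta> - ?\<beta> * ?\<gamma>)"
          "(a * ?\<delta> - c * ?\<gamma>) * ?\<beta> + (c * ?\<alpha> - a * ?\<beta>) * ?\<delta> = c * (?\<alpha> * ?\<delta> - ?\<beta> * ?\<gamma>)"
          by (simp_all add: algebra_simps)
        then have "complexify g ((a * ?\<delta> - c * ?\<gamma>) *s cv e1 + (c * ?\<alpha> - a * ?\<beta>) *s cv e2) =
            a *s cv e1 + c *s cv e2"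
          by (simp only: g_comb det mult_1_right)
        from this[symmetric]
        show "a *s cv e1 + c *s cv e2 \<in> complexify g ` {a *s cv e1 + c *s cv e2 |a c. True}"
          by (rule image_eqI) blast
      qed
    qed
    show "form_ext b (complexify g v) (cv e1) *s cv e2 - form_ext b (complexify g v) (cv e2) *s cv e1 =
         complexify g (form_ext b v (cv e1) *s cv e2 - form_ext b v (cv e2) *s cv e1)" for v
    proof -
      define s where "s = form_ext b (complexify g v) (cv e1)"
      define s' where "s' = form_ext b (complexify g v) (cv e2)"
      have t: "form_ext b v (cv e1) = ?\<alpha> * s + ?\<beta> * s'" "form_ext b v (cv e2) = ?\<gamma> * s + ?\<delta> * s'"
        using isoC[of v "cv e1"] isoC[of v "cv e2"]
        by (simp_all add: gcv form_ext_linear s_def s'_def)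
      have "complexify g ((- form_ext b v (cv e2)) *s cv e1 + form_ext b v (cv e1) *s cv e2) =
         (- (?\<alpha> * ?\<delta> - ?\<beta> * ?\<gamma>) * s') *s cv e1 + ((?\<alpha> * ?\<delta> - ?\<beta> * ?\<gamma>) * s) *s cv e2"
        unfolding g_comb t by (intro arg_cong2[where f = "(+)"] arg_cong2[where f = "(*s)"] refl)
          (simp_all add: algebra_simps)
      also have "\<dots> = s *s cv e2 - s' *s cv e1" by (simp add: det)
      finally show ?thesis by (simp add: s_def s'_def)
    qed
    show "complexify g v - v \<in> scalars_ext J" if "v \<in> scalars_ext (lperp b J)" for v
    proof -
      have sub: "vec.subspace (scalars_ext J :: (complex^'m) set)" by (simp add: scalars_ext_def)
      have emb: "complexify g (emb y) - emb y \<in> scalars_ext J" if "y \<in> lperp b J" for y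
      proof -
        have "(emb y :: real^'m) \<in> scalars_ext (lperp b J)"
          unfolding scalars_ext_emb using that by (intro vec.span_base) blast
        then have "g *v emb y - emb y \<in> scalars_ext J" using g by (auto simp: GammaJ_def)
        from cvJ[OF this] show ?thesis
          by (simp only: cv_simps map_matrix_vector_cv[symmetric] cv_emb)
      qed
      show ?thesis
        using that unfolding scalars_ext_emb[of "lperp b J"]
      proof (induction v rule: vec.span_induct_alt)
        case base
        show ?case using vec.subspace_0[OF sub] complexify_scale[of g 0 0] by simp
      next
        case (step c u v)
        then have "complexify g u - u \<in> scalars_ext J" using emb by blast
        then have "c *s (complexify g u - u) + (complexify g v - v) \<in> scalars_ext J"
          by (intro vec.subspace_add[OF sub] vec.subspace_scale[OF sub] step.IH)
        moreover have "complexify g (c *s u + v) - (c *s u + v) = c *s (complexify g u - u) + (complexify g v - v)"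
          by (simp add: complexify_add complexify_scale vec.scale_right_diff_distrib)
        ultimately show ?case by (simp only:)
      qed
    qed
  qed
  show ?thesis
    using hodge_setup.EJ_iso[OF hodge] hodge_setup.Gr1_iso[OF hodge] hodge_setup.Gr2_iso[OF hodge] by blast
qed

end
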